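(* Let $d\in\{1,2,3\}$, let $Y$ be the unit cell with $|Y|=1$, let $G,\rho$ be as in the context, fix $j\in\{1,\dots,d\}$ and fixed $\hat{\boldsymbol k}\in\mathbb R^d$, $\hat\omega\in\mathbb R$ with $\boldsymbol\mu^{(0)}:(i\hat{\boldsymbol k})^2+\rho_0\hat\omega^2\neq0$. In the long-wavelength, low-frequency regime $\boldsymbol k=\epsilon\hat{\boldsymbol k}$, $\omega=\epsilon\hat\omega$, $\epsilon\to0$, let $\tilde v_j$ be the unit-cell response to the unit dipole source (eigenstrain) $\tilde{\boldsymbol\gamma}=\boldsymbol e_j$, and suppose that its mean admits the asymptotic expansion $\langle\tilde v_j\rangle=\sum_{n=0}^{3}\epsilon^{n-2}\langle\tilde v_{jn}\rangle+O(\epsilon^2)$, where the $\tilde v_{jn}$ solve the hierarchy of cell problems given in the context. Then $$\tilde{\mathcal Z}^e_2\,\langle\tilde v_j\rangle=\tilde N_2+O(\epsilon^4),$$ where $$\tilde{\mathcal Z}^e_2=\epsilon^2\big(\boldsymbol\mu^{(0)}:(i\hat{\boldsymbol k})^2+\rho_0\hat\omega^2\big)+\epsilon^4\big(\boldsymbol\mu^{(2)}:(i\hat{\boldsymbol k})^4+\boldsymbol\rho^{(2)}:(i\hat{\boldsymbol k})^2\,\hat\omega^2\big)$$ and $$\begin{aligned}\tilde N_2=\ &\epsilon\,\boldsymbol\mu^{(0)}:(\boldsymbol e_j\otimes i\hat{\boldsymbol k})-\epsilon^2\Big\{\boldsymbol\mu^{(0)}\otimes\frac{\boldsymbol\rho^{(1)}}{\rho_0}\Big\}':\big(\boldsymbol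 e_j\otimes(i\hat{\boldsymbol k})^2\big)+\epsilon^2\tilde{\boldsymbol\mu}^{(1)}:\big(\boldsymbol e_j\otimes(i\hat{\boldsymbol k})^2\big)+\epsilon^2\hat\omega^2\boldsymbol\rho^{(1)}\cdot\boldsymbol e_j\\&+\epsilon^3\tilde{\boldsymbol\mu}^{(2)}:\big(\boldsymbol e_j\otimes(i\hat{\boldsymbol k})^3\big)+\epsilon^3\hat\omega^2\,\tilde{\boldsymbol\rho}^{(2)}:(\boldsymbol e_j\otimes i\hat{\boldsymbol k})-\epsilon^3\hat\omega^2\langle\rho\boldsymbol\chi^{(1)}\otimes\boldsymbol\chi^{(1)}\rangle:(\boldsymbol e_j\otimes i\hat{\boldsymbol k}).\end{aligned}$$
   Context: **Setting.** $Y=\{\boldsymbol x\in\mathbb R^d:0<x_j<\ell_j\}$; $G,\rho$ are real-valued, $Y$-periodic, in $L^\infty(Y)$ and bounded below by a positive constant. $\langle g\rangle=|Y|^{-1}\int_Yg$. $H^1_p(Y)$ is the space of $g\in L^2(Y)$ with $\nabla g\in L^2(Y)^d$ and $g|_{x_j=0}=g|_{x_j=\ell_j}$, $j=1,\dots,d$. All differential equations are posed in $Y$ with periodic boundary conditions: the unknown is in $H^1_p(Y)$ (componentwise) and the flux appearing under the outer divergence is periodic; equivalently, they hold weakly against all test functions in $H^1_p(Y)$. **Tensor conventions.** $\nabla\boldsymbol g=\boldsymbol e_j\otimes\partial\boldsymbol g/\partial x_j$ (the derivative index comes first); $\nabla\cdot$ contracts with the first index; $\boldsymbol I$ is the identity.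 $(i\hat{\boldsymbol k})^n=i\hat{\boldsymbol k}\otimes\dots\otimes i\hat{\boldsymbol k}$ ($n$ times); ":" is full contraction of two tensors of equal order, index by index in order, without conjugation. $(\cdot)^{T}$ swaps the first two indices of a tensor of order 2, 3 or 4. $\{\boldsymbol\tau\}$ is the average of $\boldsymbol\tau$ over all permutations of its indices; $\{\boldsymbol\tau\}'$ is the average over all permutations of all indices except the first. **Dipole response.** $\tilde v_j\in H^1_p(Y)$ solves $-\omega^2\rho\tilde v_j-\nabla_{\boldsymbol k}\cdot\big(G(\nabla_{\boldsymbol k}\tilde v_j-\boldsymbol e_j)\big)=0$ in $Y$ with $\nabla_{\boldsymbol k}=\nabla+i\boldsymbol k$. Inserting $\boldsymbol k=\epsilon\hat{\boldsymbol k}$, $\omega=\epsilon\hat\omega$ and $\tilde v_j=\epsilon^{-2}\tilde v_{j0}+\epsilon^{-1}\tilde v_{j1}+\tilde v_{j2}+\epsilon\tilde v_{j3}+\cdots$ gives the hierarchy, with $\tilde v_{j(-1)}=\tilde v_{j(-2)}=0$ and $n=0,1,\dots,5$, $$-\nabla\cdot\big(G(\nabla\tilde v_{jn}+i\hat{\boldsymbol k}\tilde v_{j(n-1)}-\delta_{n2}\boldsymbol e_j)\big)-i\hat{\boldsymbol k}\cdot G\big(\nabla\tilde v_{j(n-1)}+i\hat{\boldsymbol k}\tilde v_{j(n-2)}-\delta_{n3}\boldsymbol e_j\big)-\hat\omega^2\rho\,\tilde v_{j(n-2)}=0,$$ with $\tilde v_{jn}\in H^1_p(Y)$. **Cell functions**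 (unique zero-mean periodic solutions): - $\boldsymbol\chi^{(1)}$: $\nabla\cdot(G(\nabla\boldsymbol\chi^{(1)}+\boldsymbol I))=0$. - $\boldsymbol\chi^{(2)}$: $\nabla\cdot\big(G(\nabla\boldsymbol\chi^{(2)}+\{\boldsymbol I\otimes\boldsymbol\chi^{(1)}\}')\big)+G(\{\nabla\boldsymbol\chi^{(1)}\}+\boldsymbol I)-\frac{\rho}{\rho_0}\boldsymbol\mu^{(0)}=0$. - $\boldsymbol\chi^{(3)}$: $\nabla\cdot\big(G(\nabla\boldsymbol\chi^{(3)}+\{\boldsymbol I\otimes\boldsymbol\chi^{(2)}\}')\big)+G(\{\nabla\boldsymbol\chi^{(2)}\}+\{\boldsymbol I\otimes\boldsymbol\chi^{(1)}\})-\frac1{\rho_0}\{\rho\boldsymbol\chi^{(1)}\otimes\boldsymbol\mu^{(0)}\}=0$. - $\tilde{\boldsymbol\chi}^{(2)}$ (2nd order, non-symmetric): $\nabla\cdot(G\nabla\tilde{\boldsymbol\chi}^{(2)})+\big(\nabla\cdot(G\boldsymbol I\otimes\boldsymbol\chi^{(1)})\big)^T+G\big((\nabla\boldsymbol\chi^{(1)})^T+\boldsymbol I\big)-\frac{\rho}{\rho_0}\boldsymbol\mu^{(0)}=0$, with periodic $\boldsymbol\nu\cdot G\nabla\tilde{\boldsymbol\chi}^{(2)}+(\boldsymbol\nu\cdot(G\boldsymbol I\otimes\boldsymbol\chi^{(1)}))^T$ flux. - $\tilde{\boldsymbol\chi}^{(3)}$ (3rd order, non-symmetric): $\nabla\cdot(G\nabla\tilde{\boldsymbol\chi}^{(3)})+\big(\nabla\cdot(G\boldsymbol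 I\otimes\tilde{\boldsymbol\chi}^{(2)})\big)^T+G\big(\boldsymbol\chi^{(1)}\otimes\boldsymbol I+\{(\nabla\tilde{\boldsymbol\chi}^{(2)})^T\}'\big)-\tilde{\boldsymbol\mu}^{(1)}-\Big\{\boldsymbol\mu^{(0)}\otimes\frac{\rho\boldsymbol\chi^{(1)}-\boldsymbol\rho^{(1)}}{\rho_0}\Big\}'=0$, with periodic $\boldsymbol\nu\cdot G\nabla\tilde{\boldsymbol\chi}^{(3)}+(\boldsymbol\nu\cdot(G\boldsymbol I\otimes\tilde{\boldsymbol\chi}^{(2)}))^T$ flux. **Coefficients.** $\rho_0=\langle\rho\rangle$, $\boldsymbol\mu^{(0)}=\{\langle G(\nabla\boldsymbol\chi^{(1)}+\boldsymbol I)\rangle\}$, $\boldsymbol\rho^{(1)}=\langle\rho\boldsymbol\chi^{(1)}\rangle$, $\boldsymbol\rho^{(2)}=\langle\rho\boldsymbol\chi^{(2)}\rangle$, $\boldsymbol\mu^{(2)}=\{\langle G(\nabla\boldsymbol\chi^{(3)}+\boldsymbol I\otimes\boldsymbol\chi^{(2)})\rangle\}$, $\tilde{\boldsymbol\mu}^{(1)}=\{\langle G((\nabla\tilde{\boldsymbol\chi}^{(2)})^T+\boldsymbol\chi^{(1)}\otimes\boldsymbol I)\rangle\}'$, $\tilde{\boldsymbol\mu}^{(2)}=\{\langle G((\nabla\tilde{\boldsymbol\chi}^{(3)})^T+\tilde{\boldsymbol\chi}^{(2)}\otimes\boldsymbol I)\rangle\}'$, $\tilde{\boldsymbol\rho}^{(2)}=\langle\rho\tilde{\boldsymbol\chi}^{(2)}\rangle$.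 *)

theory Defs
  imports
    "HOL-Analysis.Analysis"
    "HOL-Combinatorics.List_Permutation"
    "HOL-Library.Landau_Symbols"
begin

definition cell_mean :: "real^'d \<Rightarrow> (real^'d \<Rightarrow> 'b::{banach, second_countable_topology}) \<Rightarrow> 'b" where
  "cell_mean l g =
     (1 / measure lebesgue (box 0 l)) *\<^sub>R integral\<^sup>L (lebesgue_on (box 0 l)) g"

definition coefficient :: "real^'d \<Rightarrow> (real^'d \<Rightarrow> real) \<Rightarrow> bool" where
  "coefficient l c \<longleftrightarrow>
     (\<forall>x j. c (x + (l $ j) *\<^sub>R axis j 1) = c x) \<and>
     c \<in> borel_measurable (lebesgue_on (box 0 l)) \<and>
     (\<exists>M. AE x in lebesgue_on (box 0 l). \<bar>c x\<bar> \<le> M) \<and>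
     (\<exists>m>0. AE x in lebesgue_on (box 0 l). m \<le> c x)"

definition L2_on :: "(real^'d) set \<Rightarrow> (real^'d \<Rightarrow> 'b::real_normed_vector) \<Rightarrow> bool" where
  "L2_on Y g \<longleftrightarrow> g \<in> borel_measurable (lebesgue_on Y) \<and>
     integrable (lebesgue_on Y) (\<lambda>x. (norm (g x))\<^sup>2)"

text \<open>\<open>D ix\<close> is the iterated partial derivative of \<open>\<phi>\<close> along the list of directions \<open>ix\<close>.\<close>

definition smooth :: "(real^'d \<Rightarrow> complex) \<Rightarrow> bool" where
  "smooth \<phi> \<longleftrightarrow> (\<exists>D :: 'd list \<Rightarrow> real^'d \<Rightarrow> complex. D [] = \<phi> \<and>
     (\<forall>ix x. (D ix has_derivative (\<lambda>h. \<Sum>a\<in>UNIV. of_real (h $ a) * D (a # ix) x)) (at x)))"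

definition classical_grad :: "(real^'d \<Rightarrow> complex) \<Rightarrow> real^'d \<Rightarrow> complex^'d" where
  "classical_grad \<phi> x = (\<chi> a. frechet_derivative \<phi> (at x) (axis a 1))"

definition H1 :: "(real^'d) set \<Rightarrow> (real^'d \<Rightarrow> complex) \<Rightarrow> (real^'d \<Rightarrow> complex^'d) \<Rightarrow> bool" where
  "H1 Y g Dg \<longleftrightarrow> L2_on Y g \<and> L2_on Y Dg \<and>
     (\<forall>\<phi>. smooth \<phi> \<and> compact (closure {x. \<phi> x \<noteq> 0}) \<and> closure {x. \<phi> x \<noteq> 0} \<subseteq> Y \<longrightarrow>
        (\<forall>a. (LINT x|lebesgue_on Y. g x * classical_grad \<phi> x $ a)
              = - (LINT x|lebesgue_on Y. Dg x $ a * \<phi> x)))"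

text \<open>
  \<open>has_trace l g Dg j s t\<close>: \<open>t\<close> is the trace of \<open>g\<close> (with weak gradient \<open>Dg\<close>) on the face
  \<open>x $ j = s\<close>, i.e. the \<open>L\<^sup>2\<close>-limit of the face values of smooth functions that converge to \<open>g\<close>
  in \<open>H\<^sup>1\<close>. A function on the face is represented by a function on the whole space that does not
  depend on \<open>x $ j\<close>, so that integration over the cell is \<open>l $ j\<close> times integration over the face.
\<close>

definition has_trace :: "real^'d \<Rightarrow> (real^'d \<Rightarrow> complex) \<Rightarrow> (real^'d \<Rightarrow> complex^'d) \<Rightarrow>
    'd \<Rightarrow> real \<Rightarrow> (real^'d \<Rightarrow> complex) \<Rightarrow> bool" where
  "has_trace l g Dg j s t \<longleftrightarrow>
     (\<forall>x y. (\<forall>i. i \<noteq> j \<longrightarrow> x $ i = y $ i) \<longrightarrow> t x = t y) \<and>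
     L2_on (box 0 l) t \<and>
     (\<exists>\<psi> :: nat \<Rightarrow> real^'d \<Rightarrow> complex. (\<forall>m. smooth (\<psi> m)) \<and>
        (\<lambda>m. LINT x|lebesgue_on (box 0 l). (norm (\<psi> m x - g x))\<^sup>2) \<longlonglongrightarrow> 0 \<and>
        (\<lambda>m. LINT x|lebesgue_on (box 0 l). (norm (classical_grad (\<psi> m) x - Dg x))\<^sup>2) \<longlonglongrightarrow> 0 \<and>
        (\<lambda>m. LINT x|lebesgue_on (box 0 l).
           (norm (\<psi> m (\<chi> i. if i = j then s else x $ i) - t x))\<^sup>2) \<longlonglongrightarrow> 0)"

text \<open>
  \<open>H1p l g Dg\<close>: \<open>g\<close> belongs to the periodic space \<open>H\<^sup>1\<^sub>p(Y)\<close> and \<open>Dg\<close> is its weak gradient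
  (determined by \<open>g\<close> up to null sets).
\<close>

definition H1p :: "real^'d \<Rightarrow> (real^'d \<Rightarrow> complex) \<Rightarrow> (real^'d \<Rightarrow> complex^'d) \<Rightarrow> bool" where
  "H1p l g Dg \<longleftrightarrow> H1 (box 0 l) g Dg \<and>
     (\<forall>j. \<exists>t. has_trace l g Dg j 0 t \<and> has_trace l g Dg j (l $ j) t)"

definition bdot :: "complex^'d \<Rightarrow> complex^'d \<Rightarrow> complex" where
  "bdot u w = (\<Sum>a\<in>UNIV. u $ a * w $ a)"

text \<open>
  \<open>weak_eq l F f\<close> is \<open>\<nabla>\<cdot>F + f = 0\<close> in the cell with periodic flux \<open>F\<close>, in weak form.
\<close>

definition weak_eq :: "real^'d \<Rightarrow> (real^'d \<Rightarrow> complex^'d) \<Rightarrow> (real^'d \<Rightarrow> complex) \<Rightarrow> bool" where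
  "weak_eq l F f \<longleftrightarrow> (\<forall>\<phi> D\<phi>. H1p l \<phi> D\<phi> \<longrightarrow>
     (LINT x|lebesgue_on (box 0 l). bdot (F x) (D\<phi> x)) = (LINT x|lebesgue_on (box 0 l). f x * \<phi> x))"

text \<open>
  A tensor of order \<open>n\<close> is given by its components, indexed by lists of length \<open>n\<close>; the values at
  lists of other lengths are irrelevant. Symmetrisations read the order off the index list, the
  tensor product is annotated with the order of its left factor and the full contraction with
  the common order of its arguments.
\<close>

type_synonym 'd tensor = "'d list \<Rightarrow> complex"

definition tvec :: "complex^'d \<Rightarrow> 'd tensor" where
  "tvec u ix = u $ hd ix"

definition tI :: "'d tensor" where
  "tI ix = (if ix ! 0 = ix ! 1 then 1 else 0)"

definition tprod :: "'d tensor \<Rightarrow> nat \<Rightarrow> 'd tensor \<Rightarrow> 'd tensor"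
    ("(_ \<otimes>\<^bsub>_\<^esub> _)" [71, 0, 70] 70) where
  "(\<sigma> \<otimes>\<^bsub>m\<^esub> \<tau>) ix = \<sigma> (take m ix) * \<tau> (drop m ix)"

primrec tpow :: "complex^'d \<Rightarrow> nat \<Rightarrow> 'd tensor" where
  "tpow u 0 = (\<lambda>_. 1)"
| "tpow u (Suc n) = tvec u \<otimes>\<^bsub>1\<^esub> tpow u n"

definition contract :: "nat \<Rightarrow> 'd tensor \<Rightarrow> 'd tensor \<Rightarrow> complex" where
  "contract n \<sigma> \<tau> = (\<Sum>ix | length ix = n. \<sigma> ix * \<tau> ix)"

text \<open>Average over all permutations of the indices.\<close>

definition tsym :: "'d tensor \<Rightarrow> 'd tensor" where
  "tsym \<tau> ix =
     (\<Sum>p | p permutes {..<length ix}. \<tau> (permute_list p ix)) / fact (length ix)"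

text \<open>Average over all permutations of the indices other than the first.\<close>

definition tsym' :: "'d tensor \<Rightarrow> 'd tensor" where
  "tsym' \<tau> ix =
     (\<Sum>p | p permutes {1..<length ix}. \<tau> (permute_list p ix)) / fact (length ix - 1)"

fun ttransp :: "'d tensor \<Rightarrow> 'd tensor" where
  "ttransp \<tau> (a # b # ix) = \<tau> (b # a # ix)"
| "ttransp \<tau> ix = \<tau> ix"

text \<open>
  Flux form of a transposed divergence: \<open>(\<nabla>\<cdot>\<tau>)\<^sup>T\<close> is the divergence, in the first index, of
  \<open>flux_transp \<tau>\<close>, and \<open>(\<nu>\<cdot>\<tau>)\<^sup>T = \<nu>\<cdot>flux_transp \<tau>\<close>.
\<close>

definition flux_transp :: "'d tensor \<Rightarrow> 'd tensor" where
  "flux_transp \<tau> ix = ttransp (\<lambda>jx. \<tau> (hd ix # jx)) (tl ix)"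

definition tmean :: "real^'d \<Rightarrow> (real^'d \<Rightarrow> 'd tensor) \<Rightarrow> 'd tensor" where
  "tmean l \<tau> ix = cell_mean l (\<lambda>x. \<tau> x ix)"

text \<open>
  \<open>tensor_H1p0 l n g Dg\<close>: \<open>g\<close> is a tensor field of order \<open>n\<close> whose components are zero-mean
  elements of \<open>H\<^sup>1\<^sub>p(Y)\<close>, and \<open>Dg\<close> is its gradient, with the derivative index first.
\<close>

definition tensor_H1p0 :: "real^'d \<Rightarrow> nat \<Rightarrow> (real^'d \<Rightarrow> 'd tensor) \<Rightarrow> (real^'d \<Rightarrow> 'd tensor) \<Rightarrow> bool"
  where
  "tensor_H1p0 l n g Dg \<longleftrightarrow> (\<forall>ix. length ix = n \<longrightarrow>
     H1p l (\<lambda>x. g x ix) (\<lambda>x. \<chi> a. Dg x (a # ix)) \<and> cell_mean l (\<lambda>x. g x ix) = 0)"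

definition tensor_eq :: "real^'d \<Rightarrow> nat \<Rightarrow> (real^'d \<Rightarrow> 'd tensor) \<Rightarrow> (real^'d \<Rightarrow> 'd tensor) \<Rightarrow> bool"
  where
  "tensor_eq l n F f \<longleftrightarrow> (\<forall>ix. length ix = n \<longrightarrow>
     weak_eq l (\<lambda>x. \<chi> a. F x (a # ix)) (\<lambda>x. f x ix))"

text \<open>
  The arguments are the cell functions, each followed by its gradient. They are allowed to be
  complex-valued; by uniqueness of the solutions they are real (almost everywhere).
\<close>

definition cell1 :: "real^'d \<Rightarrow> (real^'d \<Rightarrow> real) \<Rightarrow>
    (real^'d \<Rightarrow> 'd tensor) \<Rightarrow> (real^'d \<Rightarrow> 'd tensor) \<Rightarrow> bool" where
  "cell1 l G \<chi>\<^sub>1 D\<chi>\<^sub>1 \<longleftrightarrow> tensor_H1p0 l 1 \<chi>\<^sub>1 D\<chi>\<^sub>1 \<and>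
     tensor_eq l 1 (\<lambda>x ix. of_real (G x) * (D\<chi>\<^sub>1 x ix + tI ix)) (\<lambda>x ix. 0)"

definition cell2 :: "real^'d \<Rightarrow> (real^'d \<Rightarrow> real) \<Rightarrow> (real^'d \<Rightarrow> real) \<Rightarrow> 'd tensor \<Rightarrow>
    (real^'d \<Rightarrow> 'd tensor) \<Rightarrow> (real^'d \<Rightarrow> 'd tensor) \<Rightarrow>
    (real^'d \<Rightarrow> 'd tensor) \<Rightarrow> (real^'d \<Rightarrow> 'd tensor) \<Rightarrow> bool" where
  "cell2 l G \<rho> \<mu>\<^sub>0 \<chi>\<^sub>1 D\<chi>\<^sub>1 \<chi>\<^sub>2 D\<chi>\<^sub>2 \<longleftrightarrow> tensor_H1p0 l 2 \<chi>\<^sub>2 D\<chi>\<^sub>2 \<and>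
     tensor_eq l 2
       (\<lambda>x ix. of_real (G x) * (D\<chi>\<^sub>2 x ix + tsym' (tI \<otimes>\<^bsub>2\<^esub> \<chi>\<^sub>1 x) ix))
       (\<lambda>x ix. of_real (G x) * (tsym (D\<chi>\<^sub>1 x) ix + tI ix)
          - of_real (\<rho> x / cell_mean l \<rho>) * \<mu>\<^sub>0 ix)"

definition cell3 :: "real^'d \<Rightarrow> (real^'d \<Rightarrow> real) \<Rightarrow> (real^'d \<Rightarrow> real) \<Rightarrow> 'd tensor \<Rightarrow>
    (real^'d \<Rightarrow> 'd tensor) \<Rightarrow>
    (real^'d \<Rightarrow> 'd tensor) \<Rightarrow> (real^'d \<Rightarrow> 'd tensor) \<Rightarrow>
    (real^'d \<Rightarrow> 'd tensor) \<Rightarrow> (real^'d \<Rightarrow> 'd tensor) \<Rightarrow> bool" where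
  "cell3 l G \<rho> \<mu>\<^sub>0 \<chi>\<^sub>1 \<chi>\<^sub>2 D\<chi>\<^sub>2 \<chi>\<^sub>3 D\<chi>\<^sub>3 \<longleftrightarrow> tensor_H1p0 l 3 \<chi>\<^sub>3 D\<chi>\<^sub>3 \<and>
     tensor_eq l 3
       (\<lambda>x ix. of_real (G x) * (D\<chi>\<^sub>3 x ix + tsym' (tI \<otimes>\<^bsub>2\<^esub> \<chi>\<^sub>2 x) ix))
       (\<lambda>x ix. of_real (G x) * (tsym (D\<chi>\<^sub>2 x) ix + tsym (tI \<otimes>\<^bsub>2\<^esub> \<chi>\<^sub>1 x) ix)
          - of_real (1 / cell_mean l \<rho>) * tsym (\<lambda>jx. of_real (\<rho> x) * (\<chi>\<^sub>1 x \<otimes>\<^bsub>1\<^esub> \<mu>\<^sub>0) jx) ix)"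

definition tilde_cell2 :: "real^'d \<Rightarrow> (real^'d \<Rightarrow> real) \<Rightarrow> (real^'d \<Rightarrow> real) \<Rightarrow> 'd tensor \<Rightarrow>
    (real^'d \<Rightarrow> 'd tensor) \<Rightarrow> (real^'d \<Rightarrow> 'd tensor) \<Rightarrow>
    (real^'d \<Rightarrow> 'd tensor) \<Rightarrow> (real^'d \<Rightarrow> 'd tensor) \<Rightarrow> bool" where
  "tilde_cell2 l G \<rho> \<mu>\<^sub>0 \<chi>\<^sub>1 D\<chi>\<^sub>1 \<chi>t\<^sub>2 D\<chi>t\<^sub>2 \<longleftrightarrow> tensor_H1p0 l 2 \<chi>t\<^sub>2 D\<chi>t\<^sub>2 \<and>
     tensor_eq l 2
       (\<lambda>x ix. of_real (G x) * D\<chi>t\<^sub>2 x ix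
          + flux_transp (\<lambda>jx. of_real (G x) * (tI \<otimes>\<^bsub>2\<^esub> \<chi>\<^sub>1 x) jx) ix)
       (\<lambda>x ix. of_real (G x) * (ttransp (D\<chi>\<^sub>1 x) ix + tI ix)
          - of_real (\<rho> x / cell_mean l \<rho>) * \<mu>\<^sub>0 ix)"

definition tilde_cell3 :: "real^'d \<Rightarrow> (real^'d \<Rightarrow> real) \<Rightarrow> (real^'d \<Rightarrow> real) \<Rightarrow>
    'd tensor \<Rightarrow> 'd tensor \<Rightarrow> 'd tensor \<Rightarrow> (real^'d \<Rightarrow> 'd tensor) \<Rightarrow>
    (real^'d \<Rightarrow> 'd tensor) \<Rightarrow> (real^'d \<Rightarrow> 'd tensor) \<Rightarrow>
    (real^'d \<Rightarrow> 'd tensor) \<Rightarrow> (real^'d \<Rightarrow> 'd tensor) \<Rightarrow> bool" where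
  "tilde_cell3 l G \<rho> \<mu>\<^sub>0 \<rho>\<^sub>1 \<mu>t\<^sub>1 \<chi>\<^sub>1 \<chi>t\<^sub>2 D\<chi>t\<^sub>2 \<chi>t\<^sub>3 D\<chi>t\<^sub>3 \<longleftrightarrow> tensor_H1p0 l 3 \<chi>t\<^sub>3 D\<chi>t\<^sub>3 \<and>
     tensor_eq l 3
       (\<lambda>x ix. of_real (G x) * D\<chi>t\<^sub>3 x ix
          + flux_transp (\<lambda>jx. of_real (G x) * (tI \<otimes>\<^bsub>2\<^esub> \<chi>t\<^sub>2 x) jx) ix)
       (\<lambda>x ix. of_real (G x) * ((\<chi>\<^sub>1 x \<otimes>\<^bsub>1\<^esub> tI) ix + tsym' (ttransp (D\<chi>t\<^sub>2 x)) ix)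
          - \<mu>t\<^sub>1 ix
          - tsym' (\<mu>\<^sub>0 \<otimes>\<^bsub>2\<^esub>
              (\<lambda>jx. (of_real (\<rho> x) * \<chi>\<^sub>1 x jx - \<rho>\<^sub>1 jx) / of_real (cell_mean l \<rho>))) ix)"

definition ivec :: "real^'d \<Rightarrow> complex^'d" where
  "ivec k = (\<chi> a. \<i> * of_real (k $ a))"

definition dipole_response :: "real^'d \<Rightarrow> (real^'d \<Rightarrow> real) \<Rightarrow> (real^'d \<Rightarrow> real) \<Rightarrow> real^'d \<Rightarrow> real \<Rightarrow>
    'd \<Rightarrow> (real^'d \<Rightarrow> complex) \<Rightarrow> (real^'d \<Rightarrow> complex^'d) \<Rightarrow> bool" where
  "dipole_response l G \<rho> k \<omega> j v Dv \<longleftrightarrow> H1p l v Dv \<and>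
     (let F = (\<lambda>x. of_real (G x) *s (Dv x + v x *s ivec k - axis j 1)) in
      weak_eq l F (\<lambda>x. bdot (ivec k) (F x) + of_real (\<omega>\<^sup>2 * \<rho> x) * v x))"

definition dipole_hierarchy :: "real^'d \<Rightarrow> (real^'d \<Rightarrow> real) \<Rightarrow> (real^'d \<Rightarrow> real) \<Rightarrow> real^'d \<Rightarrow> real \<Rightarrow>
    'd \<Rightarrow> (int \<Rightarrow> real^'d \<Rightarrow> complex) \<Rightarrow> (int \<Rightarrow> real^'d \<Rightarrow> complex^'d) \<Rightarrow> bool" where
  "dipole_hierarchy l G \<rho> k \<omega> j v Dv \<longleftrightarrow>
     (\<forall>n\<in>{-2, -1}. v n = (\<lambda>x. 0) \<and> Dv n = (\<lambda>x. 0)) \<and>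
     (\<forall>n\<in>{0..5}. H1p l (v n) (Dv n) \<and>
        weak_eq l
          (\<lambda>x. of_real (G x) *s
             (Dv n x + v (n - 1) x *s ivec k - (if n = 2 then axis j 1 else 0)))
          (\<lambda>x. bdot (ivec k) (of_real (G x) *s
             (Dv (n - 1) x + v (n - 2) x *s ivec k - (if n = 3 then axis j 1 else 0)))
           + of_real (\<omega>\<^sup>2 * \<rho> x) * v (n - 2) x))"

end

theory Submission
  imports Defs
begin

text \<open>
  Contracting the cell problems with \<open>\<kappa> = i k\<close> turns them into scalar problems for functions
  \<open>w\<^sub>1, w\<^sub>2, w\<^sub>3\<close> (and, with one index in the dipole direction, \<open>X, t\<^sub>2, t\<^sub>3\<close>).
  A periodic solution is determined by its mean, so the hierarchy gives, with \<open>m\<^sub>n\<close> the mean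
  of \<open>v\<^sub>n\<close>: \<open>v\<^sub>0 = m\<^sub>0\<close>, \<open>v\<^sub>1 = m\<^sub>0 w\<^sub>1 + m\<^sub>1\<close>, \<open>v\<^sub>2 = m\<^sub>1 w\<^sub>1 - X + m\<^sub>2\<close> and
  \<open>v\<^sub>3 = m\<^sub>1 w\<^sub>2 - t\<^sub>2 + m\<^sub>2 w\<^sub>1 + m\<^sub>3\<close>; here \<open>m\<^sub>0 = 0\<close> by nondegeneracy. Testing the problems of
  order 2 to 5 with the constant 1 gives one equation for each \<open>m\<^sub>n\<close>. The function \<open>v\<^sub>4\<close> is not
  needed: its contribution is found by testing its problem with \<open>w\<^sub>1\<close> and that of \<open>w\<^sub>1\<close> with \<open>v\<^sub>4\<close>.
\<close>

subsection \<open>Square integrable functions\<close>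

text \<open>The obstacle is order 5. Its solvability condition contains the mean flux of
  \<open>v 4\<close>, which is not a combination of the given cell functions: its source contains
  the density-weighted field \<open>X\<close> inherited from \<open>v 2\<close>, and no cell problem
  is posed for that source. By symmetry of the energy form only the data of the \<open>v 4\<close>
  problem survive, and pairing them with \<open>w\<^sub>1\<close> is what leaves the mean of
  \<open>\<rho> \<chi>\<^sub>1 \<otimes> \<chi>\<^sub>1\<close> in the numerator. The companion term
  with \<open>w\<^sub>1\<close> twice cancels by the order 3 equation.

  That a solution is fixed by its mean rests on one fact: a periodic function with zero weak
  gradient is constant a.e. The trace condition supplies smooth functions that converge in H^1 on
  the whole cell, so a Poincare inequality for smooth functions is enough, and an L^1 version
  suffices because only a vanishing gradient is at stake.

  Symmetrisations disappear under contraction, since powers of \<kappa> are symmetric and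
  \<open>e \<otimes> \<kappa>^n\<close> is symmetric in all indices but the first. The exception is
  \<open>\<mu>\<^sub>0\<close> against \<open>e \<otimes> \<kappa>\<close>, which calls for the
  symmetry of the homogenised tensor.\<close>

lemma borel_measurable_vec:
  fixes f :: "'a \<Rightarrow> complex^'d"
  assumes "\<And>a. (\<lambda>x. f x $ a) \<in> borel_measurable M"
  shows "f \<in> borel_measurable M"
proof (rule borel_measurable_euclidean_space[THEN iffD2], intro ballI)
  fix b :: "complex^'d" assume "b \<in> Basis"
  then obtain i u where b: "b = axis i u"
    by (auto simp: Basis_vec_def)
  have "(\<lambda>x. f x $ i \<bullet> u) \<in> borel_measurable M"
    by (intro borel_measurable_inner assms) auto
  then show "(\<lambda>x. f x \<bullet> b) \<in> borel_measurable M"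
    by (simp add: b inner_axis)
qed

lemma norm_power2_vec: "(norm (v :: complex^'d))\<^sup>2 = (\<Sum>a\<in>UNIV. (norm (v $ a))\<^sup>2)"
  unfolding norm_vec_def L2_set_def by (simp add: sum_nonneg)

lemma norm_add_power2_le:
  fixes a b :: "'a::real_normed_vector"
  shows "(norm (a + b))\<^sup>2 \<le> 2 * (norm a)\<^sup>2 + 2 * (norm b)\<^sup>2"
proof -
  have "(norm (a + b))\<^sup>2 \<le> (norm a + norm b)\<^sup>2"
    by (intro power_mono norm_triangle_ineq) auto
  also have "\<dots> \<le> 2 * (norm a)\<^sup>2 + 2 * (norm b)\<^sup>2"
    using zero_le_power2[of "norm a - norm b"] by (simp add: power2_eq_square algebra_simps)
  finally show ?thesis .
qed

lemma L2_on_bound: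
  fixes f :: "real^'d \<Rightarrow> 'b::real_normed_vector" and g :: "real^'d \<Rightarrow> 'c::real_normed_vector"
  assumes f: "L2_on Y f" and g: "g \<in> borel_measurable (lebesgue_on Y)"
    and le: "AE x in lebesgue_on Y. norm (g x) \<le> K * norm (f x)"
  shows "L2_on Y g"
  unfolding L2_on_def
proof (intro conjI g)
  have [measurable]: "g \<in> borel_measurable (lebesgue_on Y)" by fact
  have "integrable (lebesgue_on Y) (\<lambda>x. K\<^sup>2 * (norm (f x))\<^sup>2)"
    using f by (auto simp: L2_on_def)
  then show "integrable (lebesgue_on Y) (\<lambda>x. (norm (g x))\<^sup>2)"
  proof (rule Bochner_Integration.integrable_bound)
    show "AE x in lebesgue_on Y. norm ((norm (g x))\<^sup>2) \<le> norm (K\<^sup>2 * (norm (f x))\<^sup>2)"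
      using le
    proof eventually_elim
      case (elim x)
      then have "(norm (g x))\<^sup>2 \<le> (K * norm (f x))\<^sup>2"
        by (intro power_mono) auto
      then show ?case by (simp add: power_mult_distrib)
    qed
  qed measurable
qed

lemma L2_on_add:
  fixes f g :: "real^'d \<Rightarrow> 'b::{real_normed_vector, second_countable_topology}"
  assumes f: "L2_on Y f" and g: "L2_on Y g"
  shows "L2_on Y (\<lambda>x. f x + g x)"
  unfolding L2_on_def
proof (intro conjI)
  have [measurable]: "f \<in> borel_measurable (lebesgue_on Y)" "g \<in> borel_measurable (lebesgue_on Y)"
    using f g by (auto simp: L2_on_def)
  show "(\<lambda>x. f x + g x) \<in> borel_measurable (lebesgue_on Y)" by measurable
  have "integrable (lebesgue_on Y) (\<lambda>x. 2 * (norm (f x))\<^sup>2 + 2 * (norm (g x))\<^sup>2)"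
    using f g by (auto simp: L2_on_def)
  then show "integrable (lebesgue_on Y) (\<lambda>x. (norm (f x + g x))\<^sup>2)"
    by (rule Bochner_Integration.integrable_bound)
      (auto intro!: AE_I2 norm_add_power2_le order_trans[OF norm_add_power2_le abs_ge_self])
qed

lemma L2_on_bounded_linear:
  fixes f :: "real^'d \<Rightarrow> 'b::real_normed_vector"
  assumes T: "bounded_linear T" and f: "L2_on Y f"
  shows "L2_on Y (\<lambda>x. T (f x))"
proof -
  obtain K where K: "\<And>u. norm (T u) \<le> norm u * K"
    using bounded_linear.bounded[OF T] by blast
  show ?thesis
  proof (rule L2_on_bound[OF f, of _ K])
    have "T \<in> borel_measurable borel"
      using T by (intro borel_measurable_continuous_onI) (simp add: linear_continuous_on)
    then show "(\<lambda>x. T (f x)) \<in> borel_measurable (lebesgue_on Y)"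
      using f by (auto simp: L2_on_def intro: measurable_compose)
  qed (use K in \<open>auto simp: mult.commute\<close>)
qed

lemma L2_on_nth: "L2_on Y f \<Longrightarrow> L2_on Y (\<lambda>x. (f x :: complex^'d) $ a)"
  by (rule L2_on_bounded_linear[OF bounded_linear_vec_nth])

lemma L2_on_vec:
  fixes f :: "real^'d \<Rightarrow> complex^'n"
  assumes f: "\<And>a. L2_on Y (\<lambda>x. f x $ a)"
  shows "L2_on Y f"
  using f unfolding L2_on_def norm_power2_vec
  by (auto intro!: borel_measurable_vec)

lemma L2_on_cmult: "L2_on Y f \<Longrightarrow> L2_on Y (\<lambda>x. c * f x :: complex)"
  by (rule L2_on_bounded_linear[OF bounded_linear_mult_right])

lemma L2_on_zero: "L2_on Y (\<lambda>x. 0 :: 'b :: real_normed_vector)"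
  by (auto simp: L2_on_def)

lemma L2_on_diff:
  fixes f g :: "real^'d \<Rightarrow> 'b::{real_normed_vector, second_countable_topology}"
  assumes f: "L2_on Y f" and g: "L2_on Y g"
  shows "L2_on Y (\<lambda>x. f x - g x)"
  using L2_on_add[OF f L2_on_bounded_linear[OF bounded_linear_minus[OF bounded_linear_ident] g]] by simp

lemma L2_on_sum:
  fixes f :: "'i \<Rightarrow> real^'d \<Rightarrow> 'b::{real_normed_vector, second_countable_topology}"
  shows "(\<And>i. i \<in> A \<Longrightarrow> L2_on Y (f i)) \<Longrightarrow> L2_on Y (\<lambda>x. \<Sum>i\<in>A. f i x)"
  by (induction A rule: infinite_finite_induct) (auto intro: L2_on_zero L2_on_add)

lemma integrable_L2_mult:
  fixes f g :: "real^'d \<Rightarrow> complex"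
  assumes f: "L2_on Y f" and g: "L2_on Y g"
  shows "integrable (lebesgue_on Y) (\<lambda>x. f x * g x)"
proof -
  have [measurable]: "f \<in> borel_measurable (lebesgue_on Y)" "g \<in> borel_measurable (lebesgue_on Y)"
    using f g by (auto simp: L2_on_def)
  have "integrable (lebesgue_on Y) (\<lambda>x. (norm (f x))\<^sup>2 + (norm (g x))\<^sup>2)"
    using f g by (auto simp: L2_on_def)
  then show ?thesis
  proof (rule Bochner_Integration.integrable_bound)
    show "AE x in lebesgue_on Y. norm (f x * g x) \<le> norm ((norm (f x))\<^sup>2 + (norm (g x))\<^sup>2)"
    proof (intro AE_I2)
      fix x
      have "2 * norm (f x) * norm (g x) \<le> (norm (f x))\<^sup>2 + (norm (g x))\<^sup>2"
        by (rule sum_squares_bound)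
      moreover have "0 \<le> norm (f x) * norm (g x)" by simp
      ultimately have "norm (f x) * norm (g x) \<le> (norm (f x))\<^sup>2 + (norm (g x))\<^sup>2"
        by linarith
      then show "norm (f x * g x) \<le> norm ((norm (f x))\<^sup>2 + (norm (g x))\<^sup>2)"
        by (simp add: norm_mult)
    qed
  qed measurable
qed

lemma integrable_L2_bdot:
  assumes "L2_on Y F" "L2_on Y H"
  shows "integrable (lebesgue_on Y) (\<lambda>x. bdot (F x) (H x))"
  unfolding bdot_def by (intro Bochner_Integration.integrable_sum integrable_L2_mult L2_on_nth assms)

text \<open>Continuity holds on the whole space, hence on the compact closure of the cell, where the
  squared norm is integrable; on the open box alone a continuous function may blow up at the
  boundary.\<close>

lemma L2_on_box_continuous:
  fixes f :: "real^'d \<Rightarrow> 'b::real_normed_vector"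
  assumes f: "continuous_on UNIV f"
  shows "L2_on (box 0 l) f"
  unfolding L2_on_def
proof
  have c: "continuous_on (cbox 0 l) (\<lambda>x. (norm (f x))\<^sup>2)"
    using f by (intro continuous_intros) (auto intro: continuous_on_subset)
  have "f \<in> borel_measurable borel"
    using f by (rule borel_measurable_continuous_onI)
  then have "f \<in> borel_measurable lebesgue"
    by (simp add: measurable_completion)
  then show "f \<in> borel_measurable (lebesgue_on (box 0 l))"
    by (rule measurable_restrict_space1)
  have "integrable (lebesgue_on (cbox 0 l)) (\<lambda>x. (norm (f x))\<^sup>2)"
    using c by (intro continuous_imp_integrable) 
  then show "integrable (lebesgue_on (box 0 l)) (\<lambda>x. (norm (f x))\<^sup>2)"
    using set_integrable_subset[of lebesgue "cbox 0 l" "\<lambda>x. (norm (f x))\<^sup>2" "box 0 l"]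
    by (simp add: integrable_restrict_space set_integrable_def box_subset_cbox)
qed

subsection \<open>Smooth functions\<close>

text \<open>Every member of the family \<open>D\<close> is differentiable and therefore continuous.
  Since uniqueness of the derivative identifies the singletons \<open>D [a]\<close> with the
  components of \<open>classical_grad\<close>, the gradient is continuous too.\<close>

lemma smooth_witness:
  assumes "smooth \<phi>"
  obtains D where "D [] = \<phi>"
    "\<And>ix x. (D ix has_derivative (\<lambda>h. \<Sum>a\<in>UNIV. of_real (h $ a) * D (a # ix) x)) (at x)"
    "\<And>x a. classical_grad \<phi> x $ a = D [a] x"
    "\<And>ix. continuous_on UNIV (D ix)"
proof -
  from assms obtain D where D0: "D [] = \<phi>"
    and D: "\<And>ix x. (D ix has_derivative (\<lambda>h. \<Sum>a\<in>UNIV. of_real (h $ a) * D (a # ix) x)) (at x)"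
    unfolding smooth_def by blast
  have "classical_grad \<phi> x $ a = D [a] x" for x a
  proof -
    have "(\<lambda>h. \<Sum>a\<in>UNIV. of_real (h $ a) * D [a] x) = frechet_derivative \<phi> (at x)"
      using D[of "[]" x] D0 by (auto intro: frechet_derivative_at)
    from fun_cong[OF this, of "axis a 1", symmetric]
    show ?thesis
      by (simp add: classical_grad_def axis_def if_distrib[of of_real] if_distrib[of "\<lambda>u. u * _"] cong: if_cong)
  qed
  moreover have "continuous_on UNIV (D ix)" for ix
    using D[of ix] by (intro continuous_at_imp_continuous_on ballI) (auto intro: has_derivative_continuous)
  ultimately show ?thesis using that D0 D by blast
qed

lemma smooth_continuous: "smooth \<phi> \<Longrightarrow> continuous_on UNIV \<phi>"
  by (erule smooth_witness) metis

lemma classical_grad_continuous: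
  assumes "smooth \<phi>"
  shows "continuous_on UNIV (classical_grad \<phi>)"
proof -
  obtain D where "\<And>x a. classical_grad \<phi> x $ a = D [a] x" "\<And>ix. continuous_on UNIV (D ix)"
    by (rule smooth_witness[OF assms], rule that)
  then have "classical_grad \<phi> = (\<lambda>x. \<chi> a. D [a] x)" "continuous_on UNIV (\<lambda>x. \<chi> a. D [a] x)"
    by (auto simp: vec_eq_iff fun_eq_iff intro!: continuous_on_vec_lambda)
  then show ?thesis by simp
qed

lemma smooth_has_derivative:
  assumes "smooth \<phi>"
  shows "(\<phi> has_derivative (\<lambda>h. \<Sum>a\<in>UNIV. of_real (h $ a) * classical_grad \<phi> x $ a)) (at x)"
proof -
  obtain D where D: "D [] = \<phi>"
    "\<And>ix. (D ix has_derivative (\<lambda>h. \<Sum>a\<in>UNIV. of_real (h $ a) * D (a # ix) x)) (at x)"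
    "\<And>a. classical_grad \<phi> x $ a = D [a] x"
    by (rule smooth_witness[OF assms], rule that)
  show ?thesis
    using D(2)[of "[]"] unfolding D(1) D(3) .
qed

lemma classical_gradI:
  assumes "\<And>x. (\<phi> has_derivative (\<lambda>h. \<Sum>a\<in>UNIV. of_real (h $ a) * p x $ a)) (at x)"
  shows "classical_grad \<phi> = p"
proof (intro ext vec_eq_iff[THEN iffD2] allI)
  fix x a
  have "(\<lambda>h. \<Sum>a\<in>UNIV. of_real (h $ a) * p x $ a) = frechet_derivative \<phi> (at x)"
    using assms by (rule frechet_derivative_at)
  from fun_cong[OF this, of "axis a 1", symmetric]
  show "classical_grad \<phi> x $ a = p x $ a"
    by (simp add: classical_grad_def axis_def if_distrib[of of_real] if_distrib[of "\<lambda>u. u * _"] cong: if_cong)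
qed

text \<open>\<open>T\<close> is linear over the reals only, so that one lemma serves both
  multiplication by a complex constant and conjugation.\<close>

lemma smooth_bounded_linear:
  assumes T: "bounded_linear (T :: complex \<Rightarrow> complex)" and \<phi>: "smooth \<phi>"
  shows "smooth (\<lambda>x. T (\<phi> x))"
    and "classical_grad (\<lambda>x. T (\<phi> x)) = (\<lambda>x. \<chi> a. T (classical_grad \<phi> x $ a))"
proof -
  have Tr: "T (of_real r * u) = of_real r * T u" for r u
    using linear_scale[OF bounded_linear.linear[OF T], of r u] by (simp add: scaleR_conv_of_real)
  have Ts: "T (\<Sum>a\<in>A. f a) = (\<Sum>a\<in>A. T (f a))" for f and A :: "'x set"
    using linear_sum[OF bounded_linear.linear[OF T]] .
  obtain D where D: "D [] = \<phi>"
    "\<And>ix x. (D ix has_derivative (\<lambda>h. \<Sum>a\<in>UNIV. of_real (h $ a) * D (a # ix) x)) (at x)"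
    by (rule smooth_witness[OF \<phi>], rule that)
  have "((\<lambda>x. T (D ix x)) has_derivative (\<lambda>h. \<Sum>a\<in>UNIV. of_real (h $ a) * T (D (a # ix) x))) (at x)" for ix x
    using bounded_linear.has_derivative[OF T D(2)[of ix x]] by (simp add: Ts Tr)
  then show "smooth (\<lambda>x. T (\<phi> x))"
    unfolding smooth_def using D(1) by (intro exI[of _ "\<lambda>ix x. T (D ix x)"]) auto
  show "classical_grad (\<lambda>x. T (\<phi> x)) = (\<lambda>x. \<chi> a. T (classical_grad \<phi> x $ a))"
    using bounded_linear.has_derivative[OF T smooth_has_derivative[OF \<phi>]]
    by (intro classical_gradI) (simp add: Ts Tr)
qed

lemma smooth_add:
  assumes \<phi>: "smooth \<phi>" and \<psi>: "smooth \<psi>"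
  shows "smooth (\<lambda>x. \<phi> x + \<psi> x)"
    and "classical_grad (\<lambda>x. \<phi> x + \<psi> x) = (\<lambda>x. classical_grad \<phi> x + classical_grad \<psi> x)"
proof -
  obtain D where D: "D [] = \<phi>"
    "\<And>ix x. (D ix has_derivative (\<lambda>h. \<Sum>a\<in>UNIV. of_real (h $ a) * D (a # ix) x)) (at x)"
    by (rule smooth_witness[OF \<phi>], rule that)
  obtain E where E: "E [] = \<psi>"
    "\<And>ix x. (E ix has_derivative (\<lambda>h. \<Sum>a\<in>UNIV. of_real (h $ a) * E (a # ix) x)) (at x)"
    by (rule smooth_witness[OF \<psi>], rule that)
  have "((\<lambda>x. D ix x + E ix x) has_derivative
      (\<lambda>h. \<Sum>a\<in>UNIV. of_real (h $ a) * (D (a # ix) x + E (a # ix) x))) (at x)" for ix x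
    using has_derivative_add[OF D(2)[of ix x] E(2)[of ix x]] by (simp add: sum.distrib distrib_left)
  then show "smooth (\<lambda>x. \<phi> x + \<psi> x)"
    unfolding smooth_def using D(1) E(1) by (intro exI[of _ "\<lambda>ix x. D ix x + E ix x"]) auto
  show "classical_grad (\<lambda>x. \<phi> x + \<psi> x) = (\<lambda>x. classical_grad \<phi> x + classical_grad \<psi> x)"
    using has_derivative_add[OF smooth_has_derivative[OF \<phi>] smooth_has_derivative[OF \<psi>]]
    by (intro classical_gradI) (simp add: sum.distrib distrib_left)
qed

lemma smooth_const:
  shows "smooth (\<lambda>x. c)" and "classical_grad (\<lambda>x. c) = (\<lambda>x. 0)"
proof -
  show "smooth (\<lambda>x. c)"
    unfolding smooth_def
    by (intro exI[of _ "\<lambda>ix x. if ix = [] then c else 0"]) (auto intro: has_derivative_const)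
  show "classical_grad (\<lambda>x. c) = (\<lambda>x. 0)"
    by (rule classical_gradI) (simp add: has_derivative_const)
qed

subsection \<open>The periodic Sobolev space is a vector space closed under conjugation\<close>

text \<open>The form of the three limits in \<open>has_trace\<close>. The integral of a
  non-integrable function is 0 by convention, so the limit alone does not carry information; the
  rules below therefore ask for membership in L^2 separately.\<close>

definition L2_conv :: "(real^'d) set \<Rightarrow> (nat \<Rightarrow> real^'d \<Rightarrow> 'b::real_normed_vector) \<Rightarrow>
    (real^'d \<Rightarrow> 'b) \<Rightarrow> bool" where
  "L2_conv Y f g \<longleftrightarrow> (\<lambda>m. LINT x|lebesgue_on Y. (norm (f m x - g x))\<^sup>2) \<longlonglongrightarrow> 0"

lemma L2_conv_add:
  fixes f f' :: "nat \<Rightarrow> real^'d \<Rightarrow> 'b::{real_normed_vector, second_countable_topology}"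
  assumes f: "\<And>m. L2_on Y (f m)" "L2_on Y g" "L2_conv Y f g"
    and f': "\<And>m. L2_on Y (f' m)" "L2_on Y g'" "L2_conv Y f' g'"
  shows "L2_conv Y (\<lambda>m x. f m x + f' m x) (\<lambda>x. g x + g' x)"
proof -
  let ?I = "\<lambda>f (g :: real^'d \<Rightarrow> 'b) m. LINT x|lebesgue_on Y. (norm (f m x - g x))\<^sup>2"
  have i: "integrable (lebesgue_on Y) (\<lambda>x. (norm (f m x - g x))\<^sup>2)"
    "integrable (lebesgue_on Y) (\<lambda>x. (norm (f' m x - g' x))\<^sup>2)"
    "integrable (lebesgue_on Y) (\<lambda>x. (norm (f m x + f' m x - (g x + g' x)))\<^sup>2)" for m
    using L2_on_diff[OF f(1,2), of m] L2_on_diff[OF f'(1,2), of m]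
      L2_on_diff[OF L2_on_add[OF f(1) f'(1)] L2_on_add[OF f(2) f'(2)], of m m]
    by (auto simp: L2_on_def)
  have le: "?I (\<lambda>m x. f m x + f' m x) (\<lambda>x. g x + g' x) m \<le> 2 * ?I f g m + 2 * ?I f' g' m" for m
  proof -
    have "?I (\<lambda>m x. f m x + f' m x) (\<lambda>x. g x + g' x) m
        \<le> (LINT x|lebesgue_on Y. 2 * (norm (f m x - g x))\<^sup>2 + 2 * (norm (f' m x - g' x))\<^sup>2)"
    proof (intro integral_mono i Bochner_Integration.integrable_add integrable_mult_right)
      fix x
      show "(norm (f m x + f' m x - (g x + g' x)))\<^sup>2
          \<le> 2 * (norm (f m x - g x))\<^sup>2 + 2 * (norm (f' m x - g' x))\<^sup>2"
        using norm_add_power2_le[of "f m x - g x" "f' m x - g' x"] by (simp add: algebra_simps)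
    qed
    also have "\<dots> = 2 * ?I f g m + 2 * ?I f' g' m"
      using i by simp
    finally show ?thesis .
  qed
  have "(\<lambda>m. 2 * ?I f g m + 2 * ?I f' g' m) \<longlonglongrightarrow> 2 * 0 + 2 * 0"
    using f(3) f'(3) unfolding L2_conv_def by (intro tendsto_intros)
  then have lim: "(\<lambda>m. 2 * ?I f g m + 2 * ?I f' g' m) \<longlonglongrightarrow> 0" by simp
  show ?thesis
    unfolding L2_conv_def
    by (rule tendsto_sandwich[OF always_eventually always_eventually tendsto_const lim])
      (use le in \<open>auto intro: integral_nonneg_AE\<close>)
qed

lemma L2_conv_bounded_linear:
  fixes f :: "nat \<Rightarrow> real^'d \<Rightarrow> 'b::{real_normed_vector, second_countable_topology}"
  assumes T: "bounded_linear T" and f: "\<And>m. L2_on Y (f m)" "L2_on Y g" "L2_conv Y f g"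
  shows "L2_conv Y (\<lambda>m x. T (f m x)) (\<lambda>x. T (g x))"
proof -
  let ?I = "\<lambda>m. LINT x|lebesgue_on Y. (norm (f m x - g x))\<^sup>2"
  obtain K where K: "\<And>u. norm (T u) \<le> norm u * K"
    using bounded_linear.bounded[OF T] by blast
  have i: "integrable (lebesgue_on Y) (\<lambda>x. (norm (f m x - g x))\<^sup>2)"
    "integrable (lebesgue_on Y) (\<lambda>x. (norm (T (f m x - g x)))\<^sup>2)" for m
    using L2_on_diff[OF f(1,2), of m] L2_on_bounded_linear[OF T L2_on_diff[OF f(1,2), of m]]
    by (auto simp: L2_on_def)
  have le: "(LINT x|lebesgue_on Y. (norm (T (f m x - g x)))\<^sup>2) \<le> K\<^sup>2 * ?I m" for m
  proof -
    have "(LINT x|lebesgue_on Y. (norm (T (f m x - g x)))\<^sup>2)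
        \<le> (LINT x|lebesgue_on Y. K\<^sup>2 * (norm (f m x - g x))\<^sup>2)"
    proof (intro integral_mono i integrable_mult_right)
      fix x
      have "(norm (T (f m x - g x)))\<^sup>2 \<le> (norm (f m x - g x) * K)\<^sup>2"
        by (intro power_mono K) simp
      then show "(norm (T (f m x - g x)))\<^sup>2 \<le> K\<^sup>2 * (norm (f m x - g x))\<^sup>2"
        by (simp add: power_mult_distrib mult.commute)
    qed
    then show ?thesis by simp
  qed
  have "(\<lambda>m. K\<^sup>2 * ?I m) \<longlonglongrightarrow> K\<^sup>2 * 0"
    using f(3) unfolding L2_conv_def by (intro tendsto_intros)
  then have lim: "(\<lambda>m. K\<^sup>2 * ?I m) \<longlonglongrightarrow> 0" by simp
  have "(\<lambda>m. LINT x|lebesgue_on Y. (norm (T (f m x - g x)))\<^sup>2) \<longlonglongrightarrow> 0"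
    by (rule tendsto_sandwich[OF always_eventually always_eventually tendsto_const lim])
      (use le in \<open>auto intro: integral_nonneg_AE\<close>)
  then show ?thesis
    by (simp add: L2_conv_def linear_diff[OF bounded_linear.linear[OF T]])
qed

lemma bounded_linear_vec_map:
  assumes T: "bounded_linear (T :: complex \<Rightarrow> complex)"
  shows "bounded_linear (\<lambda>u :: complex^'d. \<chi> a. T (u $ a))"
proof -
  interpret T: bounded_linear T by fact
  show ?thesis
    by (intro linear_conv_bounded_linear[THEN iffD1] linearI)
      (auto simp: vec_eq_iff T.add T.scaleR)
qed

lemma continuous_on_face:
  fixes s :: real
  assumes "continuous_on UNIV f"
  shows "continuous_on UNIV (\<lambda>x :: real^'d. f (\<chi> i. if i = j then s else x $ i))"
proof -
  have "continuous_on UNIV (\<lambda>x :: real^'d. if i = j then s else x $ i)" for i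
    by (cases "i = j") (auto intro!: continuous_intros)
  then show ?thesis
    by (intro continuous_on_compose2[OF assms] continuous_on_vec_lambda) auto
qed

lemma has_trace_sequence:
  assumes "has_trace l g Dg j s t"
  obtains \<psi> where "\<And>m. smooth (\<psi> m)" "L2_conv (box 0 l) \<psi> g"
    "L2_conv (box 0 l) (\<lambda>m. classical_grad (\<psi> m)) Dg"
    "L2_conv (box 0 l) (\<lambda>m x. \<psi> m (\<chi> i. if i = j then s else x $ i)) t"
  using assms unfolding has_trace_def L2_conv_def[symmetric]
  by (elim conjE exE) (rule that, assumption?, simp_all)

lemma has_trace_face:
  assumes "has_trace l g Dg j s t"
  shows "(\<forall>i. i \<noteq> j \<longrightarrow> x $ i = y $ i) \<Longrightarrow> t x = t y" "L2_on (box 0 l) t"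
  using assms unfolding has_trace_def by simp_all

lemma has_trace_add:
  assumes "has_trace l g Dg j s t" "has_trace l h Dh j s u"
    and L2: "L2_on (box 0 l) g" "L2_on (box 0 l) Dg" "L2_on (box 0 l) h" "L2_on (box 0 l) Dh"
  shows "has_trace l (\<lambda>x. g x + h x) (\<lambda>x. Dg x + Dh x) j s (\<lambda>x. t x + u x)"
proof -
  let ?f = "\<lambda>x. \<chi> i. if i = j then s else x $ i"
  obtain \<psi> where \<psi>: "\<And>m. smooth (\<psi> m)" "L2_conv (box 0 l) \<psi> g"
      "L2_conv (box 0 l) (\<lambda>m. classical_grad (\<psi> m)) Dg" "L2_conv (box 0 l) (\<lambda>m x. \<psi> m (?f x)) t"
    by (rule has_trace_sequence[OF assms(1)], rule that)
  note t = has_trace_face[OF assms(1)]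
  obtain \<eta> where \<eta>: "\<And>m. smooth (\<eta> m)" "L2_conv (box 0 l) \<eta> h"
      "L2_conv (box 0 l) (\<lambda>m. classical_grad (\<eta> m)) Dh" "L2_conv (box 0 l) (\<lambda>m x. \<eta> m (?f x)) u"
    by (rule has_trace_sequence[OF assms(2)], rule that)
  note u = has_trace_face[OF assms(2)]
  note c = L2_on_box_continuous
  note L = c[OF smooth_continuous[OF \<psi>(1)]] c[OF smooth_continuous[OF \<eta>(1)]]
    c[OF classical_grad_continuous[OF \<psi>(1)]] c[OF classical_grad_continuous[OF \<eta>(1)]]
    c[OF continuous_on_face[OF smooth_continuous[OF \<psi>(1)]]]
    c[OF continuous_on_face[OF smooth_continuous[OF \<eta>(1)]]]
  show ?thesis
    unfolding has_trace_def
  proof (intro conjI exI allI impI)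
    show "t x + u x = t y + u y" if "\<forall>i. i \<noteq> j \<longrightarrow> x $ i = y $ i" for x y
      using t(1)[OF that] u(1)[OF that] by simp
    show "L2_on (box 0 l) (\<lambda>x. t x + u x)" by (rule L2_on_add[OF t(2) u(2)])
    show "smooth (\<lambda>x. \<psi> m x + \<eta> m x)" for m by (rule smooth_add[OF \<psi>(1) \<eta>(1)])
  qed (use L2_conv_add[OF L(1) L2(1) \<psi>(2) L(2) L2(3) \<eta>(2)]
      L2_conv_add[OF L(3) L2(2) \<psi>(3) L(4) L2(4) \<eta>(3)]
      L2_conv_add[OF L(5) t(2) \<psi>(4) L(6) u(2) \<eta>(4)]
      in \<open>simp_all add: L2_conv_def smooth_add(2)[OF \<psi>(1) \<eta>(1)]\<close>)
qed

lemma has_trace_bounded_linear: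
  assumes "has_trace l g Dg j s t" and T: "bounded_linear (T :: complex \<Rightarrow> complex)"
    and L2: "L2_on (box 0 l) g" "L2_on (box 0 l) Dg"
  shows "has_trace l (\<lambda>x. T (g x)) (\<lambda>x. \<chi> a. T (Dg x $ a)) j s (\<lambda>x. T (t x))"
proof -
  let ?f = "\<lambda>x. \<chi> i. if i = j then s else x $ i"
  obtain \<psi> where \<psi>: "\<And>m. smooth (\<psi> m)" "L2_conv (box 0 l) \<psi> g"
      "L2_conv (box 0 l) (\<lambda>m. classical_grad (\<psi> m)) Dg" "L2_conv (box 0 l) (\<lambda>m x. \<psi> m (?f x)) t"
    by (rule has_trace_sequence[OF assms(1)], rule that)
  note t = has_trace_face[OF assms(1)]
  note c = L2_on_box_continuous
  note L = c[OF smooth_continuous[OF \<psi>(1)]] c[OF classical_grad_continuous[OF \<psi>(1)]]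
    c[OF continuous_on_face[OF smooth_continuous[OF \<psi>(1)]]]
  show ?thesis
    unfolding has_trace_def
  proof (intro conjI exI allI impI)
    show "T (t x) = T (t y)" if "\<forall>i. i \<noteq> j \<longrightarrow> x $ i = y $ i" for x y
      using t(1)[OF that] by simp
    show "L2_on (box 0 l) (\<lambda>x. T (t x))" by (rule L2_on_bounded_linear[OF T t(2)])
    show "smooth (\<lambda>x. T (\<psi> m x))" for m by (rule smooth_bounded_linear[OF T \<psi>(1)])
  qed (use L2_conv_bounded_linear[OF T L(1) L2(1) \<psi>(2)]
      L2_conv_bounded_linear[OF bounded_linear_vec_map[OF T] L(2) L2(2) \<psi>(3)]
      L2_conv_bounded_linear[OF T L(3) t(2) \<psi>(4)]
      in \<open>simp_all add: L2_conv_def smooth_bounded_linear(2)[OF T \<psi>(1)]\<close>)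
qed

lemma H1p_L2_on:
  assumes "H1p l g Dg"
  shows "L2_on (box 0 l) g" "L2_on (box 0 l) Dg"
  using assms by (auto simp: H1p_def H1_def)

lemma H1p_add:
  assumes g: "H1p l g Dg" and h: "H1p l h Dh"
  shows "H1p l (\<lambda>x. g x + h x) (\<lambda>x. Dg x + Dh x)"
proof -
  note L2 = H1p_L2_on[OF g] H1p_L2_on[OF h]
  have "H1 (box 0 l) (\<lambda>x. g x + h x) (\<lambda>x. Dg x + Dh x)"
    unfolding H1_def
  proof (intro conjI allI impI L2_on_add L2)
    fix \<phi> a
    assume \<phi>: "smooth \<phi> \<and> compact (closure {x. \<phi> x \<noteq> 0}) \<and> closure {x. \<phi> x \<noteq> 0} \<subseteq> box 0 l"
    then have L: "L2_on (box 0 l) \<phi>" "L2_on (box 0 l) (\<lambda>x. classical_grad \<phi> x $ a)"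
      by (blast intro: L2_on_box_continuous smooth_continuous,
          blast intro: L2_on_nth[OF L2_on_box_continuous] classical_grad_continuous)
    have "(LINT x|lebesgue_on (box 0 l). g x * classical_grad \<phi> x $ a) = - (LINT x|lebesgue_on (box 0 l). Dg x $ a * \<phi> x)"
      "(LINT x|lebesgue_on (box 0 l). h x * classical_grad \<phi> x $ a) = - (LINT x|lebesgue_on (box 0 l). Dh x $ a * \<phi> x)"
      using g h \<phi> unfolding H1p_def H1_def by blast+
    then show "(LINT x|lebesgue_on (box 0 l). (g x + h x) * classical_grad \<phi> x $ a)
        = - (LINT x|lebesgue_on (box 0 l). (Dg x + Dh x) $ a * \<phi> x)"
      using L2 L by (simp add: distrib_right integrable_L2_mult L2_on_nth)
  qed
  moreover have "\<exists>t. has_trace l (\<lambda>x. g x + h x) (\<lambda>x. Dg x + Dh x) j 0 t \<and>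
      has_trace l (\<lambda>x. g x + h x) (\<lambda>x. Dg x + Dh x) j (l $ j) t" for j
  proof -
    obtain t where t: "has_trace l g Dg j 0 t" "has_trace l g Dg j (l $ j) t"
      using g unfolding H1p_def by blast
    obtain u where u: "has_trace l h Dh j 0 u" "has_trace l h Dh j (l $ j) u"
      using h unfolding H1p_def by blast
    show ?thesis
      using has_trace_add[OF t(1) u(1) L2] has_trace_add[OF t(2) u(2) L2] by blast
  qed
  ultimately show ?thesis by (simp add: H1p_def)
qed

lemma H1p_cmult:
  assumes g: "H1p l g Dg"
  shows "H1p l (\<lambda>x. c * g x) (\<lambda>x. c *s Dg x)"
proof -
  note L2 = H1p_L2_on[OF g]
  have v: "(\<chi> a. c * u $ a) = c *s u" for u :: "complex^'d"
    by (simp add: vec_eq_iff)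
  note T = bounded_linear_mult_right[of c]
  have "H1 (box 0 l) (\<lambda>x. c * g x) (\<lambda>x. c *s Dg x)"
    unfolding H1_def
  proof (intro conjI allI impI)
    show "L2_on (box 0 l) (\<lambda>x. c * g x)" using L2 by (intro L2_on_cmult)
    show "L2_on (box 0 l) (\<lambda>x. c *s Dg x)"
      using L2_on_bounded_linear[OF bounded_linear_vec_map[OF T] L2(2)] by (simp add: v)
    fix \<phi> a
    assume "smooth \<phi> \<and> compact (closure {x. \<phi> x \<noteq> 0}) \<and> closure {x. \<phi> x \<noteq> 0} \<subseteq> box 0 l"
    then have "(LINT x|lebesgue_on (box 0 l). g x * classical_grad \<phi> x $ a) = - (LINT x|lebesgue_on (box 0 l). Dg x $ a * \<phi> x)"
      using g unfolding H1p_def H1_def by blast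
    then show "(LINT x|lebesgue_on (box 0 l). c * g x * classical_grad \<phi> x $ a)
        = - (LINT x|lebesgue_on (box 0 l). (c *s Dg x) $ a * \<phi> x)"
      by (simp add: mult.assoc)
  qed
  moreover have "\<exists>t. has_trace l (\<lambda>x. c * g x) (\<lambda>x. c *s Dg x) j 0 t \<and>
      has_trace l (\<lambda>x. c * g x) (\<lambda>x. c *s Dg x) j (l $ j) t" for j
  proof -
    obtain t where t: "has_trace l g Dg j 0 t" "has_trace l g Dg j (l $ j) t"
      using g unfolding H1p_def by blast
    show ?thesis
      using has_trace_bounded_linear[OF t(1) T L2] has_trace_bounded_linear[OF t(2) T L2]
      unfolding v by blast
  qed
  ultimately show ?thesis by (simp add: H1p_def)
qed

text \<open>The weak form is bilinear, without conjugation. Positivity of the energy becomes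
  available only by testing with a conjugate, which must then be an admissible test function. In the
  integration by parts formula the conjugation is shifted onto the smooth function and the identity
  is conjugated back.\<close>

lemma H1p_cnj:
  assumes g: "H1p l g Dg"
  shows "H1p l (\<lambda>x. cnj (g x)) (\<lambda>x. \<chi> a. cnj (Dg x $ a))"
proof -
  note L2 = H1p_L2_on[OF g]
  note T = bounded_linear_cnj
  have "H1 (box 0 l) (\<lambda>x. cnj (g x)) (\<lambda>x. \<chi> a. cnj (Dg x $ a))"
    unfolding H1_def
  proof (intro conjI allI impI)
    show "L2_on (box 0 l) (\<lambda>x. cnj (g x))" by (rule L2_on_bounded_linear[OF T L2(1)])
    show "L2_on (box 0 l) (\<lambda>x. \<chi> a. cnj (Dg x $ a))"
      by (rule L2_on_bounded_linear[OF bounded_linear_vec_map[OF T] L2(2)])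
    fix \<phi> a
    assume \<phi>: "smooth \<phi> \<and> compact (closure {x. \<phi> x \<noteq> 0}) \<and> closure {x. \<phi> x \<noteq> 0} \<subseteq> box 0 l"
    have "smooth (\<lambda>x. cnj (\<phi> x)) \<and> compact (closure {x. cnj (\<phi> x) \<noteq> 0}) \<and> closure {x. cnj (\<phi> x) \<noteq> 0} \<subseteq> box 0 l"
      using \<phi> smooth_bounded_linear(1)[OF T, of \<phi>] by auto
    then have "(LINT x|lebesgue_on (box 0 l). g x * classical_grad (\<lambda>x. cnj (\<phi> x)) x $ a)
        = - (LINT x|lebesgue_on (box 0 l). Dg x $ a * cnj (\<phi> x))"
      using g unfolding H1p_def H1_def by blast
    then have "(LINT x|lebesgue_on (box 0 l). g x * cnj (classical_grad \<phi> x $ a))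
        = - (LINT x|lebesgue_on (box 0 l). Dg x $ a * cnj (\<phi> x))"
      using \<phi> by (simp add: smooth_bounded_linear(2)[OF T])
    from arg_cong[OF this, of cnj]
    show "(LINT x|lebesgue_on (box 0 l). cnj (g x) * classical_grad \<phi> x $ a)
        = - (LINT x|lebesgue_on (box 0 l). (\<chi> a. cnj (Dg x $ a)) $ a * \<phi> x)"
      by (simp only: Bochner_Integration.integral_cnj[symmetric] complex_cnj_minus complex_cnj_mult complex_cnj_cnj
          vec_lambda_beta)
  qed
  moreover have "\<exists>t. has_trace l (\<lambda>x. cnj (g x)) (\<lambda>x. \<chi> a. cnj (Dg x $ a)) j 0 t \<and>
      has_trace l (\<lambda>x. cnj (g x)) (\<lambda>x. \<chi> a. cnj (Dg x $ a)) j (l $ j) t" for j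
  proof -
    obtain t where t: "has_trace l g Dg j 0 t" "has_trace l g Dg j (l $ j) t"
      using g unfolding H1p_def by blast
    show ?thesis
      using has_trace_bounded_linear[OF t(1) T L2] has_trace_bounded_linear[OF t(2) T L2] by blast
  qed
  ultimately show ?thesis by (simp add: H1p_def)
qed

lemma smooth_has_vector_derivative_line:
  assumes "smooth \<phi>"
  shows "((\<lambda>r. \<phi> (x + r *\<^sub>R u)) has_vector_derivative
      (\<Sum>a\<in>UNIV. of_real (u $ a) * classical_grad \<phi> (x + s *\<^sub>R u) $ a)) (at s)"
proof -
  have "((\<lambda>r. x + r *\<^sub>R u) has_derivative (\<lambda>r. r *\<^sub>R u)) (at s)"
    by (auto intro!: derivative_eq_intros)
  from diff_chain_at[OF this smooth_has_derivative[OF assms, of "x + s *\<^sub>R u"]]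
  show ?thesis
    by (simp add: has_vector_derivative_def o_def scaleR_conv_of_real[where 'a=complex] sum_distrib_left mult.assoc)
qed

text \<open>Provides the uniform bound on difference quotients that dominated convergence asks
  for.\<close>

lemma smooth_translate_le:
  fixes \<phi> :: "real^'d \<Rightarrow> complex"
  assumes \<phi>: "smooth \<phi>" and B: "\<And>x. norm (classical_grad \<phi> x $ a) \<le> B"
  shows "norm (\<phi> (x + t *\<^sub>R axis a 1) - \<phi> x) \<le> B * \<bar>t\<bar>"
proof -
  have "(\<Sum>b\<in>UNIV. of_real ((axis a 1 :: real^'d) $ b) * p $ b) = (p :: complex^'d) $ a" for p
    by (simp add: axis_def if_distrib[of of_real] if_distrib[of "\<lambda>u. u * _"] cong: if_cong)
  then have d: "((\<lambda>r. \<phi> (x + r *\<^sub>R axis a 1)) has_vector_derivative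
      classical_grad \<phi> (x + s *\<^sub>R axis a 1) $ a) (at s)" for s
    using smooth_has_vector_derivative_line[OF \<phi>, of x "axis a 1" s] by simp
  have "norm (\<phi> (x + t *\<^sub>R axis a 1) - \<phi> (x + 0 *\<^sub>R axis a 1)) \<le> B * norm (t - 0)"
  proof (rule differentiable_bound[of UNIV])
    show "((\<lambda>r. \<phi> (x + r *\<^sub>R axis a 1)) has_derivative
        (\<lambda>h. h *\<^sub>R (classical_grad \<phi> (x + s *\<^sub>R axis a 1) $ a))) (at s within UNIV)" for s
      using d[of s] by (simp add: has_vector_derivative_def)
    show "onorm (\<lambda>h. h *\<^sub>R (classical_grad \<phi> (x + s *\<^sub>R axis a 1) $ a)) \<le> B" for s
      using B by (intro onorm_le) (simp add: mult.commute[of B] mult_left_mono)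
  qed auto
  then show ?thesis by simp
qed

text \<open>Translation invariance of the integral makes the integral of each difference quotient vanish.\<close>

lemma integral_classical_grad_eq_0:
  fixes \<phi> :: "real^'d \<Rightarrow> complex"
  assumes \<phi>: "smooth \<phi>" and supp: "closure {x. \<phi> x \<noteq> 0} \<subseteq> box 0 l"
  shows "(LINT x|lebesgue_on (box 0 l). classical_grad \<phi> x $ a) = 0"
proof -
  let ?g = "\<lambda>x. classical_grad \<phi> x $ a"
  let ?e = "axis a 1 :: real^'d"
  have \<phi>0: "\<phi> x = 0" if "x \<notin> box 0 l" for x
    using that supp closure_subset[of "{x. \<phi> x \<noteq> 0}"] by blast
  \<comment> \<open>Points of the boundary are included: they lie in the open complement of the
    closed support, where the function vanishes identically.\<close>
  have g0: "classical_grad \<phi> x = 0" if x: "x \<notin> box 0 l" for x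
  proof -
    have "(\<phi> has_derivative (\<lambda>h. 0)) (at x)"
    proof (rule has_derivative_transform_within_open[of "\<lambda>_. 0"])
      show "open (- closure {x. \<phi> x \<noteq> 0})" "x \<in> - closure {x. \<phi> x \<noteq> 0}"
        using x supp by auto
      show "0 = \<phi> y" if "y \<in> - closure {x. \<phi> x \<noteq> 0}" for y
        using that closure_subset[of "{x. \<phi> x \<noteq> 0}"] by auto
    qed simp
    then have "frechet_derivative \<phi> (at x) = (\<lambda>h. 0)"
      by (simp add: frechet_derivative_at[symmetric])
    then show ?thesis
      by (simp add: classical_grad_def vec_eq_iff)
  qed
  have c\<phi>: "continuous_on UNIV \<phi>" and cg: "continuous_on UNIV ?g"
    using smooth_continuous[OF \<phi>] classical_grad_continuous[OF \<phi>] by (auto intro!: continuous_intros)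
  then have [measurable]: "\<phi> \<in> borel_measurable borel" "?g \<in> borel_measurable borel"
    by (auto intro: borel_measurable_continuous_onI)
  obtain B where B: "\<And>x. norm (?g x) \<le> B"
  proof -
    have "bounded (?g ` cbox 0 l)"
      by (intro compact_imp_bounded compact_continuous_image continuous_on_subset[OF cg]) auto
    then obtain B where B: "\<And>x. x \<in> cbox 0 l \<Longrightarrow> norm (?g x) \<le> B"
      by (auto simp: bounded_iff)
    have "norm (?g x) \<le> max B 0" for x
      using B[of x] g0[of x] box_subset_cbox[of 0 l] by (cases "x \<in> box 0 l") auto
    then show ?thesis using that by blast
  qed
  define t where "t n = 1 / real (Suc n)" for n
  have t: "t n > 0" "t n \<le> 1" for n by (auto simp: t_def)
  define f where "f n x = (\<phi> (x + t n *\<^sub>R ?e) - \<phi> x) /\<^sub>R t n" for n x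
  \<comment> \<open>A shift by \<open>t n\<close>, which lies between 0 and 1, can bring a point
    from outside the cell into the support. Enlarging the box by 1 on each side catches all points
    where some \<open>f n\<close> is nonzero.\<close>
  define K where "K = cbox (\<chi> i. -1) (\<chi> i. l $ i + 1)"
  have \<phi>_int: "integrable lborel \<phi>"
  proof -
    have "set_integrable lborel (cbox 0 l) \<phi>"
      unfolding set_integrable_def 
      by (intro borel_integrable_compact) (auto intro: continuous_on_subset[OF c\<phi>])
    moreover have "(\<lambda>x. indicator (cbox 0 l) x *\<^sub>R \<phi> x) = \<phi>"
      using \<phi>0 box_subset_cbox[of 0 l] by (force simp: indicator_def)
    ultimately show ?thesis
      unfolding set_integrable_def by simp
  qed
  have f_int: "integral\<^sup>L lborel (f n) = 0" for n
  proof -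
    have e: "distr lborel borel ((+) (t n *\<^sub>R ?e)) = lborel"
      by (rule lborel_distr_plus)
    have i: "integrable lborel (\<lambda>x. \<phi> (x + t n *\<^sub>R ?e))"
      using integrable_distr_eq[of "(+) (t n *\<^sub>R ?e)" lborel borel \<phi>] \<phi>_int
      unfolding e by (simp add: add.commute)
    have "(LINT x|lborel. \<phi> (x + t n *\<^sub>R ?e)) = integral\<^sup>L lborel \<phi>"
      using integral_distr[of "(+) (t n *\<^sub>R ?e)" lborel borel \<phi>]
      unfolding e by (simp add: add.commute)
    then show ?thesis
      unfolding f_def using i \<phi>_int by simp
  qed
  have "(\<lambda>n. integral\<^sup>L lborel (f n)) \<longlonglongrightarrow> integral\<^sup>L lborel ?g"
  proof (rule integral_dominated_convergence[where w = "\<lambda>x. B * indicator K x"])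
    show "integrable lborel (\<lambda>x. B * indicator K x)"
      unfolding K_def by (intro integrable_mult_right integrable_real_indicator) (auto simp: emeasure_lborel_cbox_eq)
    show "AE x in lborel. (\<lambda>n. f n x) \<longlonglongrightarrow> ?g x"
    proof (intro AE_I2)
      fix x
      have "(\<Sum>b\<in>UNIV. of_real (?e $ b) * classical_grad \<phi> x $ b) = ?g x"
        by (simp add: axis_def if_distrib[of of_real] if_distrib[of "\<lambda>u. u * _"] cong: if_cong)
      then have "((\<lambda>r. \<phi> (x + r *\<^sub>R ?e)) has_vector_derivative ?g x) (at 0)"
        using smooth_has_vector_derivative_line[OF \<phi>, of x ?e 0] by simp
      then have "((\<lambda>h. norm (\<phi> (x + h *\<^sub>R ?e) - \<phi> x - h *\<^sub>R ?g x) / norm h) \<longlongrightarrow> 0) (at 0)"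
        by (simp add: has_vector_derivative_def has_derivative_at)
      moreover have "norm (\<phi> (x + h *\<^sub>R ?e) - \<phi> x - h *\<^sub>R ?g x) / norm h
          = norm ((\<phi> (x + h *\<^sub>R ?e) - \<phi> x) /\<^sub>R h - ?g x)" if "h \<noteq> 0" for h
      proof -
        have "(\<phi> (x + h *\<^sub>R ?e) - \<phi> x) /\<^sub>R h - ?g x = (\<phi> (x + h *\<^sub>R ?e) - \<phi> x - h *\<^sub>R ?g x) /\<^sub>R h"
          using that by (simp add: scaleR_diff_right)
        then show ?thesis by (simp add: divide_inverse_commute)
      qed
      ultimately have "((\<lambda>h. norm ((\<phi> (x + h *\<^sub>R ?e) - \<phi> x) /\<^sub>R h - ?g x)) \<longlongrightarrow> 0) (at 0)"
        by (auto elim!: Lim_transform_eventually simp: eventually_at_filter)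
      then have "((\<lambda>h. (\<phi> (x + h *\<^sub>R ?e) - \<phi> x) /\<^sub>R h) \<longlongrightarrow> ?g x) (at 0)"
        by (rule LIM_zero_cancel[OF tendsto_norm_zero_cancel])
      moreover have "filterlim t (at 0) sequentially"
        unfolding filterlim_at using t(1) LIMSEQ_inverse_real_of_nat
        by (auto simp: t_def[abs_def] inverse_eq_divide intro!: always_eventually)
      ultimately show "(\<lambda>n. f n x) \<longlonglongrightarrow> ?g x"
        unfolding f_def by (auto dest!: filterlim_compose[of _ _ _ t sequentially])
    qed
    show "AE x in lborel. norm (f n x) \<le> B * indicator K x" for n
    proof (intro AE_I2)
      fix x
      show "norm (f n x) \<le> B * indicator K x"
      proof (cases "x \<in> K")
        case True
        then show ?thesis
          using smooth_translate_le[OF \<phi> B, of x "t n"] t[of n]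
          by (simp add: f_def inverse_eq_divide pos_divide_le_eq)
      next
        case False
        have "x \<notin> box 0 l" "x + t n *\<^sub>R ?e \<notin> box 0 l"
        proof -
          obtain i where i: "x $ i < -1 \<or> l $ i + 1 < x $ i"
            using False by (auto simp: K_def mem_box_cart not_le)
          have "0 \<le> (t n *\<^sub>R ?e) $ i" "(t n *\<^sub>R ?e) $ i \<le> 1"
            using t[of n] by (auto simp: axis_def)
          with i show "x \<notin> box 0 l" "x + t n *\<^sub>R ?e \<notin> box 0 l"
            by (force simp: mem_box_cart dest: spec[of _ i])+
        qed
        then show ?thesis using False \<phi>0 by (simp add: f_def)
      qed
    qed
  qed (simp_all add: f_def[abs_def])
  then have "(\<lambda>n. 0) \<longlonglongrightarrow> integral\<^sup>L lborel ?g"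
    by (simp add: f_int)
  from LIMSEQ_unique[OF this tendsto_const] have "integral\<^sup>L lborel ?g = 0" .
  moreover have "(LINT x|lebesgue_on (box 0 l). ?g x) = integral\<^sup>L lborel ?g"
  proof -
    have "(LINT x|lebesgue_on (box 0 l). ?g x) = (LINT x|lebesgue. indicator (box 0 l) x *\<^sub>R ?g x)"
      by (rule integral_restrict_space) simp
    also have "\<dots> = integral\<^sup>L lebesgue ?g"
      using g0 by (intro Bochner_Integration.integral_cong) (auto simp: indicator_def)
    also have "\<dots> = integral\<^sup>L lborel ?g"
      by (rule integral_completion) measurable
    finally show ?thesis .
  qed
  ultimately show ?thesis by simp
qed

text \<open>For a constant, integration by parts says that the gradient of a compactly supported
  smooth function has integral 0. Constants are the test functions that produce the solvability
  conditions.\<close>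

lemma H1p_const: "H1p (l :: real^'d) (\<lambda>x. 1) (\<lambda>x. 0)"
proof -
  have c: "L2_on (box 0 l) (\<lambda>x :: real^'d. 1 :: complex)"
    by (rule L2_on_box_continuous) simp
  have "has_trace l (\<lambda>x. 1) (\<lambda>x. 0) j s (\<lambda>x. 1)" for j s
    unfolding has_trace_def
    by (intro conjI exI[of _ "\<lambda>_ _. 1"]) (auto simp: c smooth_const)
  then show ?thesis
    using integral_classical_grad_eq_0[of _ l]
    by (auto simp: H1p_def H1_def c L2_on_zero)
qed

subsection \<open>A Poincare inequality on the cell\<close>

lemma norm_directional_le:
  fixes u :: "real^'d" and p :: "complex^'d"
  shows "norm (\<Sum>a\<in>UNIV. of_real (u $ a) * p $ a) \<le> CARD('d) * norm u * norm p"
proof -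
  have "norm (\<Sum>a\<in>UNIV. of_real (u $ a) * p $ a) \<le> (\<Sum>a\<in>(UNIV :: 'd set). norm u * norm p)"
  proof (rule sum_norm_le)
    fix a :: 'd
    show "norm (of_real (u $ a) * p $ a) \<le> norm u * norm p"
      using component_le_norm_cart[of u a] Finite_Cartesian_Product.norm_nth_le[of p a]
      by (auto simp: norm_mult intro!: mult_mono)
  qed
  then show ?thesis by simp
qed

text \<open>The derivative is integrated over the half of the segment that ends in \<open>x\<close>.
  The bound is phrased with a nonnegative integral so that the orders of integration can later be
  exchanged without integrability conditions.\<close>

lemma smooth_diff_midpoint_le:
  fixes \<psi> :: "real^'d \<Rightarrow> complex"
  assumes \<psi>: "smooth \<psi>"
  shows "ennreal (norm (\<psi> x - \<psi> (y + (1/2) *\<^sub>R (x - y)))) \<le>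
    (\<integral>\<^sup>+t. indicator {1/2..1} t *
       ennreal (CARD('d) * norm (x - y) * norm (classical_grad \<psi> (y + t *\<^sub>R (x - y)))) \<partial>lborel)"
proof -
  let ?d = "\<lambda>t. \<Sum>a\<in>UNIV. of_real ((x - y) $ a) * classical_grad \<psi> (y + t *\<^sub>R (x - y)) $ a"
  let ?f = "\<lambda>t. CARD('d) * norm (x - y) * norm (classical_grad \<psi> (y + t *\<^sub>R (x - y)))"
  have c: "continuous_on A (\<lambda>t. classical_grad \<psi> (y + t *\<^sub>R (x - y)))" for A
    by (intro continuous_on_compose2[OF classical_grad_continuous[OF \<psi>]] continuous_intros) auto
  have 1: "(?d has_integral (\<psi> (y + 1 *\<^sub>R (x - y)) - \<psi> (y + (1/2) *\<^sub>R (x - y)))) {1/2..1}"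
    by (rule fundamental_theorem_of_calculus)
      (simp, rule has_vector_derivative_at_within[OF smooth_has_vector_derivative_line[OF \<psi>]])
  have "?f integrable_on {1/2..1}"
    by (intro integrable_continuous_interval continuous_intros c)
  then obtain I where I: "(?f has_integral I) {1/2..1}" by blast
  have "norm (integral {1/2..1} ?d) \<le> integral {1/2..1} ?f"
    by (rule integral_norm_bound_integral[OF has_integral_integrable[OF 1] has_integral_integrable[OF I]])
      (rule norm_directional_le)
  then have "norm (\<psi> x - \<psi> (y + (1/2) *\<^sub>R (x - y))) \<le> I"
    unfolding integral_unique[OF 1] integral_unique[OF I] by simp
  then have "ennreal (norm (\<psi> x - \<psi> (y + (1/2) *\<^sub>R (x - y)))) \<le> ennreal I"
    by (rule ennreal_leI)
  also have "ennreal I = (\<integral>\<^sup>+t. indicator {1/2..1} t * ?f t \<partial>lborel)"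
    using nn_integral_has_integral_lebesgue[OF _ I] by (simp add: ennreal_mult' ennreal_indicator)
  finally show ?thesis by (simp add: ennreal_mult' ennreal_indicator)
qed

text \<open>The substitution scales Lebesgue measure by \<open>t ^ CARD('d)\<close>, and
  \<open>(2 * t) ^ CARD('d)\<close> is at least 1. The bound degenerates as \<open>t\<close> tends
  to 0, which is why a whole segment cannot be handled with a single moving end point.\<close>

lemma nn_integral_affine_le:
  fixes g :: "real^'d \<Rightarrow> ennreal"
  assumes [measurable]: "g \<in> borel_measurable borel" and t: "1/2 \<le> t"
  shows "(\<integral>\<^sup>+x. g (z + t *\<^sub>R x) \<partial>lborel) \<le> 2 ^ CARD('d) * (\<integral>\<^sup>+x. g x \<partial>lborel)"
proof -
  have "(\<integral>\<^sup>+x. g x \<partial>lborel) = ennreal (t ^ CARD('d)) * (\<integral>\<^sup>+x. g (z + t *\<^sub>R x) \<partial>lborel)"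
    using t by (subst lborel_affine[of t z])
      (auto simp: nn_integral_density nn_integral_distr nn_integral_cmult)
  then have "2 ^ CARD('d) * (\<integral>\<^sup>+x. g x \<partial>lborel)
      = ennreal ((2 * t) ^ CARD('d)) * (\<integral>\<^sup>+x. g (z + t *\<^sub>R x) \<partial>lborel)"
    using t by (simp add: power_mult_distrib ennreal_mult' ennreal_power mult.assoc flip: ennreal_numeral)
  moreover have "1 \<le> ennreal ((2 * t) ^ CARD('d))"
    using one_le_power[of "2 * t" "CARD('d)"] t by (simp del: power_mult_distrib)
  ultimately show ?thesis
    using mult_right_mono[of 1 "ennreal ((2 * t) ^ CARD('d))"] by simp
qed

text \<open>
  Each half of the segment from \<open>x\<close> to \<open>y\<close> is controlled by moving its own end point: near \<open>x\<close>
  the map \<open>x \<mapsto> y + t (x - y)\<close> has Jacobian at least \<open>2\<^sup>-\<^sup>d\<close>.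
\<close>

lemma nn_poincare:
  fixes l :: "real^'d"
  assumes "measure lebesgue (box 0 l) = 1"
  shows "\<exists>C\<ge>0. \<forall>\<psi>. smooth \<psi> \<longrightarrow>
    (\<integral>\<^sup>+x. \<integral>\<^sup>+y. indicator (box 0 l) x * indicator (box 0 l) y * ennreal (norm (\<psi> x - \<psi> y)) \<partial>lborel \<partial>lborel)
     \<le> ennreal C * (\<integral>\<^sup>+x. indicator (box 0 l) x * ennreal (norm (classical_grad \<psi> x)) \<partial>lborel)"
proof -
  let ?Q = "box 0 l"
  have vol: "emeasure lborel ?Q = 1"
    using assms emeasure_eq_ennreal_measure[of lborel ?Q] by (simp add: emeasure_lborel_box_eq)
  obtain R where R: "R > 0" "\<And>x y. x \<in> ?Q \<Longrightarrow> y \<in> ?Q \<Longrightarrow> norm (x - y) \<le> R"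
  proof -
    obtain r where r: "\<And>x. x \<in> ?Q \<Longrightarrow> norm x \<le> r" 
      using bounded_box[of 0 l] by (auto simp: bounded_iff)
    have "norm (x - y) \<le> 2 * \<bar>r\<bar> + 1" if "x \<in> ?Q" "y \<in> ?Q" for x y
      using r[OF that(1)] r[OF that(2)] norm_triangle_ineq4[of x y] by linarith
    then show ?thesis by (intro that[of "2 * \<bar>r\<bar> + 1"]) auto
  qed
  define c where "c = CARD('d) * R"
  have c0: "c \<ge> 0" using R by (simp add: c_def)
  \<comment> \<open>The factor 2 counts the two halves of the segment, \<open>2 ^ CARD('d)\<close>
    is the Jacobian bound, and \<open>c\<close> combines a diameter bound \<open>R\<close> with the
    dimension factor of the directional derivative.\<close>
  let ?C = "2 * (c * 2 ^ CARD('d))"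
  interpret P: pair_sigma_finite "lborel :: (real^'d) measure" "lborel :: (real^'d) measure" ..
  interpret P1: pair_sigma_finite "lborel :: (real^'d) measure" "lborel :: real measure" ..
  show ?thesis
  proof (intro exI[of _ ?C] conjI allI impI)
    fix \<psi> :: "real^'d \<Rightarrow> complex" assume \<psi>: "smooth \<psi>"
    let ?F = "\<lambda>x. ennreal (norm (classical_grad \<psi> x))"
    let ?G = "\<integral>\<^sup>+x. indicator ?Q x * ?F x \<partial>lborel"
    have [measurable]: "\<psi> \<in> borel_measurable borel" "classical_grad \<psi> \<in> borel_measurable borel"
      by (intro borel_measurable_continuous_onI smooth_continuous classical_grad_continuous \<psi>)+
    \<comment> \<open>This is the bound for the half next to \<open>x\<close>, cut off to the cell
      and to \<open>t \<ge> 1/2\<close>. Exchanging \<open>x\<close> and \<open>y\<close> gives the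
      other half, because the midpoint is the same.\<close>
    define h where "h x y t = indicator ?Q x * indicator ?Q y * indicator {1/2..1} t
        * (ennreal c * ?F (y + t *\<^sub>R (x - y)))" for x y and t :: real
    have [measurable]: "case_prod (\<lambda>x y. \<integral>\<^sup>+t. h x y t \<partial>lborel) \<in> borel_measurable (lborel \<Otimes>\<^sub>M lborel)"
      "case_prod (\<lambda>y x. \<integral>\<^sup>+t. h x y t \<partial>lborel) \<in> borel_measurable (lborel \<Otimes>\<^sub>M lborel)"
      "case_prod (\<lambda>x t. h x y t) \<in> borel_measurable (lborel \<Otimes>\<^sub>M lborel)"
      "(\<lambda>x. h x y t) \<in> borel_measurable lborel"
      for y t
      unfolding h_def by measurable
    have half: "indicator ?Q x * indicator ?Q y * ennreal (norm (\<psi> x - \<psi> (y + (1/2) *\<^sub>R (x - y))))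
        \<le> (\<integral>\<^sup>+t. h x y t \<partial>lborel)" for x y
    proof (cases "x \<in> ?Q \<and> y \<in> ?Q")
      case True
      have "ennreal (norm (\<psi> x - \<psi> (y + (1/2) *\<^sub>R (x - y)))) \<le> (\<integral>\<^sup>+t. indicator {1/2..1} t *
          ennreal (CARD('d) * norm (x - y) * norm (classical_grad \<psi> (y + t *\<^sub>R (x - y)))) \<partial>lborel)"
        by (rule smooth_diff_midpoint_le[OF \<psi>])
      also have "\<dots> \<le> (\<integral>\<^sup>+t. h x y t \<partial>lborel)"
      proof (intro nn_integral_mono)
        fix t :: real
        have "CARD('d) * norm (x - y) * norm (classical_grad \<psi> (y + t *\<^sub>R (x - y)))
            \<le> c * norm (classical_grad \<psi> (y + t *\<^sub>R (x - y)))"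
          unfolding c_def using R(2) True by (intro mult_right_mono mult_left_mono) auto
        then show "indicator {1/2..1} t *
            ennreal (CARD('d) * norm (x - y) * norm (classical_grad \<psi> (y + t *\<^sub>R (x - y)))) \<le> h x y t"
          using True c0 by (auto simp: h_def indicator_def ennreal_leI simp flip: ennreal_mult')
      qed
      finally show ?thesis using True by simp
    qed (auto simp: indicator_def)
    have "(\<integral>\<^sup>+x. \<integral>\<^sup>+y. indicator ?Q x * indicator ?Q y * ennreal (norm (\<psi> x - \<psi> y)) \<partial>lborel \<partial>lborel)
        \<le> (\<integral>\<^sup>+x. \<integral>\<^sup>+y. (\<integral>\<^sup>+t. h x y t \<partial>lborel) + (\<integral>\<^sup>+t. h y x t \<partial>lborel) \<partial>lborel \<partial>lborel)"
    proof (intro nn_integral_mono)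
      fix x y :: "real^'d"
      have m: "x + (1/2) *\<^sub>R (y - x) = y + (1/2) *\<^sub>R (x - y)"
        by (simp add: vec_eq_iff field_simps)
      have "indicator ?Q x * indicator ?Q y * ennreal (norm (\<psi> x - \<psi> y))
          \<le> indicator ?Q x * indicator ?Q y * (ennreal (norm (\<psi> x - \<psi> (y + (1/2) *\<^sub>R (x - y))))
            + ennreal (norm (\<psi> y - \<psi> (y + (1/2) *\<^sub>R (x - y)))))"
        using norm_triangle_ineq4[of "\<psi> x - \<psi> (y + (1/2) *\<^sub>R (x - y))" "\<psi> y - \<psi> (y + (1/2) *\<^sub>R (x - y))"]
        by (intro mult_left_mono) (auto simp flip: ennreal_plus intro!: ennreal_leI)
      also have "\<dots> \<le> (\<integral>\<^sup>+t. h x y t \<partial>lborel) + (\<integral>\<^sup>+t. h y x t \<partial>lborel)"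
        using add_mono[OF half[of x y] half[of y x]] by (simp add: distrib_left m mult.commute[of "indicator ?Q y"])
      finally show "indicator ?Q x * indicator ?Q y * ennreal (norm (\<psi> x - \<psi> y))
          \<le> (\<integral>\<^sup>+t. h x y t \<partial>lborel) + (\<integral>\<^sup>+t. h y x t \<partial>lborel)" .
    qed
    also have "\<dots> = (\<integral>\<^sup>+x. \<integral>\<^sup>+y. (\<integral>\<^sup>+t. h x y t \<partial>lborel) \<partial>lborel \<partial>lborel)
        + (\<integral>\<^sup>+x. \<integral>\<^sup>+y. (\<integral>\<^sup>+t. h y x t \<partial>lborel) \<partial>lborel \<partial>lborel)"
      by (simp add: nn_integral_add)
    \<comment> \<open>After the exchange both halves are the same integral up to renaming. The
      innermost space variable is now the end point that moves, ready for the substitution with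
      \<open>y\<close> and \<open>t\<close> fixed.\<close>
    also have "(\<integral>\<^sup>+x. \<integral>\<^sup>+y. (\<integral>\<^sup>+t. h x y t \<partial>lborel) \<partial>lborel \<partial>lborel)
        = (\<integral>\<^sup>+y. \<integral>\<^sup>+x. (\<integral>\<^sup>+t. h x y t \<partial>lborel) \<partial>lborel \<partial>lborel)"
      by (rule lborel_pair.Fubini') measurable
    also have "(\<integral>\<^sup>+y. \<integral>\<^sup>+x. (\<integral>\<^sup>+t. h x y t \<partial>lborel) \<partial>lborel \<partial>lborel)
        + (\<integral>\<^sup>+x. \<integral>\<^sup>+y. (\<integral>\<^sup>+t. h y x t \<partial>lborel) \<partial>lborel \<partial>lborel)
        = 2 * (\<integral>\<^sup>+y. \<integral>\<^sup>+x. (\<integral>\<^sup>+t. h x y t \<partial>lborel) \<partial>lborel \<partial>lborel)"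
      by (simp add: mult_2)
    also have "(\<integral>\<^sup>+y. \<integral>\<^sup>+x. (\<integral>\<^sup>+t. h x y t \<partial>lborel) \<partial>lborel \<partial>lborel)
        \<le> (\<integral>\<^sup>+y. indicator ?Q y * (ennreal c * 2 ^ CARD('d) * ?G) \<partial>lborel)"
    proof (intro nn_integral_mono)
      fix y
      have "(\<integral>\<^sup>+x. (\<integral>\<^sup>+t. h x y t \<partial>lborel) \<partial>lborel) = (\<integral>\<^sup>+t. (\<integral>\<^sup>+x. h x y t \<partial>lborel) \<partial>lborel)"
        by (rule lborel_pair.Fubini'[symmetric]) measurable
      also have "\<dots> \<le> (\<integral>\<^sup>+t. indicator ?Q y * (ennreal c * 2 ^ CARD('d) * ?G) * indicator {1/2..1::real} t \<partial>lborel)"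
      proof (intro nn_integral_mono)
        fix t :: real
        show "(\<integral>\<^sup>+x. h x y t \<partial>lborel) \<le> indicator ?Q y * (ennreal c * 2 ^ CARD('d) * ?G) * indicator {1/2..1} t"
        proof (cases "y \<in> ?Q \<and> t \<in> {1/2..1}")
          case True
          let ?z = "y - t *\<^sub>R y"
          have "(\<integral>\<^sup>+x. h x y t \<partial>lborel) \<le> (\<integral>\<^sup>+x. ennreal c * (indicator ?Q (?z + t *\<^sub>R x) * ?F (?z + t *\<^sub>R x)) \<partial>lborel)"
          proof (intro nn_integral_mono)
            fix x
            have e: "y + t *\<^sub>R (x - y) = ?z + t *\<^sub>R x" by (simp add: algebra_simps)
            \<comment> \<open>Convexity of the cell keeps the segment inside, so the gradient is
              evaluated only at points of the cell.\<close>
            have "?z + t *\<^sub>R x \<in> ?Q" if "x \<in> ?Q"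
              using convexD_alt[OF convex_box(2), of y 0 l x t] True that by (simp add: algebra_simps)
            then show "h x y t \<le> ennreal c * (indicator ?Q (?z + t *\<^sub>R x) * ?F (?z + t *\<^sub>R x))"
              unfolding h_def e by (auto simp: indicator_def)
          qed
          also have "\<dots> = ennreal c * (\<integral>\<^sup>+x. indicator ?Q (?z + t *\<^sub>R x) * ?F (?z + t *\<^sub>R x) \<partial>lborel)"
            by (rule nn_integral_cmult) measurable
          also have "\<dots> \<le> ennreal c * (2 ^ CARD('d) * ?G)"
            using True by (intro mult_left_mono nn_integral_affine_le[of "\<lambda>x. indicator ?Q x * ?F x"]) auto
          finally show ?thesis using True by (simp add: mult.assoc)
        next
          case False
          then have "h x y t = 0" for x by (auto simp: h_def)
          then show ?thesis by simp
        qed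
      qed
      \<comment> \<open>The \<open>t\<close>-interval has length 1/2; this factor is estimated by 1
        afterwards.\<close>
      also have "\<dots> = indicator ?Q y * (ennreal c * 2 ^ CARD('d) * ?G) * ennreal (1/2)"
        by (subst nn_integral_cmult_indicator) auto
      also have "\<dots> \<le> indicator ?Q y * (ennreal c * 2 ^ CARD('d) * ?G) * 1"
        by (intro mult_left_mono) (simp_all only: ennreal_le_1 zero_le)
      finally show "(\<integral>\<^sup>+x. (\<integral>\<^sup>+t. h x y t \<partial>lborel) \<partial>lborel) \<le> indicator ?Q y * (ennreal c * 2 ^ CARD('d) * ?G)"
        by simp
    qed
    also have "(\<integral>\<^sup>+y. indicator ?Q y * (ennreal c * 2 ^ CARD('d) * ?G) \<partial>lborel) = ennreal c * 2 ^ CARD('d) * ?G"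
      by (simp add: nn_integral_multc vol)
    also have "2 * (ennreal c * 2 ^ CARD('d) * ?G) = ennreal ?C * ?G"
      using c0 by (simp add: ennreal_mult' mult.assoc flip: ennreal_power)
    finally show "(\<integral>\<^sup>+x. \<integral>\<^sup>+y. indicator ?Q x * indicator ?Q y * ennreal (norm (\<psi> x - \<psi> y)) \<partial>lborel \<partial>lborel)
        \<le> ennreal ?C * ?G"
      by (simp add: mult_left_mono)
  qed (use c0 in simp)
qed

text \<open>Exchange of integrals and affine substitution are carried out over
  \<open>lborel\<close>, whereas cell integrals use the completed measure; this passes between the
  two.\<close>

lemma nn_integral_lebesgue_on:
  "(\<integral>\<^sup>+x. f x \<partial>lebesgue_on (box 0 l)) = (\<integral>\<^sup>+x. indicator (box 0 l) x * f x \<partial>lborel)"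
  by (simp add: nn_integral_restrict_space nn_integral_completion mult.commute)

locale unit_cell =
  fixes l :: "real^'d"
  assumes measure_cell: "measure lebesgue (box 0 l) = 1"
begin

abbreviation M :: "(real^'d) measure" where "M \<equiv> lebesgue_on (box 0 l)"

lemma measure_M [simp]: "measure M (box 0 l) = 1"
  using measure_cell by (simp add: measure_restrict_space)

sublocale finite_measure M
  by (rule finite_measureI) (use measure_M in \<open>auto simp: measure_def space_restrict_space\<close>)

lemma cell_mean_eq: "cell_mean l f = integral\<^sup>L M f"
  by (simp add: cell_mean_def measure_cell)

lemma integral_const_M: "(LINT x|M. c) = (c :: 'b :: {banach, second_countable_topology})"
  by simp

lemma L2_on_const: "L2_on (box 0 l) (\<lambda>x. c :: 'b :: real_normed_vector)"
  by (simp add: L2_on_def)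

lemma L2_on_integrable:
  fixes f :: "real^'d \<Rightarrow> 'b :: {banach, second_countable_topology}"
  assumes "L2_on (box 0 l) f"
  shows "integrable M f"
proof -
  have "integrable M (\<lambda>x. 1 + (norm (f x))\<^sup>2)" "f \<in> borel_measurable M"
    using assms by (auto simp: L2_on_def)
  then show ?thesis
  proof (rule Bochner_Integration.integrable_bound)
    show "AE x in M. norm (f x) \<le> norm (1 + (norm (f x))\<^sup>2)"
    proof (intro AE_I2)
      fix x
      show "norm (f x) \<le> norm (1 + (norm (f x))\<^sup>2)"
        using sum_squares_bound[of 1 "norm (f x)"] norm_ge_zero[of "f x"] by (simp del: norm_ge_zero)
    qed
  qed
qed

text \<open>The variance of \<open>norm (f x)\<close> is nonnegative. Total mass 1 of the cell
  enters here.\<close>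

lemma L1_le_L2:
  fixes f :: "real^'d \<Rightarrow> 'b :: {banach, second_countable_topology}"
  assumes f: "L2_on (box 0 l) f"
  shows "(LINT x|M. norm (f x)) \<le> sqrt (LINT x|M. (norm (f x))\<^sup>2)"
proof -
  let ?c = "LINT x|M. norm (f x)"
  have i: "integrable M (\<lambda>x. norm (f x))" "integrable M (\<lambda>x. (norm (f x))\<^sup>2)"
    using f L2_on_integrable[OF f] by (auto simp: L2_on_def)
  have "0 \<le> (LINT x|M. (norm (f x) - ?c)\<^sup>2)"
    by simp
  also have "\<dots> = (LINT x|M. (norm (f x))\<^sup>2 - 2 * ?c * norm (f x) + ?c\<^sup>2)"
    by (simp add: power2_diff algebra_simps)
  also have "\<dots> = (LINT x|M. (norm (f x))\<^sup>2) - ?c\<^sup>2"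
    using i by (simp add: integral_const_M power2_eq_square)
  finally show ?thesis
    by (intro real_le_rsqrt) simp
qed

text \<open>As the cell has volume 1, \<open>\<psi> x\<close> minus its mean is the integral over
  \<open>y\<close> of \<open>\<psi> x - \<psi> y\<close>. The double integral bounded above
  therefore dominates the deviation from the mean.\<close>

lemma poincare:
  "\<exists>C. \<forall>\<psi>. smooth \<psi> \<longrightarrow>
    (LINT x|M. norm (\<psi> x - integral\<^sup>L M \<psi>)) \<le> C * (LINT x|M. norm (classical_grad \<psi> x))"
proof -
  obtain C where C: "C \<ge> 0" "\<And>\<psi>. smooth \<psi> \<Longrightarrow>
    (\<integral>\<^sup>+x. \<integral>\<^sup>+y. indicator (box 0 l) x * indicator (box 0 l) y * ennreal (norm (\<psi> x - \<psi> y)) \<partial>lborel \<partial>lborel)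
     \<le> ennreal C * (\<integral>\<^sup>+x. indicator (box 0 l) x * ennreal (norm (classical_grad \<psi> x)) \<partial>lborel)"
    using nn_poincare[OF measure_cell] by auto
  have "(LINT x|M. norm (\<psi> x - integral\<^sup>L M \<psi>)) \<le> C * (LINT x|M. norm (classical_grad \<psi> x))"
    if \<psi>: "smooth \<psi>" for \<psi>
  proof -
    have [measurable]: "\<psi> \<in> borel_measurable borel"
      by (intro borel_measurable_continuous_onI smooth_continuous \<psi>)
    have i: "integrable M \<psi>" "integrable M (classical_grad \<psi>)"
      using \<psi> by (auto intro!: L2_on_integrable L2_on_box_continuous smooth_continuous classical_grad_continuous)
    have "ennreal (LINT x|M. norm (\<psi> x - integral\<^sup>L M \<psi>)) = (\<integral>\<^sup>+x. ennreal (norm (\<psi> x - integral\<^sup>L M \<psi>)) \<partial>M)"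
      by (rule nn_integral_eq_integral[symmetric]) (use i in auto)
    also have "\<dots> \<le> (\<integral>\<^sup>+x. (\<integral>\<^sup>+y. ennreal (norm (\<psi> x - \<psi> y)) \<partial>M) \<partial>M)"
    proof (intro nn_integral_mono)
      fix x
      have "\<psi> x - integral\<^sup>L M \<psi> = (LINT y|M. \<psi> x - \<psi> y)"
        using i by (simp add: integral_const_M)
      also have "ennreal (norm \<dots>) \<le> (\<integral>\<^sup>+y. ennreal (norm (\<psi> x - \<psi> y)) \<partial>M)"
        by (rule integral_norm_bound_ennreal) (use i in auto)
      finally show "ennreal (norm (\<psi> x - integral\<^sup>L M \<psi>)) \<le> (\<integral>\<^sup>+y. ennreal (norm (\<psi> x - \<psi> y)) \<partial>M)" .
    qed
    also have "\<dots> = (\<integral>\<^sup>+x. \<integral>\<^sup>+y. indicator (box 0 l) x * indicator (box 0 l) y * ennreal (norm (\<psi> x - \<psi> y)) \<partial>lborel \<partial>lborel)"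
      unfolding nn_integral_lebesgue_on
      by (intro nn_integral_cong) (simp add: nn_integral_cmult[symmetric] mult.assoc)
    also have "\<dots> \<le> ennreal C * (\<integral>\<^sup>+x. indicator (box 0 l) x * ennreal (norm (classical_grad \<psi> x)) \<partial>lborel)"
      by (rule C(2)[OF \<psi>])
    also have "(\<integral>\<^sup>+x. indicator (box 0 l) x * ennreal (norm (classical_grad \<psi> x)) \<partial>lborel) = ennreal (LINT x|M. norm (classical_grad \<psi> x))"
      unfolding nn_integral_lebesgue_on[symmetric]
      by (rule nn_integral_eq_integral) (use i in auto)
    finally show ?thesis
      using C(1) by (simp flip: ennreal_mult)
  qed
  then show ?thesis by blast
qed

text \<open>Smooth approximants of \<open>g\<close> have gradients tending to 0 in L^2, hence in
  L^1, so by the Poincare inequality their deviations from the mean tend to 0 as well. The deviation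
  of \<open>g\<close> is within twice the L^1 distance of that of an approximant.\<close>

lemma constant_if_gradient_0:
  assumes g: "H1p l g Dg" and Dg: "AE x in M. Dg x = 0"
  shows "AE x in M. g x = integral\<^sup>L M g"
proof -
  \<comment> \<open>The trace on any one face is taken for the sake of the approximating sequence
    that it carries.\<close>
  obtain t and j :: 'd where t: "has_trace l g Dg j 0 t"
    using g unfolding H1p_def by blast
  obtain \<psi> where \<psi>: "\<And>m. smooth (\<psi> m)" "L2_conv (box 0 l) \<psi> g"
    "L2_conv (box 0 l) (\<lambda>m. classical_grad (\<psi> m)) Dg"
    by (rule has_trace_sequence[OF t], rule that)
  obtain C where C: "\<And>\<psi>. smooth \<psi> \<Longrightarrow>
      (LINT x|M. norm (\<psi> x - integral\<^sup>L M \<psi>)) \<le> C * (LINT x|M. norm (classical_grad \<psi> x))"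
    using poincare by blast
  let ?a = "\<lambda>m. sqrt (LINT x|M. (norm (\<psi> m x - g x))\<^sup>2)"
  let ?b = "\<lambda>m. sqrt (LINT x|M. (norm (classical_grad (\<psi> m) x - Dg x))\<^sup>2)"
  have le: "(LINT x|M. norm (g x - integral\<^sup>L M g)) \<le> 2 * ?a m + \<bar>C\<bar> * ?b m" for m
  proof -
    have L: "L2_on (box 0 l) (\<psi> m)" "L2_on (box 0 l) (classical_grad (\<psi> m))"
      using \<psi>(1)[of m] by (auto intro!: L2_on_box_continuous smooth_continuous classical_grad_continuous)
    note i = L2_on_integrable[OF L(1)] L2_on_integrable[OF L(2)]
      L2_on_integrable[OF H1p_L2_on(1)[OF g]] L2_on_integrable[OF H1p_L2_on(2)[OF g]]
    have a: "(LINT x|M. norm (\<psi> m x - g x)) \<le> ?a m"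
      by (rule L1_le_L2[OF L2_on_diff[OF L(1) H1p_L2_on(1)[OF g]]])
    have "(LINT x|M. norm (classical_grad (\<psi> m) x)) = (LINT x|M. norm (classical_grad (\<psi> m) x - Dg x))"
      using Dg i by (intro integral_cong_AE) auto
    then have b: "(LINT x|M. norm (classical_grad (\<psi> m) x)) \<le> ?b m"
      using L1_le_L2[OF L2_on_diff[OF L(2) H1p_L2_on(2)[OF g]]] by simp
    have "(LINT x|M. norm (g x - integral\<^sup>L M g)) \<le> (LINT x|M. norm (\<psi> m x - g x)
        + norm (\<psi> m x - integral\<^sup>L M (\<psi> m)) + norm (integral\<^sup>L M (\<psi> m) - integral\<^sup>L M g))"
    proof (intro integral_mono)
      fix x
      show "norm (g x - integral\<^sup>L M g) \<le> norm (\<psi> m x - g x)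
        + norm (\<psi> m x - integral\<^sup>L M (\<psi> m)) + norm (integral\<^sup>L M (\<psi> m) - integral\<^sup>L M g)"
        using norm_triangle_ineq[of "g x - \<psi> m x + (\<psi> m x - integral\<^sup>L M (\<psi> m))" "integral\<^sup>L M (\<psi> m) - integral\<^sup>L M g"]
          norm_triangle_ineq[of "g x - \<psi> m x" "\<psi> m x - integral\<^sup>L M (\<psi> m)"]
        by (simp add: norm_minus_commute[of "g x"])
    qed (use i in auto)
    also have "\<dots> = (LINT x|M. norm (\<psi> m x - g x)) + (LINT x|M. norm (\<psi> m x - integral\<^sup>L M (\<psi> m)))
        + norm (LINT x|M. \<psi> m x - g x)"
      using i by (simp add: integral_const_M)
    also have "\<dots> \<le> ?a m + \<bar>C\<bar> * ?b m + ?a m"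
    proof (intro add_mono a)
      show "norm (LINT x|M. \<psi> m x - g x) \<le> ?a m"
        by (rule order_trans[OF integral_norm_bound a])
      have "(LINT x|M. norm (\<psi> m x - integral\<^sup>L M (\<psi> m))) \<le> C * (LINT x|M. norm (classical_grad (\<psi> m) x))"
        by (rule C[OF \<psi>(1)])
      also have "\<dots> \<le> \<bar>C\<bar> * ?b m"
        using b by (intro mult_mono) auto
      finally show "(LINT x|M. norm (\<psi> m x - integral\<^sup>L M (\<psi> m))) \<le> \<bar>C\<bar> * ?b m" .
    qed
    finally show ?thesis by simp
  qed
  have "(\<lambda>m. 2 * ?a m + \<bar>C\<bar> * ?b m) \<longlonglongrightarrow> 2 * sqrt 0 + \<bar>C\<bar> * sqrt 0"
    using \<psi>(2,3) unfolding L2_conv_def by (intro tendsto_intros)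
  then have "(LINT x|M. norm (g x - integral\<^sup>L M g)) \<le> 0"
    using le by (intro LIMSEQ_le_const[of _ 0]) auto
  moreover have "integrable M (\<lambda>x. norm (g x - integral\<^sup>L M g))"
    using L2_on_integrable[OF H1p_L2_on(1)[OF g]] by auto
  ultimately have "AE x in M. norm (g x - integral\<^sup>L M g) = 0"
    using integral_nonneg_eq_0_iff_AE[of M "\<lambda>x. norm (g x - integral\<^sup>L M g)"]
    by (auto intro: antisym)
  then show ?thesis by simp
qed

end

subsection \<open>Energy and mass pairings\<close>

lemma bdot_commute: "bdot u w = bdot w u"
  by (simp add: bdot_def mult.commute)

lemma bdot_add_left: "bdot (u + u') w = bdot u w + bdot u' w"
  by (simp add: bdot_def sum.distrib distrib_right)

lemma bdot_scale_left: "bdot (c *s u) w = c * bdot u w"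
  by (simp add: bdot_def sum_distrib_left mult.assoc)

lemma bdot_scale_right: "bdot u (c *s w) = c * bdot u w"
  by (simp add: bdot_commute[of u] bdot_scale_left)

lemma bdot_0_left [simp]: "bdot 0 w = 0"
  by (simp add: bdot_def)

lemma bdot_0_right [simp]: "bdot w 0 = 0"
  by (simp add: bdot_def)

lemma L2_on_scale: 
  assumes "L2_on Y f" shows "L2_on Y (\<lambda>x. c *s (f x :: complex^'n))"
  by (rule L2_on_vec) (simp add: L2_on_cmult L2_on_nth assms)

lemma L2_on_scale_vec: 
  assumes "L2_on Y f" shows "L2_on Y (\<lambda>x. f x *s (u :: complex^'n))"
  by (rule L2_on_vec) (simp add: L2_on_bounded_linear[OF bounded_linear_mult_left assms])

lemma coefficient_L2_on:
  assumes c: "coefficient l c" and f: "L2_on (box 0 l) f"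
  shows "L2_on (box 0 l) (\<lambda>x. of_real (c x) * (f x :: complex))"
proof -
  from c obtain K where K: "AE x in lebesgue_on (box 0 l). \<bar>c x\<bar> \<le> K"
    and m: "c \<in> borel_measurable (lebesgue_on (box 0 l))"
    unfolding coefficient_def by blast
  show ?thesis
  proof (rule L2_on_bound[OF f])
    show "(\<lambda>x. of_real (c x) * f x) \<in> borel_measurable (lebesgue_on (box 0 l))"
      using m f by (auto simp: L2_on_def)
    show "AE x in lebesgue_on (box 0 l). norm (of_real (c x) * f x) \<le> K * norm (f x)"
      using K by eventually_elim (simp add: norm_mult mult_right_mono)
  qed
qed

lemma coefficient_L2_on_vec:
  assumes c: "coefficient l c" and f: "L2_on (box 0 l) f"
  shows "L2_on (box 0 l) (\<lambda>x. of_real (c x) *s (f x :: complex^'n))"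
  by (rule L2_on_vec) (simp add: coefficient_L2_on[OF c] L2_on_nth f)

locale elliptic_cell = unit_cell l for l :: "real^'d" +
  fixes G \<rho> :: "real^'d \<Rightarrow> real"
  assumes coeff: "coefficient l G" "coefficient l \<rho>"
begin

abbreviation L2v :: "(real^'d \<Rightarrow> 'b::real_normed_vector) \<Rightarrow> bool" where
  "L2v \<equiv> L2_on (box 0 l)"

text \<open>Complex bilinear rather than sesquilinear, in accordance with \<open>bdot\<close> and
  the full contraction. Being symmetric, it allows two cell problems to be tested with each other's
  solutions.\<close>

definition energy :: "(real^'d \<Rightarrow> complex^'d) \<Rightarrow> (real^'d \<Rightarrow> complex^'d) \<Rightarrow> complex" where
  "energy u w = (LINT x|M. of_real (G x) * bdot (u x) (w x))"

definition mass :: "(real^'d \<Rightarrow> complex) \<Rightarrow> (real^'d \<Rightarrow> complex) \<Rightarrow> complex" where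
  "mass f g = (LINT x|M. of_real (\<rho> x) * f x * g x)"

lemma energy_commute: "energy u w = energy w u"
  by (simp add: energy_def bdot_commute)

lemma mass_commute: "mass u w = mass w u"
  by (simp add: mass_def mult_ac)

lemma energy_integrable:
  assumes "L2v u" "L2v w"
  shows "integrable M (\<lambda>x. of_real (G x) * bdot (u x) (w x))"
  using integrable_L2_bdot[OF coefficient_L2_on_vec[OF coeff(1) assms(1)] assms(2)]
  by (simp add: bdot_scale_left)

lemma mass_integrable:
  fixes u w :: "real^'d \<Rightarrow> complex"
  assumes "L2v u" "L2v w"
  shows "integrable M (\<lambda>x. of_real (\<rho> x) * u x * w x)"
  using integrable_L2_mult[OF coefficient_L2_on[OF coeff(2) assms(1)] assms(2)] .

text \<open>Four summands are enough for the longest expansion, that of \<open>v 3\<close>; shorter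
  ones are padded with zero coefficients. Equality is asked only a.e. because the expansions come
  from a uniqueness result that holds a.e.\<close>

lemma energy_lincomb:
  assumes L: "L2v P" "L2v u\<^sub>1" "L2v u\<^sub>2" "L2v u\<^sub>3" "L2v u\<^sub>4" "L2v w"
    and P: "AE x in M. P x = c\<^sub>1 *s u\<^sub>1 x + c\<^sub>2 *s u\<^sub>2 x + c\<^sub>3 *s u\<^sub>3 x + c\<^sub>4 *s u\<^sub>4 x"
  shows "energy P w = c\<^sub>1 * energy u\<^sub>1 w + c\<^sub>2 * energy u\<^sub>2 w + c\<^sub>3 * energy u\<^sub>3 w + c\<^sub>4 * energy u\<^sub>4 w"
proof -
  note i = energy_integrable[OF L(1,6)] energy_integrable[OF L(2,6)] energy_integrable[OF L(3,6)]
    energy_integrable[OF L(4,6)] energy_integrable[OF L(5,6)]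
  have "energy P w = (LINT x|M. c\<^sub>1 * (of_real (G x) * bdot (u\<^sub>1 x) (w x)) + c\<^sub>2 * (of_real (G x) * bdot (u\<^sub>2 x) (w x))
      + c\<^sub>3 * (of_real (G x) * bdot (u\<^sub>3 x) (w x)) + c\<^sub>4 * (of_real (G x) * bdot (u\<^sub>4 x) (w x)))"
    unfolding energy_def
  proof (rule integral_cong_AE)
    show "AE x in M. of_real (G x) * bdot (P x) (w x) = c\<^sub>1 * (of_real (G x) * bdot (u\<^sub>1 x) (w x)) + c\<^sub>2 * (of_real (G x) * bdot (u\<^sub>2 x) (w x))
      + c\<^sub>3 * (of_real (G x) * bdot (u\<^sub>3 x) (w x)) + c\<^sub>4 * (of_real (G x) * bdot (u\<^sub>4 x) (w x))"
      using P by eventually_elim (simp add: bdot_add_left bdot_scale_left algebra_simps)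
  qed (use i in \<open>auto intro!: borel_measurable_add borel_measurable_times dest: borel_measurable_integrable\<close>)
  also have "\<dots> = c\<^sub>1 * energy u\<^sub>1 w + c\<^sub>2 * energy u\<^sub>2 w + c\<^sub>3 * energy u\<^sub>3 w + c\<^sub>4 * energy u\<^sub>4 w"
    unfolding energy_def using i by simp
  finally show ?thesis .
qed

lemma mass_lincomb:
  assumes L: "L2v f" "L2v g\<^sub>1" "L2v g\<^sub>2" "L2v g\<^sub>3" "L2v g\<^sub>4" "L2v w"
    and P: "AE x in M. f x = c\<^sub>1 * g\<^sub>1 x + c\<^sub>2 * g\<^sub>2 x + c\<^sub>3 * g\<^sub>3 x + c\<^sub>4 * g\<^sub>4 x"
  shows "mass f w = c\<^sub>1 * mass g\<^sub>1 w + c\<^sub>2 * mass g\<^sub>2 w + c\<^sub>3 * mass g\<^sub>3 w + c\<^sub>4 * mass g\<^sub>4 w"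
proof -
  note i = mass_integrable[OF L(1,6)] mass_integrable[OF L(2,6)] mass_integrable[OF L(3,6)]
    mass_integrable[OF L(4,6)] mass_integrable[OF L(5,6)]
  have "mass f w = (LINT x|M. c\<^sub>1 * (of_real (\<rho> x) * g\<^sub>1 x * w x) + c\<^sub>2 * (of_real (\<rho> x) * g\<^sub>2 x * w x)
      + c\<^sub>3 * (of_real (\<rho> x) * g\<^sub>3 x * w x) + c\<^sub>4 * (of_real (\<rho> x) * g\<^sub>4 x * w x))"
    unfolding mass_def
  proof (rule integral_cong_AE)
    show "AE x in M. of_real (\<rho> x) * f x * w x = c\<^sub>1 * (of_real (\<rho> x) * g\<^sub>1 x * w x) + c\<^sub>2 * (of_real (\<rho> x) * g\<^sub>2 x * w x)
      + c\<^sub>3 * (of_real (\<rho> x) * g\<^sub>3 x * w x) + c\<^sub>4 * (of_real (\<rho> x) * g\<^sub>4 x * w x)"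
      using P by eventually_elim (simp add: algebra_simps)
  qed (use i in \<open>auto intro!: borel_measurable_add borel_measurable_times dest: borel_measurable_integrable\<close>)
  also have "\<dots> = c\<^sub>1 * mass g\<^sub>1 w + c\<^sub>2 * mass g\<^sub>2 w + c\<^sub>3 * mass g\<^sub>3 w + c\<^sub>4 * mass g\<^sub>4 w"
    unfolding mass_def using i by simp
  finally show ?thesis .
qed

lemma energy_0 [simp]: "energy (\<lambda>x. 0) w = 0" "energy w (\<lambda>x. 0) = 0"
  by (simp_all add: energy_def)

lemma energy_add_left:
  assumes "L2v u" "L2v u'" "L2v w"
  shows "energy (\<lambda>x. u x + u' x) w = energy u w + energy u' w"
  using energy_lincomb[OF L2_on_add[OF assms(1,2)] assms(1,2) L2_on_zero L2_on_zero assms(3), of 1 1 0 0]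
  by simp

lemma energy_add_right:
  assumes "L2v u" "L2v u'" "L2v w"
  shows "energy w (\<lambda>x. u x + u' x) = energy w u + energy w u'"
  using energy_add_left[OF assms] by (simp add: energy_commute)

lemma mass_1_1: "mass (\<lambda>x. 1) (\<lambda>x. 1) = of_real (cell_mean l \<rho>)"
  by (simp add: mass_def cell_mean_eq)

lemma cell_mean_density_pos: "cell_mean l \<rho> > 0"
proof -
  from coeff(2) obtain m where m: "m > 0" "AE x in M. m \<le> \<rho> x"
    unfolding coefficient_def by blast
  have i: "integrable M \<rho>"
  proof -
    obtain K where K: "AE x in M. \<bar>\<rho> x\<bar> \<le> K" "\<rho> \<in> borel_measurable M"
      using coeff(2) unfolding coefficient_def by blast
    then show ?thesis by (intro integrable_const_bound[of _ K]) auto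
  qed
  have "(LINT x|M. m) \<le> (LINT x|M. \<rho> x)"
    using m i by (intro integral_mono_AE) auto
  then show ?thesis using m(1) by (simp add: cell_mean_eq)
qed

text \<open>Testing with the conjugate of the difference shows that the periodic problem determines
  the gradient, and the Poincare inequality then determines the solution up to its mean.\<close>

lemma periodic_solution_unique:
  assumes v: "H1p l v Dv" and w: "H1p l w Dw" and L: "L2v P" "L2v Q"
    and PQ: "AE x in M. P x - Q x = Dv x - Dw x"
    and eq: "\<And>\<phi> D\<phi>. H1p l \<phi> D\<phi> \<Longrightarrow> energy P D\<phi> = energy Q D\<phi>"
  shows "AE x in M. P x = Q x"
    and "AE x in M. v x = w x + (cell_mean l v - cell_mean l w)"
proof -
  define u where "u x = v x + (-1) * w x" for x
  define Du where "Du x = Dv x + (-1) *s Dw x" for x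
  have u: "H1p l u Du"
    unfolding u_def[abs_def] Du_def[abs_def] by (intro H1p_add H1p_cmult v w)
  let ?c = "\<lambda>x. \<chi> a. cnj (Du x $ a)"
  have c: "H1p l (\<lambda>x. cnj (u x)) ?c" by (rule H1p_cnj[OF u])
  \<comment> \<open>The lower-order parts of \<open>P\<close> and \<open>Q\<close> cancel, so
    \<open>Du\<close> is a.e. their difference and the two weak problems subtract to a homogeneous
    one.\<close>
  have "energy Du ?c = 1 * energy P ?c + (-1) * energy Q ?c + 0 * energy (\<lambda>x. 0) ?c + 0 * energy (\<lambda>x. 0) ?c"
  proof (rule energy_lincomb)
    show "AE x in M. Du x = 1 *s P x + (- 1) *s Q x + 0 *s 0 + 0 *s 0"
      using PQ by eventually_elim (simp add: Du_def)
  qed (use L H1p_L2_on[OF u] H1p_L2_on[OF c] in \<open>auto simp: L2_on_zero\<close>)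
  then have 0: "energy Du ?c = 0" using eq[OF c] by simp
  have e: "of_real (G x) * bdot (Du x) (?c x) = complex_of_real (G x * (norm (Du x))\<^sup>2)" for x
    by (simp add: bdot_def norm_power2_vec complex_norm_square del: of_real_power)
  obtain m where m: "m > 0" "AE x in M. m \<le> G x"
    using coeff(1) unfolding coefficient_def by blast
  have "integrable M (\<lambda>x. complex_of_real (G x * (norm (Du x))\<^sup>2))"
    using energy_integrable[OF H1p_L2_on(2)[OF u] H1p_L2_on(2)[OF c]] unfolding e .
  then have i: "integrable M (\<lambda>x. G x * (norm (Du x))\<^sup>2)"
    by (simp only: complex_of_real_integrable_eq)
  have "(LINT x|M. G x * (norm (Du x))\<^sup>2) = 0"
    using 0 unfolding energy_def e by (simp only: integral_complex_of_real of_real_eq_0_iff)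
  moreover have "AE x in M. 0 \<le> G x * (norm (Du x))\<^sup>2"
    using m(2) by eventually_elim (use m(1) in auto)
  ultimately have "AE x in M. G x * (norm (Du x))\<^sup>2 = 0"
    using integral_nonneg_eq_0_iff_AE[OF i] by simp
  then have Du0: "AE x in M. Du x = 0"
    using m(2) by eventually_elim (use m(1) in auto)
  show "AE x in M. P x = Q x"
    using PQ Du0 by eventually_elim (simp add: Du_def)
  have "integral\<^sup>L M u = cell_mean l v - cell_mean l w"
    unfolding u_def cell_mean_eq
    using L2_on_integrable[OF H1p_L2_on(1)[OF v]] L2_on_integrable[OF H1p_L2_on(1)[OF w]] by simp
  then show "AE x in M. v x = w x + (cell_mean l v - cell_mean l w)"
    using constant_if_gradient_0[OF u Du0] by (auto elim!: eventually_mono simp: u_def algebra_simps)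
qed

text \<open>
  \<open>\<kappa>\<close> plays the role of the wave vector and \<open>e\<close> of the dipole direction. \<open>w\<^sub>1, w\<^sub>2, w\<^sub>3\<close> are the
  cell functions contracted with powers of \<open>\<kappa>\<close>, and \<open>X, t\<^sub>2, t\<^sub>3\<close> are \<open>\<chi>\<^sup>(\<^sup>1\<^sup>)\<close> and the non-symmetric
  cell functions with the first index contracted with \<open>e\<close> and the others with \<open>\<kappa>\<close>.
\<close>

lemma dipole_mean_coefficients:
  fixes \<kappa> e :: "complex^'d" and \<omega> :: real
    and v :: "int \<Rightarrow> real^'d \<Rightarrow> complex" and Dv :: "int \<Rightarrow> real^'d \<Rightarrow> complex^'d"
    and w\<^sub>1 w\<^sub>2 w\<^sub>3 X t\<^sub>2 t\<^sub>3 :: "real^'d \<Rightarrow> complex"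
    and Dw\<^sub>1 Dw\<^sub>2 Dw\<^sub>3 DX Dt\<^sub>2 Dt\<^sub>3 :: "real^'d \<Rightarrow> complex^'d"
  defines "r\<^sub>0 \<equiv> complex_of_real (cell_mean l \<rho>)"
  defines "W\<^sub>1 \<equiv> \<lambda>x. Dw\<^sub>1 x + \<kappa>"
    and "W\<^sub>2 \<equiv> \<lambda>x. Dw\<^sub>2 x + w\<^sub>1 x *s \<kappa>"
    and "W\<^sub>3 \<equiv> \<lambda>x. Dw\<^sub>3 x + w\<^sub>2 x *s \<kappa>"
    and "X\<^sub>1 \<equiv> \<lambda>x. DX x + e"
    and "T\<^sub>2 \<equiv> \<lambda>x. Dt\<^sub>2 x + X x *s \<kappa>"
    and "T\<^sub>3 \<equiv> \<lambda>x. Dt\<^sub>3 x + t\<^sub>2 x *s \<kappa>"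
    and "U \<equiv> \<lambda>n x. Dv n x + v (n - 1) x *s \<kappa> - (if n = (2::int) then e else 0)"
  defines "\<mu> \<equiv> energy W\<^sub>1 (\<lambda>x. \<kappa>)" and "\<nu> \<equiv> energy X\<^sub>1 (\<lambda>x. \<kappa>)"
    and "r\<^sub>1 \<equiv> mass w\<^sub>1 (\<lambda>x. 1)" and "\<mu>t \<equiv> energy T\<^sub>2 (\<lambda>x. \<kappa>)"
  defines "a \<equiv> \<mu> + r\<^sub>0 * of_real (\<omega>\<^sup>2)"
    and "b \<equiv> energy W\<^sub>3 (\<lambda>x. \<kappa>) + mass w\<^sub>2 (\<lambda>x. 1) * of_real (\<omega>\<^sup>2)"
  assumes H: "H1p l w\<^sub>1 Dw\<^sub>1" "H1p l w\<^sub>2 Dw\<^sub>2" "H1p l w\<^sub>3 Dw\<^sub>3" "H1p l X DX" "H1p l t\<^sub>2 Dt\<^sub>2" "H1p l t\<^sub>3 Dt\<^sub>3"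
    and mean0: "cell_mean l w\<^sub>1 = 0" "cell_mean l w\<^sub>2 = 0" "cell_mean l X = 0" "cell_mean l t\<^sub>2 = 0"
    and w1: "\<And>\<phi> D\<phi>. H1p l \<phi> D\<phi> \<Longrightarrow> energy W\<^sub>1 D\<phi> = 0"
    and w2: "\<And>\<phi> D\<phi>. H1p l \<phi> D\<phi> \<Longrightarrow>
      energy W\<^sub>2 D\<phi> = energy W\<^sub>1 (\<lambda>x. \<phi> x *s \<kappa>) - \<mu> / r\<^sub>0 * mass (\<lambda>x. 1) \<phi>"
    and w3: "\<And>\<phi> D\<phi>. H1p l \<phi> D\<phi> \<Longrightarrow>
      energy W\<^sub>3 D\<phi> = energy W\<^sub>2 (\<lambda>x. \<phi> x *s \<kappa>) - \<mu> / r\<^sub>0 * mass w\<^sub>1 \<phi>"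
    and X: "\<And>\<phi> D\<phi>. H1p l \<phi> D\<phi> \<Longrightarrow> energy X\<^sub>1 D\<phi> = 0"
    and t2: "\<And>\<phi> D\<phi>. H1p l \<phi> D\<phi> \<Longrightarrow>
      energy T\<^sub>2 D\<phi> = energy X\<^sub>1 (\<lambda>x. \<phi> x *s \<kappa>) - \<nu> / r\<^sub>0 * mass (\<lambda>x. 1) \<phi>"
    and t3: "\<And>\<phi> D\<phi>. H1p l \<phi> D\<phi> \<Longrightarrow>
      energy T\<^sub>3 D\<phi> = energy T\<^sub>2 (\<lambda>x. \<phi> x *s \<kappa>) - \<mu>t * cell_mean l \<phi>
        - \<nu> / r\<^sub>0 * (mass w\<^sub>1 \<phi> - r\<^sub>1 * cell_mean l \<phi>)"
    and v_neg: "v (-2) = (\<lambda>x. 0)" "v (-1) = (\<lambda>x. 0)" "Dv (-1) = (\<lambda>x. 0)"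
    and v: "\<And>n. n \<in> {0..5} \<Longrightarrow> H1p l (v n) (Dv n)"
    and eq: "\<And>n \<phi> D\<phi>. n \<in> {0..5} \<Longrightarrow> H1p l \<phi> D\<phi> \<Longrightarrow>
      energy (U n) D\<phi> = energy (U (n - 1)) (\<lambda>x. \<phi> x *s \<kappa>) + of_real (\<omega>\<^sup>2) * mass (v (n - 2)) \<phi>"
    and nondegenerate: "a \<noteq> 0"
  shows "cell_mean l (v 0) = 0"
    and "a * cell_mean l (v 1) = \<nu>"
    and "a * cell_mean l (v 2) = \<mu>t - \<nu> * r\<^sub>1 / r\<^sub>0 + of_real (\<omega>\<^sup>2) * mass X (\<lambda>x. 1)"
    and "a * cell_mean l (v 3) + b * cell_mean l (v 1)
      = energy T\<^sub>3 (\<lambda>x. \<kappa>) + of_real (\<omega>\<^sup>2) * mass t\<^sub>2 (\<lambda>x. 1) - of_real (\<omega>\<^sup>2) * mass X w\<^sub>1"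
proof -
  define m where "m n = cell_mean l (v n)" for n
  let ?o = "\<lambda>x::real^'d. 1::complex"
  let ?k = "\<lambda>x::real^'d. \<kappa>"
  let ?z = "\<lambda>x::real^'d. 0::complex"
  let ?zv = "\<lambda>x::real^'d. 0::complex^'d"
  have r0: "r\<^sub>0 \<noteq> 0" using cell_mean_density_pos by (simp add: r\<^sub>0_def)
  have moo: "mass ?o ?o = r\<^sub>0" by (simp add: mass_1_1 r\<^sub>0_def)
  note h = H1p_L2_on(1)
  note L = h[OF H(1)] h[OF H(2)] h[OF H(3)] h[OF H(4)] h[OF H(5)] h[OF H(6)]
  note LD = H1p_L2_on(2)[OF H(1)] H1p_L2_on(2)[OF H(2)] H1p_L2_on(2)[OF H(3)] H1p_L2_on(2)[OF H(4)]
    H1p_L2_on(2)[OF H(5)] H1p_L2_on(2)[OF H(6)]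
  have Lv: "L2v (v n)" "L2v (Dv n)" if "n \<in> {0..5}" for n
    using H1p_L2_on[OF v[OF that]] by auto
  have Lk: "L2v (\<lambda>x. f x *s \<kappa>)" if "L2v f" for f by (rule L2_on_scale_vec[OF that])
  have LW: "L2v W\<^sub>1" "L2v W\<^sub>2" "L2v W\<^sub>3" "L2v X\<^sub>1" "L2v T\<^sub>2" "L2v T\<^sub>3"
    unfolding W\<^sub>1_def W\<^sub>2_def W\<^sub>3_def X\<^sub>1_def T\<^sub>2_def T\<^sub>3_def
    by (intro L2_on_add L2_on_const Lk L LD)+
  have Lz: "L2v ?z" "L2v ?zv" "L2v ?o" "L2v ?k" by (rule L2_on_const)+
  have LU: "L2v (U n)" if "n \<in> {0..5}" for n
  proof -
    have "L2v (v (n - 1))"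
    proof (cases "n = 0")
      case True then show ?thesis using v_neg Lz(1) by simp
    next
      case False then show ?thesis using that by (intro Lv) auto
    qed
    then show ?thesis
      unfolding U_def using that by (intro L2_on_add L2_on_diff L2_on_const Lk Lv(2))
  qed
  have one: "H1p l ?o ?zv" by (rule H1p_const)
  \<comment> \<open>A constant has zero gradient, so the left side of the problem of order
    \<open>n\<close> disappears and a condition on \<open>v (n - 1)\<close> and
    \<open>v (n - 2)\<close> remains.\<close>
  have test1: "0 = energy (U (n - 1)) ?k + of_real (\<omega>\<^sup>2) * mass (v (n - 2)) ?o" if "n \<in> {0..5}" for n
    using eq[OF that one] by simp
  have mass0: "mass ?z \<phi> = 0" for \<phi> by (simp add: mass_def)
  have cm: "H1p l (\<lambda>x. c * 1) (\<lambda>x. c *s 0)" for c by (rule H1p_cmult[OF one])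
  have Lp: "L2v (\<lambda>x. \<phi> x *s \<kappa>)" if "H1p l \<phi> D\<phi>" for \<phi> D\<phi>
    by (rule Lk[OF h[OF that]])

  \<comment> \<open>Orders 0 and 1, and the vanishing of the leading mean\<close>
  have zero: "H1p l ?z ?zv" using cm[of 0] by simp
  have cz: "cell_mean l ?z = 0" by (simp add: cell_mean_eq)
  have U0: "AE x in M. U 0 x = 0" and v0: "AE x in M. v 0 x = m 0"
  proof -
    have "U (-1) = ?zv" using v_neg by (simp add: U_def)
    then have e: "energy (U 0) D\<phi> = energy ?zv D\<phi>" if "H1p l \<phi> D\<phi>" for \<phi> D\<phi>
      using eq[OF _ that, of 0] v_neg by (simp add: mass0)
    have d: "AE x in M. U 0 x - ?zv x = Dv 0 x - ?zv x"
      using v_neg by (simp add: U_def)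
    note u = periodic_solution_unique[OF v[of 0] zero LU[of 0] Lz(2) d e]
    show "AE x in M. U 0 x = 0" using u(1) by simp
    show "AE x in M. v 0 x = m 0" using u(2) by (simp add: m_def cz)
  qed

  have U1: "AE x in M. U 1 x = m 0 *s W\<^sub>1 x" and v1: "AE x in M. v 1 x = m 0 * w\<^sub>1 x + m 1"
  proof -
    have e: "energy (U 1) D\<phi> = energy (\<lambda>x. m 0 *s W\<^sub>1 x) D\<phi>" if \<phi>: "H1p l \<phi> D\<phi>" for \<phi> D\<phi>
    proof -
      have "energy (U 0) (\<lambda>x. \<phi> x *s \<kappa>) = 0"
        using energy_lincomb[OF LU[of 0] Lz(2) Lz(2) Lz(2) Lz(2) Lp[OF \<phi>], of 0 0 0 0] U0 by simp
      moreover have "energy (\<lambda>x. m 0 *s W\<^sub>1 x) D\<phi> = m 0 * energy W\<^sub>1 D\<phi>"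
        using energy_lincomb[OF L2_on_scale[OF LW(1)] LW(1) Lz(2) Lz(2) Lz(2) H1p_L2_on(2)[OF \<phi>], of "m 0" "m 0" 0 0 0]
        by simp
      ultimately show ?thesis
        using eq[OF _ \<phi>, of 1] v_neg w1[OF \<phi>] by (simp add: mass0)
    qed
    \<comment> \<open>The expansion one order below makes the zeroth-order parts of
      \<open>U 1\<close> and of its candidate agree, so they differ by a gradient, as the uniqueness
      lemma requires. The same pattern recurs at orders 2 and 3.\<close>
    have d: "AE x in M. U 1 x - m 0 *s W\<^sub>1 x = Dv 1 x - m 0 *s Dw\<^sub>1 x"
      using v0 by eventually_elim (simp add: U_def W\<^sub>1_def vector_add_ldistrib)
    note u = periodic_solution_unique[OF v[of 1] H1p_cmult[OF H(1)] LU[of 1] L2_on_scale[OF LW(1)] d e]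
    show "AE x in M. U 1 x = m 0 *s W\<^sub>1 x" using u(1) by simp
    have "cell_mean l (\<lambda>x. m 0 * w\<^sub>1 x) = 0"
      using mean0(1) by (simp add: cell_mean_eq)
    then show "AE x in M. v 1 x = m 0 * w\<^sub>1 x + m 1" using u(2) by (simp add: m_def)
  qed

  \<comment> \<open>The order 2 condition reads \<open>m 0 * a = 0\<close>. The dipole is absent
    from it: the term \<open>- e\<close> enters \<open>U 2\<close>, whose mean appears first at
    order 3.\<close>
  have m0: "m 0 = 0"
  proof -
    have "energy (U 1) ?k = m 0 * \<mu>"
      using energy_lincomb[OF LU[of 1] LW(1) Lz(2) Lz(2) Lz(2) Lz(4), of "m 0" 0 0 0] U1 by (simp add: \<mu>_def)
    moreover have "mass (v 0) ?o = m 0 * r\<^sub>0"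
      using mass_lincomb[OF Lv(1)[of 0] Lz(3) Lz(1) Lz(1) Lz(1) Lz(3), of "m 0" 0 0 0] v0 by (simp add: moo)
    ultimately have "m 0 * a = 0"
      using test1[of 2] by (simp add: a_def algebra_simps)
    then show ?thesis using nondegenerate by simp
  qed
  then show "cell_mean l (v 0) = 0" by (simp add: m_def)

  \<comment> \<open>Orders 2 and 3, where the dipole enters\<close>
  have E1: "energy (U 1) u = 0" if "L2v u" for u
    using energy_lincomb[OF LU[of 1] Lz(2) Lz(2) Lz(2) Lz(2) that, of 0 0 0 0] U1 m0 by simp
  have M0: "mass (v 0) f = 0" if "L2v f" for f
    using mass_lincomb[OF Lv(1)[of 0] Lz(1) Lz(1) Lz(1) Lz(1) that, of 0 0 0 0] v0 m0 by simp
  have M1: "mass (v 1) f = m 1 * mass ?o f" if "L2v f" for f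
    using mass_lincomb[OF Lv(1)[of 1] Lz(3) Lz(1) Lz(1) Lz(1) that, of "m 1" 0 0 0] v1 m0 by simp

  have U2: "AE x in M. U 2 x = m 1 *s W\<^sub>1 x - X\<^sub>1 x"
    and v2: "AE x in M. v 2 x = m 1 * w\<^sub>1 x - X x + m 2"
  proof -
    \<comment> \<open>\<open>X\<^sub>1\<close> occurs with a minus sign because \<open>U 2\<close>
      contains \<open>- e\<close> while \<open>X\<^sub>1\<close> contains
      \<open>+ e\<close>.\<close>
    let ?Q = "\<lambda>x. m 1 *s W\<^sub>1 x + (-1) *s X\<^sub>1 x"
    have LQ: "L2v ?Q" by (intro L2_on_add L2_on_scale LW)
    have e: "energy (U 2) D\<phi> = energy ?Q D\<phi>" if \<phi>: "H1p l \<phi> D\<phi>" for \<phi> D\<phi>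
    proof -
      have "energy ?Q D\<phi> = m 1 * energy W\<^sub>1 D\<phi> - energy X\<^sub>1 D\<phi>"
        using energy_lincomb[OF LQ LW(1) LW(4) Lz(2) Lz(2) H1p_L2_on(2)[OF \<phi>], of "m 1" "-1" 0 0] by simp
      then show ?thesis
        using eq[OF _ \<phi>, of 2] E1[OF Lp[OF \<phi>]] M0[OF h[OF \<phi>]] w1[OF \<phi>] X[OF \<phi>] by simp
    qed
    have d: "AE x in M. U 2 x - ?Q x = Dv 2 x - (m 1 *s Dw\<^sub>1 x + (-1) *s DX x)"
      using v1 by eventually_elim (simp add: U_def W\<^sub>1_def X\<^sub>1_def m0 vector_add_ldistrib)
    note u = periodic_solution_unique[OF v[of 2] H1p_add[OF H1p_cmult[OF H(1)] H1p_cmult[OF H(4)]] LU[of 2] LQ d e]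
    show "AE x in M. U 2 x = m 1 *s W\<^sub>1 x - X\<^sub>1 x" using u(1) by simp
    have "cell_mean l (\<lambda>x. m 1 * w\<^sub>1 x + - 1 * X x) = 0"
      using mean0(1,3) L2_on_integrable[OF L(1)] L2_on_integrable[OF L(4)] by (simp add: cell_mean_eq)
    then show "AE x in M. v 2 x = m 1 * w\<^sub>1 x - X x + m 2" using u(2) by (simp add: m_def)
  qed
  have E2: "energy (U 2) u = m 1 * energy W\<^sub>1 u - energy X\<^sub>1 u" if "L2v u" for u
    using energy_lincomb[OF LU[of 2] LW(1) LW(4) Lz(2) Lz(2) that, of "m 1" "-1" 0 0] U2 by simp
  have M2: "mass (v 2) f = m 1 * mass w\<^sub>1 f - mass X f + m 2 * mass ?o f" if "L2v f" for f
    using mass_lincomb[OF Lv(1)[of 2] L(1) L(4) Lz(3) Lz(1) that, of "m 1" "-1" "m 2" 0] v2 by simp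

  have am1: "a * m 1 = \<nu>"
    using test1[of 3] E2[OF Lz(4)] M1[OF Lz(3)] by (simp add: a_def \<mu>_def \<nu>_def moo algebra_simps)
  then show "a * cell_mean l (v 1) = \<nu>" by (simp add: m_def)

  have U3: "AE x in M. U 3 x = m 1 *s W\<^sub>2 x - T\<^sub>2 x + m 2 *s W\<^sub>1 x"
    and v3: "AE x in M. v 3 x = m 1 * w\<^sub>2 x - t\<^sub>2 x + m 2 * w\<^sub>1 x + m 3"
  proof -
    let ?Q = "\<lambda>x. m 1 *s W\<^sub>2 x + (-1) *s T\<^sub>2 x + m 2 *s W\<^sub>1 x"
    have LQ: "L2v ?Q" by (intro L2_on_add L2_on_scale LW)
    have e: "energy (U 3) D\<phi> = energy ?Q D\<phi>" if \<phi>: "H1p l \<phi> D\<phi>" for \<phi> D\<phi>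
    proof -
      have Q: "energy ?Q D\<phi> = m 1 * energy W\<^sub>2 D\<phi> - energy T\<^sub>2 D\<phi> + m 2 * energy W\<^sub>1 D\<phi>"
        using energy_lincomb[OF LQ LW(2) LW(5) LW(1) Lz(2) H1p_L2_on(2)[OF \<phi>], of "m 1" "-1" "m 2" 0] by simp
      \<comment> \<open>The problems for \<open>w\<^sub>2\<close> and \<open>t\<^sub>2\<close> carry
        density sources normalised by \<mu> and \<nu>. By the equation for \<open>m 1\<close> they
        combine to precisely the inertial term of order 3.\<close>
      have "m 1 * (\<mu> / r\<^sub>0) - \<nu> / r\<^sub>0 = - of_real (\<omega>\<^sup>2) * m 1"
        using am1 r0 by (simp add: a_def field_simps)
      then have "energy ?Q D\<phi> = m 1 * energy W\<^sub>1 (\<lambda>x. \<phi> x *s \<kappa>) - energy X\<^sub>1 (\<lambda>x. \<phi> x *s \<kappa>)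
          + of_real (\<omega>\<^sup>2) * m 1 * mass ?o \<phi>"
        unfolding Q w1[OF \<phi>] w2[OF \<phi>] t2[OF \<phi>] by algebra
      then show ?thesis
        using eq[OF _ \<phi>, of 3] E2[OF Lp[OF \<phi>]] M1[OF h[OF \<phi>]] by simp
    qed
    have d: "AE x in M. U 3 x - ?Q x = Dv 3 x - (m 1 *s Dw\<^sub>2 x + (-1) *s Dt\<^sub>2 x + m 2 *s Dw\<^sub>1 x)"
      using v2
    proof eventually_elim
      case (elim x)
      show ?case by (simp add: U_def W\<^sub>1_def W\<^sub>2_def T\<^sub>2_def elim vec_eq_iff algebra_simps)
    qed
    note u = periodic_solution_unique[OF v[of 3] H1p_add[OF H1p_add[OF H1p_cmult[OF H(2)] H1p_cmult[OF H(5)]]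
          H1p_cmult[OF H(1)]] LU[of 3] LQ d e]
    show "AE x in M. U 3 x = m 1 *s W\<^sub>2 x - T\<^sub>2 x + m 2 *s W\<^sub>1 x" using u(1) by simp
    have "cell_mean l (\<lambda>x. m 1 * w\<^sub>2 x + - 1 * t\<^sub>2 x + m 2 * w\<^sub>1 x) = 0"
      using mean0 L2_on_integrable[OF L(1)] L2_on_integrable[OF L(2)] L2_on_integrable[OF L(5)]
      by (simp add: cell_mean_eq)
    then show "AE x in M. v 3 x = m 1 * w\<^sub>2 x - t\<^sub>2 x + m 2 * w\<^sub>1 x + m 3" using u(2) by (simp add: m_def)
  qed
  have E3: "energy (U 3) u = m 1 * energy W\<^sub>2 u - energy T\<^sub>2 u + m 2 * energy W\<^sub>1 u" if "L2v u" for u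
    using energy_lincomb[OF LU[of 3] LW(2) LW(5) LW(1) Lz(2) that, of "m 1" "-1" "m 2" 0] U3 by simp
  have M3: "mass (v 3) f = m 1 * mass w\<^sub>2 f - mass t\<^sub>2 f + m 2 * mass w\<^sub>1 f + m 3 * mass ?o f" if "L2v f" for f
    using mass_lincomb[OF Lv(1)[of 3] L(2) L(5) L(1) Lz(3) that, of "m 1" "-1" "m 2" "m 3"] v3 by simp

  \<comment> \<open>Reciprocity with the first cell problem, and order 4\<close>
  have swap: "energy P ?k = energy W\<^sub>1 (\<lambda>x. g x *s \<kappa>) - energy P Dw\<^sub>1"
    if P: "P = (\<lambda>x. Dg x + g x *s \<kappa>)" and g: "H1p l f Dg" "L2v g" for P f g Dg
  proof -
    have LP: "L2v P" unfolding P by (intro L2_on_add H1p_L2_on(2)[OF g(1)] Lk g(2))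
    \<comment> \<open>The pairing of \<open>P\<close> with \<open>W\<^sub>1\<close> is evaluated
      twice. Read from the side of \<open>W\<^sub>1\<close>, the gradient part of \<open>P\<close>
      drops out by the \<open>w\<^sub>1\<close> problem, so the mean flux of \<open>P\<close> is
      expressed through \<open>g\<close> and through \<open>P\<close> tested with
      \<open>w\<^sub>1\<close>.\<close>
    have "energy P Dw\<^sub>1 + energy P ?k = energy P W\<^sub>1"
      unfolding W\<^sub>1_def by (rule energy_add_right[OF LD(1) Lz(4) LP, symmetric])
    also have "\<dots> = energy W\<^sub>1 P" by (rule energy_commute)
    also have "\<dots> = energy W\<^sub>1 Dg + energy W\<^sub>1 (\<lambda>x. g x *s \<kappa>)"
      unfolding P by (rule energy_add_right[OF H1p_L2_on(2)[OF g(1)] Lk[OF g(2)] LW(1)])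
    finally show ?thesis using w1[OF g(1)] by (simp add: eq_diff_eq add.commute)
  qed
  \<comment> \<open>Testing the \<open>w\<^sub>2\<close> problem with \<open>w\<^sub>1\<close>
    yields the same term \<open>energy W\<^sub>1 (\<lambda>x. w\<^sub>1 x *s \<kappa>)\<close>,
    which cancels. The mean flux of this order thus reduces to \<mu> and \<open>r\<^sub>1\<close>,
    without a coefficient of its own.\<close>
  have W2k: "energy W\<^sub>2 ?k = \<mu> / r\<^sub>0 * r\<^sub>1"
    using swap[OF W\<^sub>2_def[THEN meta_eq_to_obj_eq] H(2) L(1)] w2[OF H(1)] by (simp add: r\<^sub>1_def mass_commute)

  have am2: "a * m 2 = \<mu>t - \<nu> * r\<^sub>1 / r\<^sub>0 + of_real (\<omega>\<^sup>2) * mass X ?o"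
  proof -
    \<comment> \<open>The terms with \<open>m 1\<close> add up to
      \<open>m 1 * r\<^sub>1 * a / r\<^sub>0\<close>, that is to
      \<open>\<nu> * r\<^sub>1 / r\<^sub>0\<close>. This is the origin of the subtracted term with
      \<open>\<rho>\<^sub>1 / \<rho>\<^sub>0\<close> in the numerator.\<close>
    have "0 = m 1 * (\<mu> / r\<^sub>0 * r\<^sub>1) - \<mu>t + m 2 * \<mu> + of_real (\<omega>\<^sup>2) * (m 1 * r\<^sub>1 - mass X ?o + m 2 * r\<^sub>0)"
      using test1[of 4] E3[OF Lz(4)] M2[OF Lz(3)] by (simp add: W2k \<mu>t_def \<mu>_def moo r\<^sub>1_def)
    then show ?thesis using am1 r0 by (simp add: a_def field_simps) algebra
  qed
  then show "a * cell_mean l (v 2) = \<mu>t - \<nu> * r\<^sub>1 / r\<^sub>0 + of_real (\<omega>\<^sup>2) * mass X ?o"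
    by (simp add: m_def)

  \<comment> \<open>Order 5 and the elimination of \<open>v 4\<close>\<close>
  let ?q = "mass w\<^sub>1 w\<^sub>1"
  let ?w1k = "\<lambda>x. w\<^sub>1 x *s \<kappa>"
  have W3k: "energy W\<^sub>3 ?k = energy W\<^sub>1 (\<lambda>x. w\<^sub>2 x *s \<kappa>) - energy W\<^sub>2 ?w1k + \<mu> / r\<^sub>0 * ?q"
    using swap[OF W\<^sub>3_def[THEN meta_eq_to_obj_eq] H(3) L(2)] w3[OF H(1)] by simp
  \<comment> \<open>The constants subtracted in the \<open>t\<^sub>3\<close> problem are multiplied
    by the mean of the test function \<open>w\<^sub>1\<close>, which is 0.\<close>
  have T3k: "energy T\<^sub>3 ?k = energy W\<^sub>1 (\<lambda>x. t\<^sub>2 x *s \<kappa>) - energy T\<^sub>2 ?w1k + \<nu> / r\<^sub>0 * ?q"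
    using swap[OF T\<^sub>3_def[THEN meta_eq_to_obj_eq] H(6) L(5)] t3[OF H(1)] mean0(1) by simp
  have U4: "U 4 = (\<lambda>x. Dv 4 x + v 3 x *s \<kappa>)" by (simp add: U_def)
  \<comment> \<open>Only \<open>v 3\<close> and \<open>v 2\<close> are left on the right. The last
    term contains \<open>mass X w\<^sub>1\<close> through the expansion of
    \<open>v 2\<close>.\<close>
  have U4k: "energy (U 4) ?k = energy W\<^sub>1 (\<lambda>x. v 3 x *s \<kappa>) - energy (U 3) ?w1k - of_real (\<omega>\<^sup>2) * mass (v 2) w\<^sub>1"
    using swap[OF U4 v[of 4] Lv(1)[of 3]] eq[OF _ H(1), of 4] by simp
  have W1v3: "energy W\<^sub>1 (\<lambda>x. v 3 x *s \<kappa>) = m 1 * energy W\<^sub>1 (\<lambda>x. w\<^sub>2 x *s \<kappa>) - energy W\<^sub>1 (\<lambda>x. t\<^sub>2 x *s \<kappa>)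
      + m 2 * energy W\<^sub>1 ?w1k + m 3 * \<mu>"
  proof -
    have "AE x in M. v 3 x *s \<kappa> = m 1 *s (w\<^sub>2 x *s \<kappa>) + (-1) *s (t\<^sub>2 x *s \<kappa>) + m 2 *s (w\<^sub>1 x *s \<kappa>) + m 3 *s \<kappa>"
      using v3
    proof eventually_elim
      case (elim x)
      show ?case by (simp add: elim vec_eq_iff algebra_simps)
    qed
    from energy_lincomb[OF Lk[OF Lv(1)[of 3]] Lk[OF L(2)] Lk[OF L(5)] Lk[OF L(1)] Lz(4) LW(1) this]
    show ?thesis by (simp add: energy_commute[of _ W\<^sub>1] \<mu>_def)
  qed
  \<comment> \<open>The mixed pairings of \<open>W\<^sub>1\<close>, \<open>W\<^sub>2\<close> and
    \<open>T\<^sub>2\<close> occur in just the combinations that \<open>W3k\<close> and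
    \<open>T3k\<close> identify. All terms with \<open>m 2\<close> cancel in pairs, so
    \<open>b\<close> multiplies \<open>m 1\<close> alone.\<close>
  have key: "0 = m 1 * (energy W\<^sub>3 ?k - \<mu> / r\<^sub>0 * ?q) - (energy T\<^sub>3 ?k - \<nu> / r\<^sub>0 * ?q) + m 3 * \<mu>
      - of_real (\<omega>\<^sup>2) * (m 1 * ?q - mass X w\<^sub>1 + m 2 * r\<^sub>1)
      + of_real (\<omega>\<^sup>2) * (m 1 * mass w\<^sub>2 ?o - mass t\<^sub>2 ?o + m 2 * r\<^sub>1 + m 3 * r\<^sub>0)"
  proof -
    have o: "mass ?o w\<^sub>1 = r\<^sub>1" "mass w\<^sub>1 ?o = r\<^sub>1"
      by (simp_all add: r\<^sub>1_def mass_commute)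
    have "0 = energy (U 4) ?k + of_real (\<omega>\<^sup>2) * mass (v 3) ?o"
      using test1[of 5] by simp
    then show ?thesis
      unfolding U4k W1v3 E3[OF Lk[OF L(1)]] M2[OF L(1)] M3[OF Lz(3)] W3k T3k moo o by algebra
  qed
  \<comment> \<open>This is the total coefficient of \<open>mass w\<^sub>1 w\<^sub>1\<close> up to
    sign. Its vanishing leaves \<open>mass X w\<^sub>1\<close> as the only quadratic term.\<close>
  have "m 1 * (\<mu> / r\<^sub>0) - \<nu> / r\<^sub>0 + of_real (\<omega>\<^sup>2) * m 1 = 0"
    using am1 r0 by (simp add: a_def field_simps)
  then have "a * m 3 + b * m 1
      = energy T\<^sub>3 ?k + of_real (\<omega>\<^sup>2) * mass t\<^sub>2 ?o - of_real (\<omega>\<^sup>2) * mass X w\<^sub>1"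
    using key unfolding a_def b_def by algebra
  then show "a * cell_mean l (v 3) + b * cell_mean l (v 1)
      = energy T\<^sub>3 ?k + of_real (\<omega>\<^sup>2) * mass t\<^sub>2 ?o - of_real (\<omega>\<^sup>2) * mass X w\<^sub>1"
    by (simp add: m_def)
qed

end

subsection \<open>Contraction of tensors\<close>

lemma finite_lists_of_length: "finite {ix :: 'd::finite list. length ix = n}"
  using finite_lists_length_eq[OF finite, of UNIV n] by simp

lemma sum_lists_Suc:
  fixes f :: "'d::finite list \<Rightarrow> 'b::comm_monoid_add"
  shows "(\<Sum>ix | length ix = Suc n. f ix) = (\<Sum>a\<in>UNIV. \<Sum>ix | length ix = n. f (a # ix))"
proof -
  have "(\<Sum>ix | length ix = Suc n. f ix) = (\<Sum>(a, ix)\<in>UNIV \<times> {ix. length ix = n}. f (a # ix))"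
    by (rule sum.reindex_bij_witness[of _ "\<lambda>(a, ix). a # ix" "\<lambda>ix. (hd ix, tl ix)"])
      (auto simp: length_Suc_conv)
  then show ?thesis by (simp add: sum.cartesian_product)
qed

lemma contract_cong:
  "(\<And>ix. length ix = n \<Longrightarrow> \<sigma> ix = \<sigma>' ix) \<Longrightarrow> contract n \<sigma> \<tau> = contract n \<sigma>' \<tau>"
  by (simp add: contract_def)

lemma contract_add: "contract n (\<lambda>ix. \<sigma> ix + \<sigma>' ix) \<tau> = contract n \<sigma> \<tau> + contract n \<sigma>' \<tau>"
  by (simp add: contract_def distrib_right sum.distrib)

lemma contract_diff: "contract n (\<lambda>ix. \<sigma> ix - \<sigma>' ix) \<tau> = contract n \<sigma> \<tau> - contract n \<sigma>' \<tau>"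
  by (simp add: contract_def left_diff_distrib sum_subtractf)

lemma contract_cmult: "contract n (\<lambda>ix. c * \<sigma> ix) \<tau> = c * contract n \<sigma> \<tau>"
  by (simp add: contract_def sum_distrib_left mult.assoc)

lemma contract_divide: "contract n (\<lambda>ix. \<sigma> ix / c) \<tau> = contract n \<sigma> \<tau> / c"
  using contract_cmult[of n "1 / c" \<sigma> \<tau>] by simp

lemma contract_Suc:
  "contract (Suc n) \<sigma> (tvec u \<otimes>\<^bsub>1\<^esub> \<tau>) = (\<Sum>a\<in>UNIV. u $ a * contract n (\<lambda>ix. \<sigma> (a # ix)) \<tau>)"
  by (simp add: contract_def sum_lists_Suc tprod_def tvec_def sum_distrib_left mult_ac)

lemma contract_tpow_Suc:
  "contract (Suc n) \<sigma> (tpow u (Suc n)) = (\<Sum>a\<in>UNIV. u $ a * contract n (\<lambda>ix. \<sigma> (a # ix)) (tpow u n))"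
  by (simp only: tpow.simps contract_Suc)

lemma contract_1: "contract 1 \<sigma> (tvec u \<otimes>\<^bsub>1\<^esub> tpow \<kappa> 0) = contract 1 \<sigma> (tvec u)"
  by (simp add: contract_def tprod_def)

text \<open>Reindexing the sum by each permutation moves it from \<tau> to \<open>W\<close>, where
  it acts trivially. The set \<open>S\<close> is arbitrary in order to cover all permutations as
  well as those that fix the first index.\<close>

lemma contract_average:
  fixes \<tau> W :: "'d::finite tensor"
  assumes S: "finite S" "S \<noteq> {}" "\<And>p. p \<in> S \<Longrightarrow> p permutes {..<n}"
    and W: "\<And>p ix. p \<in> S \<Longrightarrow> length ix = n \<Longrightarrow> W (permute_list p ix) = W ix"
  shows "(\<Sum>ix | length ix = n. (\<Sum>p\<in>S. \<tau> (permute_list p ix)) / of_nat (card S) * W ix) = contract n \<tau> W"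
proof -
  have *: "(\<Sum>ix | length ix = n. \<tau> (permute_list p ix) * W ix) = contract n \<tau> W" if p: "p \<in> S" for p
  proof -
    note pp = S(3)[OF p]
    have "(\<Sum>ix | length ix = n. \<tau> (permute_list p ix) * W ix)
        = (\<Sum>ix | length ix = n. \<tau> (permute_list p ix) * W (permute_list p ix))"
      using W[OF p] by simp
    also have "\<dots> = (\<Sum>ix | length ix = n. \<tau> ix * W ix)"
    proof (rule sum.reindex_bij_witness[of _ "permute_list (inv p)" "permute_list p"])
      fix ix :: "'d list" assume ix: "ix \<in> {ix. length ix = n}"
      have "permute_list (inv p) (permute_list p ix) = permute_list (p \<circ> inv p) ix"
        by (rule permute_list_compose[symmetric]) (use ix pp permutes_inv in auto)
      then show "permute_list (inv p) (permute_list p ix) = ix"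
        using permutes_inv_o(1)[OF pp] by simp
      have "permute_list p (permute_list (inv p) ix) = permute_list (inv p \<circ> p) ix"
        by (rule permute_list_compose[symmetric]) (use ix pp permutes_inv in auto)
      then show "permute_list p (permute_list (inv p) ix) = ix"
        using permutes_inv_o(2)[OF pp] by simp
    qed auto
    finally show ?thesis by (simp add: contract_def)
  qed
  have "(\<Sum>ix | length ix = n. (\<Sum>p\<in>S. \<tau> (permute_list p ix)) / of_nat (card S) * W ix)
      = (\<Sum>p\<in>S. \<Sum>ix | length ix = n. \<tau> (permute_list p ix) * W ix) / of_nat (card S)"
    by (subst sum.swap) (simp add: sum_distrib_right sum_divide_distrib)
  also have "\<dots> = contract n \<tau> W"
    using * S(1,2) by simp
  finally show ?thesis .
qed

text \<open>A product over positions makes the symmetry of a power under permutations of its indices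
  visible.\<close>

lemma tpow_eq_prod: "length ix = n \<Longrightarrow> tpow u n ix = (\<Prod>i<n. u $ (ix ! i))"
proof (induction n arbitrary: ix)
  case (Suc n)
  then obtain a jx where "ix = a # jx" "length jx = n" by (auto simp: length_Suc_conv)
  then show ?case
    using Suc.IH[of jx] by (simp add: tprod_def tvec_def prod.lessThan_Suc_shift del: prod.lessThan_Suc)
qed simp

lemma contract_tsym: "contract n (tsym \<tau>) (tpow u n) = contract n \<tau> (tpow u n)"
proof -
  let ?S = "{p. p permutes {..<n}}"
  have "contract n (tsym \<tau>) (tpow u n)
      = (\<Sum>ix | length ix = n. (\<Sum>p\<in>?S. \<tau> (permute_list p ix)) / of_nat (card ?S) * tpow u n ix)"
    by (simp add: contract_def tsym_def card_permutations)
  also have "\<dots> = contract n \<tau> (tpow u n)"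
  proof (rule contract_average)
    fix p ix assume p: "p \<in> ?S" and ix: "length (ix :: 'a list) = n"
    have "(\<Prod>i<n. u $ (permute_list p ix ! i)) = (\<Prod>i<n. u $ (ix ! p i))"
      using p ix by (intro prod.cong) (auto simp: permute_list_nth)
    also have "\<dots> = (\<Prod>i<n. u $ (ix ! i))"
      using prod.permute[of p "{..<n}" "\<lambda>i. u $ (ix ! i)"] p by (simp add: o_def)
    finally show "tpow u n (permute_list p ix) = tpow u n ix"
      using ix by (simp add: tpow_eq_prod)
  qed (auto simp: finite_permutations intro: permutes_id)
  finally show ?thesis .
qed

text \<open>The permutations in \<open>tsym'\<close> fix position 0, where \<open>w\<close> sits,
  and permute only slots filled with \<open>u\<close>.\<close>

lemma contract_tsym':
  "contract (Suc n) (tsym' \<tau>) (tvec w \<otimes>\<^bsub>1\<^esub> tpow u n) = contract (Suc n) \<tau> (tvec w \<otimes>\<^bsub>1\<^esub> tpow u n)"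
proof -
  let ?S = "{p. p permutes {1..<Suc n}}"
  let ?W = "tvec w \<otimes>\<^bsub>1\<^esub> tpow u n"
  have W: "?W ix = w $ (ix ! 0) * (\<Prod>i\<in>{1..<Suc n}. u $ (ix ! i))" if ix: "length ix = Suc n" for ix
  proof -
    obtain a jx where jx: "ix = a # jx" "length jx = n" using ix by (auto simp: length_Suc_conv)
    have "(\<Prod>i\<in>{1..<Suc n}. u $ (ix ! i)) = (\<Prod>i<n. u $ (ix ! Suc i))"
      using prod.atLeast_Suc_lessThan_Suc_shift[of "\<lambda>i. u $ (ix ! i)" 0 n] by (simp add: lessThan_atLeast0 o_def)
    then show ?thesis by (simp add: jx tprod_def tvec_def tpow_eq_prod)
  qed
  have sub: "p permutes {..<Suc n}" if "p \<in> ?S" for p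
    using that by (auto intro: permutes_subset)
  have "contract (Suc n) (tsym' \<tau>) ?W
      = (\<Sum>ix | length ix = Suc n. (\<Sum>p\<in>?S. \<tau> (permute_list p ix)) / of_nat (card ?S) * ?W ix)"
    by (simp add: contract_def tsym'_def card_permutations)
  also have "\<dots> = contract (Suc n) \<tau> ?W"
  proof (rule contract_average)
    fix p ix assume p: "p \<in> ?S" and ix: "length (ix :: 'a list) = Suc n"
    have nth: "permute_list p ix ! i = ix ! p i" if "i < Suc n" for i
      using sub[OF p] ix that by (simp add: permute_list_nth)
    have p0: "p 0 = 0" using p by (simp add: permutes_def)
    have "(\<Prod>i\<in>{1..<Suc n}. u $ (permute_list p ix ! i)) = (\<Prod>i\<in>{1..<Suc n}. u $ (ix ! p i))"
      by (intro prod.cong) (auto simp: nth)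
    also have "\<dots> = (\<Prod>i\<in>{1..<Suc n}. u $ (ix ! i))"
      using prod.permute[of p "{1..<Suc n}" "\<lambda>i. u $ (ix ! i)"] p by (simp add: o_def)
    finally have e: "(\<Prod>i\<in>{1..<Suc n}. u $ (permute_list p ix ! i)) = (\<Prod>i\<in>{1..<Suc n}. u $ (ix ! i))" .
    have l: "length (permute_list p ix) = Suc n" using ix by simp
    show "?W (permute_list p ix) = ?W ix"
      unfolding W[OF ix] W[OF l] e nth[OF zero_less_Suc] p0 ..
  qed (use sub in \<open>auto simp: finite_permutations intro: permutes_id\<close>)
  finally show ?thesis .
qed

lemma sum_axis_nth: "(\<Sum>a\<in>UNIV. axis j 1 $ a * f a) = (f j :: complex)"
  by (simp add: axis_def if_distrib[of "\<lambda>u. u * _"] cong: if_cong)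

text \<open>In a flux the first index is the free divergence index. Placing \<open>axis a 1\<close>
  there turns the preceding rule into a statement about slices.\<close>

lemma contract_tsym'_slice:
  "contract n (\<lambda>ix. tsym' \<tau> (a # ix)) (tpow u n) = contract n (\<lambda>ix. \<tau> (a # ix)) (tpow u n)"
  using contract_tsym'[of n \<tau> "axis a 1" u] unfolding contract_Suc sum_axis_nth .

text \<open>The identity ties the divergence index to the first contracted slot. This produces the
  zeroth-order part of the contracted fluxes, a scalar times \<kappa>.\<close>

lemma contract_tI_slice:
  "contract (Suc n) (\<lambda>ix. (tI \<otimes>\<^bsub>2\<^esub> \<sigma>) (a # ix)) (tpow u (Suc n)) = u $ a * contract n \<sigma> (tpow u n)"
proof -
  have "contract n (\<lambda>ix. (tI \<otimes>\<^bsub>2\<^esub> \<sigma>) (a # b # ix)) (tpow u n)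
      = (if b = a then contract n \<sigma> (tpow u n) else 0)" for b
    by (auto simp: tprod_def tI_def numeral_2_eq_2 contract_def)
  then show ?thesis
    unfolding contract_tpow_Suc by (simp add: if_distrib[of "\<lambda>z. _ * z"] cong: if_cong)
qed

text \<open>On an index list \<open>a # b # c # ix\<close> the transposed flux evaluates the product
  at \<open>a # c # b # ix\<close>. So \<open>tI\<close> ties the divergence index \<open>a\<close>
  to the slot \<open>c\<close>, which carries \<open>u\<close>, while the dipole slot
  \<open>b\<close> becomes the first index of \<sigma>.\<close>

lemma contract_flux_transp_slice:
  "contract (Suc (Suc n)) (\<lambda>ix. flux_transp (\<lambda>jx. g * (tI \<otimes>\<^bsub>2\<^esub> \<sigma>) jx) (a # ix)) (tvec w \<otimes>\<^bsub>1\<^esub> tpow u (Suc n))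
    = g * (u $ a * contract (Suc n) \<sigma> (tvec w \<otimes>\<^bsub>1\<^esub> tpow u n))"
proof -
  have "contract n (\<lambda>ix. flux_transp (\<lambda>jx. g * (tI \<otimes>\<^bsub>2\<^esub> \<sigma>) jx) (a # b # c # ix)) (tpow u n)
      = (if c = a then g * contract n (\<lambda>ix. \<sigma> (b # ix)) (tpow u n) else 0)" for b c
    by (auto simp: flux_transp_def tprod_def tI_def numeral_2_eq_2 contract_def sum_distrib_left mult.assoc)
  then show ?thesis
    unfolding contract_Suc contract_tpow_Suc
    by (simp add: if_distrib[of "\<lambda>z. _ * z"] sum_distrib_left mult_ac cong: if_cong)
qed

text \<open>The transposition moves the derivative index behind the dipole index, so the derivative
  is contracted with \<open>u\<close> and the dipole direction with the first index of the
  field.\<close>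

lemma contract_ttransp:
  "contract (Suc (Suc n)) (ttransp \<sigma>) (tvec w \<otimes>\<^bsub>1\<^esub> tpow u (Suc n))
    = (\<Sum>a\<in>UNIV. u $ a * contract (Suc n) (\<lambda>ix. \<sigma> (a # ix)) (tvec w \<otimes>\<^bsub>1\<^esub> tpow u n))"
  unfolding contract_Suc contract_tpow_Suc
  by (subst (2) sum_distrib_left, subst sum.swap) (simp add: sum_distrib_left mult_ac)

lemma contract_tI: "contract 2 tI (tvec w \<otimes>\<^bsub>1\<^esub> tpow u 1) = (\<Sum>a\<in>UNIV. w $ a * u $ a)"
  using contract_Suc[of 1 tI w "tpow u 1"] contract_tpow_Suc[of 0 _ u]
  by (simp add: numeral_2_eq_2 contract_def tI_def if_distrib[of "\<lambda>z. _ * z"] cong: if_cong)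

lemma contract_tprod:
  assumes "\<And>ix. length ix = n + m \<Longrightarrow> W ix = W\<^sub>1 (take n ix) * W\<^sub>2 (drop n ix)"
  shows "contract (n + m) (\<sigma> \<otimes>\<^bsub>n\<^esub> \<tau>) W = contract n \<sigma> W\<^sub>1 * contract m \<tau> W\<^sub>2"
proof -
  have "contract (n + m) (\<sigma> \<otimes>\<^bsub>n\<^esub> \<tau>) W
      = (\<Sum>ix | length ix = n + m. (\<sigma> (take n ix) * W\<^sub>1 (take n ix)) * (\<tau> (drop n ix) * W\<^sub>2 (drop n ix)))"
    by (simp add: contract_def tprod_def assms mult_ac)
  also have "\<dots> = (\<Sum>(ix, jx)\<in>{ix. length ix = n} \<times> {jx. length jx = m}. (\<sigma> ix * W\<^sub>1 ix) * (\<tau> jx * W\<^sub>2 jx))"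
    by (rule sum.reindex_bij_witness[of _ "\<lambda>(ix, jx). ix @ jx" "\<lambda>ix. (take n ix, drop n ix)"]) auto
  also have "\<dots> = contract n \<sigma> W\<^sub>1 * contract m \<tau> W\<^sub>2"
    unfolding contract_def sum_product sum.cartesian_product ..
  finally show ?thesis .
qed

lemma tpow_add: "length ix = n + m \<Longrightarrow> tpow u (n + m) ix = tpow u n (take n ix) * tpow u m (drop n ix)"
proof (induction n arbitrary: ix)
  case (Suc n)
  then obtain a jx where "ix = a # jx" "length jx = n + m" by (auto simp: length_Suc_conv)
  then show ?case using Suc.IH[of jx] by (simp add: tprod_def mult.assoc)
qed simp

lemma contract_tprod_tpow:
  "contract (n + m) (\<sigma> \<otimes>\<^bsub>n\<^esub> \<tau>) (tpow u (n + m)) = contract n \<sigma> (tpow u n) * contract m \<tau> (tpow u m)"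
  by (rule contract_tprod) (rule tpow_add)

lemma contract_tprod_dipole:
  "contract (Suc n + m) (\<sigma> \<otimes>\<^bsub>Suc n\<^esub> \<tau>) (tvec w \<otimes>\<^bsub>1\<^esub> tpow u (n + m))
    = contract (Suc n) \<sigma> (tvec w \<otimes>\<^bsub>1\<^esub> tpow u n) * contract m \<tau> (tpow u m)"
proof (rule contract_tprod)
  fix ix :: "'a list" assume "length ix = Suc n + m"
  then obtain a jx where "ix = a # jx" "length jx = n + m" by (auto simp: length_Suc_conv)
  then show "(tvec w \<otimes>\<^bsub>1\<^esub> tpow u (n + m)) ix
      = (tvec w \<otimes>\<^bsub>1\<^esub> tpow u n) (take (Suc n) ix) * tpow u m (drop (Suc n) ix)"
    by (simp add: tprod_def tvec_def tpow_add mult.assoc)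
qed

text \<open>The permutations of two positions are the identity and the swap. This serves contraction
  with \<open>e \<otimes> \<kappa>\<close>, which is not symmetric and therefore does not absorb the
  symmetrisation.\<close>

lemma tsym_2:
  assumes "\<tau> [a, b] = \<tau> [b, a]"
  shows "tsym \<tau> [a, b] = \<tau> [a, b]"
proof -
  have "\<tau> (permute_list p [a, b]) = \<tau> [a, b]" if p: "p permutes {..<2}" for p
  proof -
    have "{p 0, p 1} \<subseteq> {..<2}" "p 0 \<noteq> p 1"
      using permutes_in_image[OF p] permutes_inj[OF p] by (auto simp: inj_eq)
    then have "(p 0 = 0 \<and> p 1 = 1) \<or> (p 0 = 1 \<and> p 1 = 0)" by auto
    then show ?thesis using assms by (auto simp: permute_list_def upt_rec)
  qed
  then have "(\<Sum>p | p permutes {..<2::nat}. \<tau> (permute_list p [a, b])) = of_nat (card {p. p permutes {..<2::nat}}) * \<tau> [a, b]"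
    by simp
  also have "card {p. p permutes {..<2::nat}} = fact 2" by (simp add: card_permutations)
  finally show ?thesis by (simp add: tsym_def numeral_2_eq_2)
qed

subsection \<open>Contracted cell problems\<close>

lemma H1p_sum:
  assumes "finite A" "\<And>i. i \<in> A \<Longrightarrow> H1p l (f i) (Df i)"
  shows "H1p l (\<lambda>x. \<Sum>i\<in>A. c i * f i x) (\<lambda>x. \<Sum>i\<in>A. c i *s Df i x)"
  using assms
proof (induction A rule: finite_induct)
  case empty
  show ?case using H1p_cmult[OF H1p_const, of l 0] by simp
next
  case (insert i A)
  then show ?case using H1p_add[OF H1p_cmult[of l "f i" "Df i" "c i"]] by simp
qed

lemma L2_on_tsym:
  assumes "\<And>jx. length jx = length ix \<Longrightarrow> L2_on Y (\<lambda>x. \<tau> x jx)"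
  shows "L2_on Y (\<lambda>x. tsym (\<tau> x) ix)" "L2_on Y (\<lambda>x. tsym' (\<tau> x) ix)"
  unfolding tsym_def tsym'_def divide_inverse mult.commute[of _ "inverse _"]
  by (intro L2_on_cmult L2_on_sum assms; simp)+

lemma L2_on_flux_transp:
  assumes "\<And>jx. length jx = length ix \<Longrightarrow> L2_on Y (\<lambda>x. \<tau> x jx)" and "length ix \<ge> 3"
  shows "L2_on Y (\<lambda>x. flux_transp (\<tau> x) ix)"
proof -
  obtain a b c jx where "ix = a # b # c # jx"
    using assms(2) by (metis Suc_le_length_iff numeral_3_eq_3)
  then show ?thesis using assms(1)[of "a # c # b # jx"] by (simp add: flux_transp_def)
qed

lemma L2_on_ttransp:
  assumes "\<And>jx. length jx = length ix \<Longrightarrow> L2_on Y (\<lambda>x. \<tau> x jx)"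
  shows "L2_on Y (\<lambda>x. ttransp (\<tau> x) ix)"
proof (cases "\<exists>b c jx. ix = b # c # jx")
  case True
  then obtain b c jx where "ix = b # c # jx" by blast
  then show ?thesis using assms[of "c # b # jx"] by simp
next
  case False
  then have "ttransp \<tau>' ix = \<tau>' ix" for \<tau>' :: "'a tensor"
    by (cases "(\<tau>', ix)" rule: ttransp.cases) auto
  then show ?thesis using assms by simp
qed

lemma bdot_grad_tpow:
  "contract (Suc n) \<sigma> (tpow u (Suc n)) = bdot (\<chi> a. contract n (\<lambda>ix. \<sigma> (a # ix)) (tpow u n)) u"
  unfolding contract_tpow_Suc by (simp add: bdot_def mult.commute)

lemma bdot_grad_dipole:
  "contract (Suc (Suc n)) (ttransp \<sigma>) (tvec w \<otimes>\<^bsub>1\<^esub> tpow u (Suc n))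
    = bdot (\<chi> a. contract (Suc n) (\<lambda>ix. \<sigma> (a # ix)) (tvec w \<otimes>\<^bsub>1\<^esub> tpow u n)) u"
  unfolding contract_ttransp by (simp add: bdot_def mult.commute)

lemma contract_tI_slice_1: "contract 1 (\<lambda>ix. tI (a # ix)) (tvec w \<otimes>\<^bsub>1\<^esub> tpow u 0) = w $ a"
  unfolding contract_1
  using sum_lists_Suc[of "\<lambda>ix. tI (a # ix) * tvec w ix" 0]
  by (simp add: contract_def tI_def tvec_def if_distrib[of "\<lambda>z. z * _"] cong: if_cong)

lemma contract_tI_bdot: "contract 2 tI (tvec w \<otimes>\<^bsub>1\<^esub> tpow u 1) = bdot w u"
  by (simp only: contract_tI bdot_def)

lemma tpow_1: "tpow u 1 = tvec u \<otimes>\<^bsub>1\<^esub> tpow u 0"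
  unfolding One_nat_def tpow.simps ..

lemma tpow_2: "tpow u 2 = tvec u \<otimes>\<^bsub>1\<^esub> tpow u 1"
  unfolding numeral_2_eq_2 One_nat_def tpow.simps ..

text \<open>The contraction rules come with orders such as \<open>Suc 2\<close> or
  \<open>2 + 1\<close>; these equations restore the numerals in which the coefficients are
  written.\<close>

lemma Suc_numerals: "Suc 0 = 1" "Suc 1 = 2" "Suc 2 = 3" "Suc 3 = 4"
  by simp_all

lemma add_numerals: "1 + 2 = (3::nat)" "2 + 2 = (4::nat)" "2 + 1 = (3::nat)" "1 + 1 = (2::nat)" "0 + n = (n :: nat)"
  "n + 0 = n"
  by simp_all

lemma tensor_contract_H1p:
  assumes "tensor_H1p0 l n g Dg"
  shows "H1p l (\<lambda>x. contract n (g x) W) (\<lambda>x. \<chi> a. contract n (\<lambda>ix. Dg x (a # ix)) W)"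
proof -
  have "H1p l (\<lambda>x. \<Sum>ix | length ix = n. W ix * g x ix) (\<lambda>x. \<Sum>ix | length ix = n. W ix *s (\<chi> a. Dg x (a # ix)))"
    using assms by (intro H1p_sum finite_lists_of_length) (auto simp: tensor_H1p0_def)
  moreover have "(\<Sum>ix | length ix = n. W ix *s (\<chi> a. Dg x (a # ix))) = (\<chi> a. contract n (\<lambda>ix. Dg x (a # ix)) W)" for x
    by (simp add: vec_eq_iff contract_def mult.commute)
  ultimately show ?thesis by (simp add: contract_def mult.commute)
qed

lemma tensor_L2_on:
  assumes "tensor_H1p0 l n g Dg"
  shows "length ix = n \<Longrightarrow> L2_on (box 0 l) (\<lambda>x. g x ix)"
    and "length ix = Suc n \<Longrightarrow> L2_on (box 0 l) (\<lambda>x. Dg x ix)"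
proof -
  have H: "H1p l (\<lambda>x. g x ix) (\<lambda>x. \<chi> a. Dg x (a # ix))" if "length ix = n" for ix
    using assms that by (auto simp: tensor_H1p0_def)
  show "length ix = n \<Longrightarrow> L2_on (box 0 l) (\<lambda>x. g x ix)"
    using H1p_L2_on(1)[OF H] .
  assume "length ix = Suc n"
  then obtain a jx where "ix = a # jx" "length jx = n" by (auto simp: length_Suc_conv)
  then show "L2_on (box 0 l) (\<lambda>x. Dg x ix)"
    using L2_on_nth[OF H1p_L2_on(2)[OF H[of jx]], of a] by simp
qed

context unit_cell
begin

lemma tensor_contract_mean:
  assumes "tensor_H1p0 l n g Dg"
  shows "cell_mean l (\<lambda>x. contract n (g x) W) = 0"
proof -
  have "integral\<^sup>L M (\<lambda>x. contract n (g x) W) = (\<Sum>ix | length ix = n. (LINT x|M. g x ix * W ix))"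
    unfolding contract_def
    by (intro Bochner_Integration.integral_sum integrable_mult_left)
      (use tensor_L2_on(1)[OF assms] in \<open>auto intro: L2_on_integrable\<close>)
  also have "\<dots> = 0"
    using assms by (intro sum.neutral) (auto simp: tensor_H1p0_def cell_mean_eq)
  finally show ?thesis by (simp add: cell_mean_eq)
qed

lemma contract_tmean:
  assumes "\<And>ix. length ix = n \<Longrightarrow> integrable M (\<lambda>x. \<tau> x ix)"
  shows "contract n (tmean l \<tau>) W = cell_mean l (\<lambda>x. contract n (\<tau> x) W)"
  using assms unfolding contract_def tmean_def cell_mean_eq by simp

end

context elliptic_cell
begin

text \<open>A tensor problem is a family of scalar weak problems, so weighting the member
  \<open>ix\<close> by \<open>W ix\<close> and summing gives one scalar problem. Its source splits
  into a flux \<open>Q\<close> in the direction \<kappa>, a density part \<open>g\<close> and a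
  constant \<open>d\<close>; a nonzero \<open>d\<close> arises for the third-order non-symmetric
  cell function.\<close>

lemma contracted_cell_equation:
  fixes P Q :: "real^'d \<Rightarrow> complex^'d" and g :: "real^'d \<Rightarrow> complex"
  assumes eq: "tensor_eq l n F f"
    and F: "\<And>ix. length ix = Suc n \<Longrightarrow> L2v (\<lambda>x. F x ix)" and f: "\<And>ix. length ix = n \<Longrightarrow> L2v (\<lambda>x. f x ix)"
    and L2: "L2v Q" "L2v g"
    and P: "\<And>x a. contract n (\<lambda>ix. F x (a # ix)) W = of_real (G x) * P x $ a"
    and Q: "\<And>x. contract n (f x) W = of_real (G x) * bdot (Q x) \<kappa> - of_real (\<rho> x) * g x - d"
    and \<phi>: "H1p l \<phi> D\<phi>"
  shows "energy P D\<phi> = energy Q (\<lambda>x. \<phi> x *s \<kappa>) - mass g \<phi> - d * cell_mean l \<phi>"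
proof -
  note L = H1p_L2_on[OF \<phi>]
  have i1: "integrable M (\<lambda>x. bdot (\<chi> a. F x (a # ix)) (D\<phi> x))" if "length ix = n" for ix
    using that F by (intro integrable_L2_bdot L2_on_vec L) auto
  have i2: "integrable M (\<lambda>x. f x ix * \<phi> x)" if "length ix = n" for ix
    using that f by (intro integrable_L2_mult L) auto
  have "energy P D\<phi> = (LINT x|M. (\<Sum>ix | length ix = n. W ix * bdot (\<chi> a. F x (a # ix)) (D\<phi> x)))"
    unfolding energy_def
  proof (intro Bochner_Integration.integral_cong refl)
    fix x
    have "of_real (G x) * bdot (P x) (D\<phi> x) = (\<Sum>a\<in>UNIV. contract n (\<lambda>ix. F x (a # ix)) W * D\<phi> x $ a)"
      unfolding P by (simp add: bdot_def sum_distrib_left mult.assoc)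
    also have "\<dots> = (\<Sum>ix | length ix = n. W ix * bdot (\<chi> a. F x (a # ix)) (D\<phi> x))"
      unfolding contract_def bdot_def sum_distrib_right sum_distrib_left
      by (subst sum.swap) (simp add: mult_ac)
    finally show "of_real (G x) * bdot (P x) (D\<phi> x) = (\<Sum>ix | length ix = n. W ix * bdot (\<chi> a. F x (a # ix)) (D\<phi> x))" .
  qed
  also have "\<dots> = (\<Sum>ix | length ix = n. W ix * (LINT x|M. bdot (\<chi> a. F x (a # ix)) (D\<phi> x)))"
    using i1 by simp
  also have "\<dots> = (\<Sum>ix | length ix = n. W ix * (LINT x|M. f x ix * \<phi> x))"
    using eq \<phi> by (intro sum.cong) (auto simp: tensor_eq_def weak_eq_def)
  also have "\<dots> = (LINT x|M. (\<Sum>ix | length ix = n. W ix * (f x ix * \<phi> x)))"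
    using i2 by simp
  also have "\<dots> = (LINT x|M. of_real (G x) * bdot (Q x) (\<phi> x *s \<kappa>) - of_real (\<rho> x) * g x * \<phi> x - d * \<phi> x)"
  proof (intro Bochner_Integration.integral_cong refl)
    fix x
    have "(\<Sum>ix | length ix = n. W ix * (f x ix * \<phi> x)) = contract n (f x) W * \<phi> x"
      by (simp add: contract_def sum_distrib_left mult_ac)
    then show "(\<Sum>ix | length ix = n. W ix * (f x ix * \<phi> x))
        = of_real (G x) * bdot (Q x) (\<phi> x *s \<kappa>) - of_real (\<rho> x) * g x * \<phi> x - d * \<phi> x"
      unfolding Q by (simp add: bdot_scale_right algebra_simps)
  qed
  also have "\<dots> = energy Q (\<lambda>x. \<phi> x *s \<kappa>) - mass g \<phi> - d * cell_mean l \<phi>"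
    using energy_integrable[OF L2(1) L2_on_scale_vec[OF L(1), of \<kappa>]] mass_integrable[OF L2(2) L(1)]
      L2_on_integrable[OF L(1)]
    by (simp add: energy_def mass_def cell_mean_eq)
  finally show ?thesis .
qed

lemma mass_cmult: "mass (\<lambda>x. c * f x) g = c * mass f g"
  by (simp add: mass_def mult.left_commute[of _ c] mult.assoc)

lemma mass_const: "mass (\<lambda>x. c) g = c * mass (\<lambda>x. 1) g"
  using mass_cmult[of c "\<lambda>x. 1" g] by simp

end

text \<open>Since \<open>m 0 = 0\<close>, the product starts at order 1, and its coefficients at
  orders 1 to 3 are the three given equations. The impedance is of order 2, which lifts the
  remainder from order 2 to order 4; the cross terms \<open>b * m 2\<close> and
  \<open>b * m 3\<close> have orders 4 and 5.\<close>

lemma bigo_effective_equation: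
  fixes V :: "real \<Rightarrow> complex" and m :: "int \<Rightarrow> complex"
  assumes V: "(\<lambda>\<epsilon>. V \<epsilon> - (\<Sum>n=0..3. of_real \<epsilon> powi (n - 2) * m n)) \<in> O[at_right 0](\<lambda>\<epsilon>. of_real \<epsilon> ^ 2)"
    and m: "m 0 = 0" "a * m 1 = n\<^sub>1" "a * m 2 = n\<^sub>2" "a * m 3 + b * m 1 = n\<^sub>3"
  shows "(\<lambda>\<epsilon>. (of_real \<epsilon> ^ 2 * a + of_real \<epsilon> ^ 4 * b) * V \<epsilon>
      - (of_real \<epsilon> * n\<^sub>1 + of_real \<epsilon> ^ 2 * n\<^sub>2 + of_real \<epsilon> ^ 3 * n\<^sub>3)) \<in> O[at_right 0](\<lambda>\<epsilon>. of_real \<epsilon> ^ 4 :: complex)"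
proof -
  let ?e = "\<lambda>\<epsilon>::real. of_real \<epsilon> :: complex"
  let ?R = "\<lambda>\<epsilon>. V \<epsilon> - (\<Sum>n=0..3. ?e \<epsilon> powi (n - 2) * m n)"
  have small: "\<forall>\<^sub>F \<epsilon>::real in at_right 0. 0 < \<epsilon> \<and> \<epsilon> < 1"
    using eventually_at_right_real[of 0 1] by (auto elim: eventually_mono)
  have pow: "(\<lambda>\<epsilon>. ?e \<epsilon> ^ n * c) \<in> O[at_right 0](\<lambda>\<epsilon>. ?e \<epsilon> ^ k)" if "k \<le> n" for n k c
  proof (rule bigoI)
    show "\<forall>\<^sub>F \<epsilon> in at_right 0. norm (?e \<epsilon> ^ n * c) \<le> norm c * norm (?e \<epsilon> ^ k)"
      using small
    proof eventually_elim
      case (elim \<epsilon>)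
      then have "\<epsilon> ^ n \<le> \<epsilon> ^ k" using that by (intro power_decreasing) auto
      then show ?case using elim by (simp add: norm_mult norm_power mult.commute mult_left_mono)
    qed
  qed
  have Z: "(\<lambda>\<epsilon>. ?e \<epsilon> ^ 2 * a + ?e \<epsilon> ^ 4 * b) \<in> O[at_right 0](\<lambda>\<epsilon>. ?e \<epsilon> ^ 2)"
    by (intro sum_in_bigo pow) auto
  have "(\<lambda>\<epsilon>. (?e \<epsilon> ^ 2 * a + ?e \<epsilon> ^ 4 * b) * ?R \<epsilon>) \<in> O[at_right 0](\<lambda>\<epsilon>. ?e \<epsilon> ^ 2 * ?e \<epsilon> ^ 2)"
    by (rule landau_o.big.mult[OF Z V])
  then have "(\<lambda>\<epsilon>. (?e \<epsilon> ^ 2 * a + ?e \<epsilon> ^ 4 * b) * ?R \<epsilon>) \<in> O[at_right 0](\<lambda>\<epsilon>. ?e \<epsilon> ^ 4)"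
    by (simp flip: power_add)
  moreover have "(\<lambda>\<epsilon>. ?e \<epsilon> ^ 4 * (b * m 2) + ?e \<epsilon> ^ 5 * (b * m 3)) \<in> O[at_right 0](\<lambda>\<epsilon>. ?e \<epsilon> ^ 4)"
    by (intro sum_in_bigo pow) auto
  ultimately have "(\<lambda>\<epsilon>. (?e \<epsilon> ^ 2 * a + ?e \<epsilon> ^ 4 * b) * ?R \<epsilon> + (?e \<epsilon> ^ 4 * (b * m 2) + ?e \<epsilon> ^ 5 * (b * m 3)))
      \<in> O[at_right 0](\<lambda>\<epsilon>. ?e \<epsilon> ^ 4)"
    by (rule sum_in_bigo)
  also have "?this \<longleftrightarrow> ?thesis"
  proof (rule landau_o.big.in_cong)
    show "\<forall>\<^sub>F \<epsilon> in at_right 0. (?e \<epsilon> ^ 2 * a + ?e \<epsilon> ^ 4 * b) * ?R \<epsilon> + (?e \<epsilon> ^ 4 * (b * m 2) + ?e \<epsilon> ^ 5 * (b * m 3))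
        = (?e \<epsilon> ^ 2 * a + ?e \<epsilon> ^ 4 * b) * V \<epsilon> - (?e \<epsilon> * n\<^sub>1 + ?e \<epsilon> ^ 2 * n\<^sub>2 + ?e \<epsilon> ^ 3 * n\<^sub>3)"
      using small
    proof eventually_elim
      case (elim \<epsilon>)
      have set: "{0..3::int} = {0, 1, 2, 3}" by auto
      have S: "(\<Sum>n=0..3. ?e \<epsilon> powi (n - 2) * m n) = m 1 / ?e \<epsilon> + m 2 + ?e \<epsilon> * m 3"
        unfolding set using m(1) by (simp add: power_int_minus field_simps)
      have "(?e \<epsilon> ^ 2 * a + ?e \<epsilon> ^ 4 * b) * (m 1 / ?e \<epsilon> + m 2 + ?e \<epsilon> * m 3)
          = (?e \<epsilon> * (a * m 1) + ?e \<epsilon> ^ 2 * (a * m 2) + ?e \<epsilon> ^ 3 * (a * m 3 + b * m 1))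
            + (?e \<epsilon> ^ 4 * (b * m 2) + ?e \<epsilon> ^ 5 * (b * m 3))"
        using elim by (simp add: field_simps eval_nat_numeral)
      then show ?case unfolding S m(2-4) by (simp add: right_diff_distrib)
    qed
  qed
  finally show ?thesis .
qed

lemma L2_on_tprod:
  fixes \<sigma> :: "'d tensor"
  shows "L2_on Y (\<lambda>x. \<tau> x (drop n ix)) \<Longrightarrow> L2_on Y (\<lambda>x. (\<sigma> \<otimes>\<^bsub>n\<^esub> \<tau> x) ix)"
    and "L2_on Y (\<lambda>x. \<tau> x (take n ix)) \<Longrightarrow> L2_on Y (\<lambda>x. (\<tau> x \<otimes>\<^bsub>n\<^esub> \<sigma>) ix)"
  unfolding tprod_def mult.commute[of _ "\<sigma> _"] by (rule L2_on_cmult, assumption)+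

lemma L2_on_divide: "L2_on Y f \<Longrightarrow> L2_on Y (\<lambda>x. f x / c :: complex)"
  using L2_on_cmult[of Y f "1 / c"] by simp

context elliptic_cell
begin

lemma weak_eq_energy:
  assumes eq: "weak_eq l (\<lambda>x. of_real (G x) *s P x)
      (\<lambda>x. bdot \<kappa> (of_real (G x) *s Q x) + of_real (c * \<rho> x) * g x)"
    and L2: "L2v Q" "L2v g" and \<phi>: "H1p l \<phi> D\<phi>"
  shows "energy P D\<phi> = energy Q (\<lambda>x. \<phi> x *s \<kappa>) + of_real c * mass g \<phi>"
proof -
  note L = H1p_L2_on[OF \<phi>]
  have "energy P D\<phi> = (LINT x|M. bdot (of_real (G x) *s P x) (D\<phi> x))"
    by (simp add: energy_def bdot_scale_left)
  also have "\<dots> = (LINT x|M. (bdot \<kappa> (of_real (G x) *s Q x) + of_real (c * \<rho> x) * g x) * \<phi> x)"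
    using eq \<phi> unfolding weak_eq_def by blast
  also have "\<dots> = (LINT x|M. of_real (G x) * bdot (Q x) (\<phi> x *s \<kappa>) + of_real c * (of_real (\<rho> x) * g x * \<phi> x))"
    by (simp add: bdot_commute[of \<kappa>] bdot_scale_left bdot_scale_right algebra_simps)
  also have "\<dots> = energy Q (\<lambda>x. \<phi> x *s \<kappa>) + of_real c * mass g \<phi>"
    using energy_integrable[OF L2(1) L2_on_scale_vec[OF L(1), of \<kappa>]] mass_integrable[OF L2(2) L(1)]
    by (simp add: energy_def mass_def)
  finally show ?thesis .
qed

lemma L2_on_G: "L2v f \<Longrightarrow> L2v (\<lambda>x. of_real (G x) * f x :: complex)"
  by (rule coefficient_L2_on[OF coeff(1)])

lemma L2_on_density: "L2v f \<Longrightarrow> L2v (\<lambda>x. of_real (\<rho> x) * f x :: complex)"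
  by (rule coefficient_L2_on[OF coeff(2)])

lemma L2_on_density_const: "L2v (\<lambda>x. of_real (\<rho> x / r) * c :: complex)"
  using L2_on_density[OF L2_on_const, of "c / of_real r"] by simp

text \<open>A general \<open>w\<close> lets one equation serve the wave vector, the dipole direction
  and the coordinate axes.\<close>

lemma cell1_direction:
  assumes c: "cell1 l G \<chi>\<^sub>1 D\<chi>\<^sub>1" and \<phi>: "H1p l \<phi> D\<phi>"
  shows "energy (\<lambda>x. (\<chi> a. contract 1 (\<lambda>ix. D\<chi>\<^sub>1 x (a # ix)) (tvec w \<otimes>\<^bsub>1\<^esub> tpow u 0)) + w) D\<phi> = 0"
proof -
  from c have t: "tensor_H1p0 l 1 \<chi>\<^sub>1 D\<chi>\<^sub>1"
    and eq: "tensor_eq l 1 (\<lambda>x ix. of_real (G x) * (D\<chi>\<^sub>1 x ix + tI ix)) (\<lambda>x ix. 0)"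
    by (auto simp: cell1_def)
  have "energy (\<lambda>x. (\<chi> a. contract 1 (\<lambda>ix. D\<chi>\<^sub>1 x (a # ix)) (tvec w \<otimes>\<^bsub>1\<^esub> tpow u 0)) + w) D\<phi>
      = energy (\<lambda>x. 0) (\<lambda>x. \<phi> x *s 0) - mass (\<lambda>x. 0) \<phi> - 0 * cell_mean l \<phi>"
  proof (rule contracted_cell_equation[OF eq, where W = "tvec w \<otimes>\<^bsub>1\<^esub> tpow u 0"])
    show "L2v (\<lambda>x. of_real (G x) * (D\<chi>\<^sub>1 x ix + tI ix))" if "length ix = Suc 1" for ix
      by (intro L2_on_G L2_on_add tensor_L2_on(2)[OF t that] L2_on_const)
    show "contract 1 (\<lambda>ix. of_real (G x) * (D\<chi>\<^sub>1 x (a # ix) + tI (a # ix))) (tvec w \<otimes>\<^bsub>1\<^esub> tpow u 0)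
        = of_real (G x) * ((\<chi> a. contract 1 (\<lambda>ix. D\<chi>\<^sub>1 x (a # ix)) (tvec w \<otimes>\<^bsub>1\<^esub> tpow u 0)) + w) $ a" for x a
      unfolding contract_cmult contract_add contract_tI_slice_1 by simp
  qed (simp_all add: L2_on_const \<phi> contract_def)
  then show ?thesis by (simp add: mass_def)
qed

text \<open>The gradient of the corrector is annihilated by the cell problem and can be added to the
  second argument. The entry \<open>[a, b]\<close> thereby becomes the energy pairing of the
  corrected unit fields in the directions \<open>b\<close> and \<open>a\<close>, which is
  symmetric.\<close>

lemma stiffness_symmetric:
  assumes c: "cell1 l G \<chi>\<^sub>1 D\<chi>\<^sub>1"
  shows "tmean l (\<lambda>x ix. of_real (G x) * (D\<chi>\<^sub>1 x ix + tI ix)) [a, b]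
    = tmean l (\<lambda>x ix. of_real (G x) * (D\<chi>\<^sub>1 x ix + tI ix)) [b, a]"
proof -
  let ?\<tau> = "tmean l (\<lambda>x ix. of_real (G x) * (D\<chi>\<^sub>1 x ix + tI ix))"
  \<comment> \<open>The factor \<open>tpow 0 0\<close>, a power of order zero, is constantly 1; it
    gives the weight the shape used in \<open>cell1_direction\<close>.\<close>
  let ?W = "\<lambda>b. tvec (axis b 1 :: complex^'d) \<otimes>\<^bsub>1\<^esub> tpow 0 0"
  let ?g = "\<lambda>b x. contract 1 (\<chi>\<^sub>1 x) (?W b)"
  let ?D = "\<lambda>b x. \<chi> a. contract 1 (\<lambda>ix. D\<chi>\<^sub>1 x (a # ix)) (?W b)"
  from c have t: "tensor_H1p0 l 1 \<chi>\<^sub>1 D\<chi>\<^sub>1" by (auto simp: cell1_def)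
  note H = tensor_contract_H1p[OF t]
  have LD: "L2v (?D b)" for b using H1p_L2_on(2)[OF H] .
  have D: "?D b x $ a = D\<chi>\<^sub>1 x [a, b]" for a b x
    using contract_Suc[of 0 "\<lambda>ix. D\<chi>\<^sub>1 x (a # ix)" "axis b 1" "tpow 0 0"]
    by (simp add: sum_axis_nth) (simp add: contract_def)
  have \<tau>: "?\<tau> [a, b] = energy (\<lambda>x. ?D b x + axis b 1) (\<lambda>x. ?D a x + axis a 1)" for a b
  proof -
    have "energy (\<lambda>x. ?D b x + axis b 1) (\<lambda>x. ?D a x + axis a 1)
        = energy (\<lambda>x. ?D b x + axis b 1) (?D a) + energy (\<lambda>x. ?D b x + axis b 1) (\<lambda>x. axis a 1)"
      by (intro energy_add_right L2_on_add LD L2_on_const)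
    also have "energy (\<lambda>x. ?D b x + axis b 1) (?D a) = 0"
      by (rule cell1_direction[OF c H])
    also have "energy (\<lambda>x. ?D b x + axis b 1) (\<lambda>x. axis a 1) = ?\<tau> [a, b]"
    proof -
      have "bdot (?D b x + axis b 1) (axis a 1) = D\<chi>\<^sub>1 x [a, b] + tI [a, b]" for x
      proof -
        have "bdot (?D b x + axis b 1) (axis a 1) = (?D b x + axis b 1) $ a"
          unfolding bdot_commute[of _ "axis a 1"] unfolding bdot_def by (rule sum_axis_nth)
        also have "\<dots> = D\<chi>\<^sub>1 x [a, b] + axis b 1 $ a"
          unfolding vector_add_component D ..
        finally show ?thesis by (simp add: axis_def tI_def)
      qed
      then show ?thesis by (simp only: energy_def tmean_def cell_mean_eq)
    qed
    finally show ?thesis by simp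
  qed
  show ?thesis unfolding \<tau> by (rule energy_commute)
qed

end

theorem mainTheorem4:
  fixes l khat :: "real^'d" and \<omega>hat :: real and j :: 'd
    and G \<rho> :: "real^'d \<Rightarrow> real"
    and \<chi>\<^sub>1 D\<chi>\<^sub>1 \<chi>\<^sub>2 D\<chi>\<^sub>2 \<chi>\<^sub>3 D\<chi>\<^sub>3 \<chi>t\<^sub>2 D\<chi>t\<^sub>2 \<chi>t\<^sub>3 D\<chi>t\<^sub>3 :: "real^'d \<Rightarrow> 'd tensor"
    and \<rho>\<^sub>0 :: complex
    and \<mu>\<^sub>0 \<mu>\<^sub>2 \<rho>\<^sub>1 \<rho>\<^sub>2 \<mu>t\<^sub>1 \<mu>t\<^sub>2 \<rho>t\<^sub>2 e :: "'d tensor"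
    and v :: "real \<Rightarrow> real^'d \<Rightarrow> complex" and Dv :: "real \<Rightarrow> real^'d \<Rightarrow> complex^'d"
    and vh :: "int \<Rightarrow> real^'d \<Rightarrow> complex" and Dvh :: "int \<Rightarrow> real^'d \<Rightarrow> complex^'d"
    and Z N :: "complex \<Rightarrow> complex"
  assumes dim: "CARD('d) \<in> {1, 2, 3}"
    and cell: "\<forall>a. 0 < l $ a" "measure lebesgue (box 0 l) = 1"
    and coefficients: "coefficient l G" "coefficient l \<rho>"
    and cell_functions:
      "cell1 l G \<chi>\<^sub>1 D\<chi>\<^sub>1"
      "cell2 l G \<rho> \<mu>\<^sub>0 \<chi>\<^sub>1 D\<chi>\<^sub>1 \<chi>\<^sub>2 D\<chi>\<^sub>2"
      "cell3 l G \<rho> \<mu>\<^sub>0 \<chi>\<^sub>1 \<chi>\<^sub>2 D\<chi>\<^sub>2 \<chi>\<^sub>3 D\<chi>\<^sub>3"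
      "tilde_cell2 l G \<rho> \<mu>\<^sub>0 \<chi>\<^sub>1 D\<chi>\<^sub>1 \<chi>t\<^sub>2 D\<chi>t\<^sub>2"
      "tilde_cell3 l G \<rho> \<mu>\<^sub>0 \<rho>\<^sub>1 \<mu>t\<^sub>1 \<chi>\<^sub>1 \<chi>t\<^sub>2 D\<chi>t\<^sub>2 \<chi>t\<^sub>3 D\<chi>t\<^sub>3"
    and rho0: "\<rho>\<^sub>0 = of_real (cell_mean l \<rho>)"
    and mu0: "\<mu>\<^sub>0 = tsym (tmean l (\<lambda>x ix. of_real (G x) * (D\<chi>\<^sub>1 x ix + tI ix)))"
    and rho1: "\<rho>\<^sub>1 = tmean l (\<lambda>x ix. of_real (\<rho> x) * \<chi>\<^sub>1 x ix)"
    and rho2: "\<rho>\<^sub>2 = tmean l (\<lambda>x ix. of_real (\<rho> x) * \<chi>\<^sub>2 x ix)"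
    and mu2: "\<mu>\<^sub>2 = tsym (tmean l (\<lambda>x ix. of_real (G x) * (D\<chi>\<^sub>3 x ix + (tI \<otimes>\<^bsub>2\<^esub> \<chi>\<^sub>2 x) ix)))"
    and mut1: "\<mu>t\<^sub>1 = tsym' (tmean l (\<lambda>x ix.
                 of_real (G x) * (ttransp (D\<chi>t\<^sub>2 x) ix + (\<chi>\<^sub>1 x \<otimes>\<^bsub>1\<^esub> tI) ix)))"
    and mut2: "\<mu>t\<^sub>2 = tsym' (tmean l (\<lambda>x ix.
                 of_real (G x) * (ttransp (D\<chi>t\<^sub>3 x) ix + (\<chi>t\<^sub>2 x \<otimes>\<^bsub>2\<^esub> tI) ix)))"
    and rhot2: "\<rho>t\<^sub>2 = tmean l (\<lambda>x ix. of_real (\<rho> x) * \<chi>t\<^sub>2 x ix)"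
    and e: "e = tvec (axis j 1)"
    and nondegenerate: "contract 2 \<mu>\<^sub>0 (tpow (ivec khat) 2) + \<rho>\<^sub>0 * of_real (\<omega>hat\<^sup>2) \<noteq> 0"
    and response: "\<forall>\<^sub>F \<epsilon> in at_right 0.
      dipole_response l G \<rho> (\<epsilon> *\<^sub>R khat) (\<epsilon> * \<omega>hat) j (v \<epsilon>) (Dv \<epsilon>)"
    and hierarchy: "dipole_hierarchy l G \<rho> khat \<omega>hat j vh Dvh"
    and expansion: "(\<lambda>\<epsilon>. cell_mean l (v \<epsilon>)
        - (\<Sum>n=0..3. of_real \<epsilon> powi (n - 2) * cell_mean l (vh n)))
      \<in> O[at_right 0](\<lambda>\<epsilon>. of_real \<epsilon> ^ 2)"
    and Z: "\<And>\<epsilon>. Z \<epsilon> =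
        \<epsilon>^2 * (contract 2 \<mu>\<^sub>0 (tpow (ivec khat) 2) + \<rho>\<^sub>0 * of_real (\<omega>hat\<^sup>2))
      + \<epsilon>^4 * (contract 4 \<mu>\<^sub>2 (tpow (ivec khat) 4)
               + contract 2 \<rho>\<^sub>2 (tpow (ivec khat) 2) * of_real (\<omega>hat\<^sup>2))"
    and N: "\<And>\<epsilon>. N \<epsilon> =
        \<epsilon> * contract 2 \<mu>\<^sub>0 (e \<otimes>\<^bsub>1\<^esub> tpow (ivec khat) 1)
      - \<epsilon>^2 * contract 3 (tsym' (\<mu>\<^sub>0 \<otimes>\<^bsub>2\<^esub> (\<lambda>ix. \<rho>\<^sub>1 ix / \<rho>\<^sub>0))) (e \<otimes>\<^bsub>1\<^esub> tpow (ivec khat) 2)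
      + \<epsilon>^2 * contract 3 \<mu>t\<^sub>1 (e \<otimes>\<^bsub>1\<^esub> tpow (ivec khat) 2)
      + \<epsilon>^2 * of_real (\<omega>hat\<^sup>2) * contract 1 \<rho>\<^sub>1 e
      + \<epsilon>^3 * contract 4 \<mu>t\<^sub>2 (e \<otimes>\<^bsub>1\<^esub> tpow (ivec khat) 3)
      + \<epsilon>^3 * of_real (\<omega>hat\<^sup>2) * contract 2 \<rho>t\<^sub>2 (e \<otimes>\<^bsub>1\<^esub> tpow (ivec khat) 1)
      - \<epsilon>^3 * of_real (\<omega>hat\<^sup>2)
          * contract 2 (tmean l (\<lambda>x ix. of_real (\<rho> x) * (\<chi>\<^sub>1 x \<otimes>\<^bsub>1\<^esub> \<chi>\<^sub>1 x) ix))
              (e \<otimes>\<^bsub>1\<^esub> tpow (ivec khat) 1)"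
  shows "(\<lambda>\<epsilon>. Z (of_real \<epsilon>) * cell_mean l (v \<epsilon>) - N (of_real \<epsilon>))
           \<in> O[at_right 0](\<lambda>\<epsilon>. of_real \<epsilon> ^ 4)"
proof -
  interpret elliptic_cell l G \<rho>
    by unfold_locales (use cell coefficients in auto)

  \<comment> \<open>Contracted fields and evaluation rules\<close>
  define \<kappa> where "\<kappa> = ivec khat"
  define J :: "complex^'d" where "J = axis j 1"
  define P where "P n = tpow \<kappa> n" for n
  \<comment> \<open>\<open>V n\<close> has the dipole direction in its first slot and
    \<open>n\<close> copies of \<kappa> after it, so it is a tensor of order \<open>n + 1\<close>,
    whereas \<open>P n\<close> has order \<open>n\<close>.\<close>
  define V where "V n = tvec J \<otimes>\<^bsub>1\<^esub> tpow \<kappa> n" for n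
  let ?D = "\<lambda>n D W x. \<chi> a. contract n (\<lambda>ix. D x (a # ix)) W"
  define w1 w2 w3 X t2 t3 where w: "w1 = (\<lambda>x. contract 1 (\<chi>\<^sub>1 x) (P 1))" "w2 = (\<lambda>x. contract 2 (\<chi>\<^sub>2 x) (P 2))"
    "w3 = (\<lambda>x. contract 3 (\<chi>\<^sub>3 x) (P 3))" "X = (\<lambda>x. contract 1 (\<chi>\<^sub>1 x) (V 0))"
    "t2 = (\<lambda>x. contract 2 (\<chi>t\<^sub>2 x) (V 1))" "t3 = (\<lambda>x. contract 3 (\<chi>t\<^sub>3 x) (V 2))"
  define Dw1 Dw2 Dw3 DX Dt2 Dt3 where Dw: "Dw1 = ?D 1 D\<chi>\<^sub>1 (P 1)" "Dw2 = ?D 2 D\<chi>\<^sub>2 (P 2)" "Dw3 = ?D 3 D\<chi>\<^sub>3 (P 3)"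
    "DX = ?D 1 D\<chi>\<^sub>1 (V 0)" "Dt2 = ?D 2 D\<chi>t\<^sub>2 (V 1)" "Dt3 = ?D 3 D\<chi>t\<^sub>3 (V 2)"
  let ?W1 = "\<lambda>x. Dw1 x + \<kappa>" and ?W2 = "\<lambda>x. Dw2 x + w1 x *s \<kappa>" and ?W3 = "\<lambda>x. Dw3 x + w2 x *s \<kappa>"
  let ?X1 = "\<lambda>x. DX x + J" and ?T2 = "\<lambda>x. Dt2 x + X x *s \<kappa>" and ?T3 = "\<lambda>x. Dt3 x + t2 x *s \<kappa>"
  let ?k = "\<lambda>x::real^'d. \<kappa>" and ?o = "\<lambda>x::real^'d. 1::complex"

  have t: "tensor_H1p0 l 1 \<chi>\<^sub>1 D\<chi>\<^sub>1" "tensor_H1p0 l 2 \<chi>\<^sub>2 D\<chi>\<^sub>2" "tensor_H1p0 l 3 \<chi>\<^sub>3 D\<chi>\<^sub>3"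
    "tensor_H1p0 l 2 \<chi>t\<^sub>2 D\<chi>t\<^sub>2" "tensor_H1p0 l 3 \<chi>t\<^sub>3 D\<chi>t\<^sub>3"
    using cell_functions by (auto simp: cell1_def cell2_def cell3_def tilde_cell2_def tilde_cell3_def)
  note H = tensor_contract_H1p[OF t(1), of "P 1"] tensor_contract_H1p[OF t(2), of "P 2"]
    tensor_contract_H1p[OF t(3), of "P 3"] tensor_contract_H1p[OF t(1), of "V 0"]
    tensor_contract_H1p[OF t(4), of "V 1"] tensor_contract_H1p[OF t(5), of "V 2"]
  note H = H[folded w Dw]
  note L = H1p_L2_on(1)[OF H(1)] H1p_L2_on(1)[OF H(2)] H1p_L2_on(1)[OF H(3)] H1p_L2_on(1)[OF H(4)]
    H1p_L2_on(1)[OF H(5)] H1p_L2_on(1)[OF H(6)]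
  note LD = H1p_L2_on(2)[OF H(1)] H1p_L2_on(2)[OF H(2)] H1p_L2_on(2)[OF H(3)] H1p_L2_on(2)[OF H(4)]
    H1p_L2_on(2)[OF H(5)] H1p_L2_on(2)[OF H(6)]
  note T\<chi> = tensor_L2_on(1)[OF t(1)] tensor_L2_on(1)[OF t(2)] tensor_L2_on(1)[OF t(3)]
     tensor_L2_on(1)[OF t(4)] tensor_L2_on(1)[OF t(5)]
  note TD = tensor_L2_on(2)[OF t(1)] tensor_L2_on(2)[OF t(2)] tensor_L2_on(2)[OF t(3)]
     tensor_L2_on(2)[OF t(4)] tensor_L2_on(2)[OF t(5)]
  have LW: "L2v ?W1" "L2v ?W2" "L2v ?W3" "L2v ?X1" "L2v ?T2" "L2v ?T3"
    by (intro L2_on_add L2_on_const L2_on_scale_vec L LD)+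
  have P1: "P 1 = tvec \<kappa> \<otimes>\<^bsub>1\<^esub> tpow \<kappa> 0" unfolding P_def by (rule tpow_1)
  \<comment> \<open>These instances, folded to \<open>P\<close> and \<open>V\<close> at fixed
    orders, evaluate every contraction by rewriting and avoid expanding sums over index
    lists.\<close>
  note Gr = bdot_grad_tpow[of 1 _ \<kappa>, unfolded Suc_numerals, folded P_def] bdot_grad_tpow[of 2 _ \<kappa>, unfolded Suc_numerals, folded P_def]
    bdot_grad_tpow[of 3 _ \<kappa>, unfolded Suc_numerals, folded P_def]
  note Gt = bdot_grad_dipole[of 0 _ J \<kappa>, unfolded Suc_numerals, folded V_def]
    bdot_grad_dipole[of 1 _ J \<kappa>, unfolded Suc_numerals, folded V_def]
    bdot_grad_dipole[of 2 _ J \<kappa>, unfolded Suc_numerals, folded V_def]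
  note sl = contract_tsym'_slice[of 1 _ _ \<kappa>, folded P_def] contract_tsym'_slice[of 2 _ _ \<kappa>, folded P_def]
    contract_tsym'_slice[of 3 _ _ \<kappa>, folded P_def]
  note sy = contract_tsym[of _ _ \<kappa>, folded P_def]
  note sy' = contract_tsym'[of 1 _ J \<kappa>, unfolded Suc_numerals, folded V_def]
    contract_tsym'[of 2 _ J \<kappa>, unfolded Suc_numerals, folded V_def]
    contract_tsym'[of 3 _ J \<kappa>, unfolded Suc_numerals, folded V_def]
  note ti = contract_tI_slice[of 1 _ _ \<kappa>, unfolded Suc_numerals, folded P_def]
    contract_tI_slice[of 2 _ _ \<kappa>, unfolded Suc_numerals, folded P_def]
  note fl = contract_flux_transp_slice[of 0 _ _ _ J \<kappa>, unfolded Suc_numerals, folded V_def]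
    contract_flux_transp_slice[of 1 _ _ _ J \<kappa>, unfolded Suc_numerals, folded V_def]
  have I: "contract 2 tI (P 2) = bdot \<kappa> \<kappa>" "contract 2 tI (V 1) = bdot J \<kappa>"
    unfolding P_def V_def tpow_2 by (rule contract_tI_bdot)+
  note pr = contract_tprod_tpow[of 2 1 _ _ \<kappa>, unfolded add_numerals, folded P_def]
    contract_tprod_tpow[of 2 2 _ _ \<kappa>, unfolded add_numerals, folded P_def]
    contract_tprod_tpow[of 1 2 _ _ \<kappa>, unfolded add_numerals, folded P_def]
  note prd = contract_tprod_dipole[of 0 2 _ _ J \<kappa>, unfolded Suc_numerals add_numerals, folded P_def V_def]
    contract_tprod_dipole[of 1 2 _ _ J \<kappa>, unfolded Suc_numerals add_numerals, folded P_def V_def]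
    contract_tprod_dipole[of 1 1 _ _ J \<kappa>, unfolded Suc_numerals add_numerals, folded P_def V_def]
    contract_tprod_dipole[of 0 1 _ _ J \<kappa>, unfolded Suc_numerals add_numerals, folded P_def V_def]
  note lin = contract_add contract_diff contract_cmult contract_divide
  have ev: "contract 1 (\<chi>\<^sub>1 x) (P 1) = w1 x" "contract 2 (\<chi>\<^sub>2 x) (P 2) = w2 x"
    "contract 1 (\<chi>\<^sub>1 x) (V 0) = X x" "contract 2 (\<chi>t\<^sub>2 x) (V 1) = t2 x"
    "contract 2 (\<lambda>ix. D\<chi>\<^sub>2 x (a # ix)) (P 2) = Dw2 x $ a"
    "contract 3 (\<lambda>ix. D\<chi>\<^sub>3 x (a # ix)) (P 3) = Dw3 x $ a"
    "contract 2 (\<lambda>ix. D\<chi>t\<^sub>2 x (a # ix)) (V 1) = Dt2 x $ a"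
    "contract 3 (\<lambda>ix. D\<chi>t\<^sub>3 x (a # ix)) (V 2) = Dt3 x $ a"
    "contract 2 (D\<chi>\<^sub>1 x) (P 2) = bdot (Dw1 x) \<kappa>" "contract 3 (D\<chi>\<^sub>2 x) (P 3) = bdot (Dw2 x) \<kappa>"
    "contract 4 (D\<chi>\<^sub>3 x) (P 4) = bdot (Dw3 x) \<kappa>" "contract 2 (ttransp (D\<chi>\<^sub>1 x)) (V 1) = bdot (DX x) \<kappa>"
    "contract 3 (ttransp (D\<chi>t\<^sub>2 x)) (V 2) = bdot (Dt2 x) \<kappa>"
    "contract 4 (ttransp (D\<chi>t\<^sub>3 x)) (V 3) = bdot (Dt3 x) \<kappa>" for x a
    by (simp_all only: w Dw Gr Gt vec_lambda_beta)
  note ev = ev lin sl sy sy' ti fl I pr prd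
  note L2I = L2_on_G L2_on_density L2_on_density_const L2_on_diff L2_on_add L2_on_const L2_on_divide
    L2_on_cmult L2_on_tsym L2_on_flux_transp L2_on_ttransp L2_on_tprod T\<chi> TD
  note vec = vector_add_component vector_smult_component

  \<comment> \<open>The coefficients as energy and mass pairings\<close>
  have mu: "contract 2 \<mu>\<^sub>0 (P 2) = energy ?W1 ?k"
  proof -
    have "contract 2 \<mu>\<^sub>0 (P 2) = cell_mean l (\<lambda>x. contract 2 (\<lambda>ix. of_real (G x) * (D\<chi>\<^sub>1 x ix + tI ix)) (P 2))"
      unfolding mu0 sy by (rule contract_tmean, intro L2_on_integrable L2I; simp)
    then show ?thesis by (simp only: ev) (simp add: cell_mean_eq energy_def bdot_add_left)
  qed
  have nu: "contract 2 \<mu>\<^sub>0 (V 1) = energy ?X1 ?k"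
  proof -
    have "contract 2 \<mu>\<^sub>0 (V 1) = contract 2 (tmean l (\<lambda>x ix. of_real (G x) * (ttransp (D\<chi>\<^sub>1 x) ix + tI ix))) (V 1)"
    proof (rule contract_cong)
      fix ix :: "'d list" assume "length ix = 2"
      then obtain a b where ix: "ix = [a, b]"
        by (auto simp: length_Suc_conv numeral_2_eq_2)
      \<comment> \<open>Symmetry of the homogenised tensor makes the symmetrisation trivial and
        permits exchanging the two indices. The derivative index then meets \<kappa> and the
        corrector index meets the dipole direction.\<close>
      have "\<mu>\<^sub>0 ix = tmean l (\<lambda>x ix. of_real (G x) * (D\<chi>\<^sub>1 x ix + tI ix)) [b, a]"
        unfolding ix mu0 using stiffness_symmetric[OF cell_functions(1), of a b] by (simp add: tsym_2)
      also have "\<dots> = tmean l (\<lambda>x ix. of_real (G x) * (ttransp (D\<chi>\<^sub>1 x) ix + tI ix)) ix"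
        unfolding ix by (simp add: tmean_def tI_def eq_commute)
      finally show "\<mu>\<^sub>0 ix = tmean l (\<lambda>x ix. of_real (G x) * (ttransp (D\<chi>\<^sub>1 x) ix + tI ix)) ix" .
    qed
    also have "\<dots> = cell_mean l (\<lambda>x. contract 2 (\<lambda>ix. of_real (G x) * (ttransp (D\<chi>\<^sub>1 x) ix + tI ix)) (V 1))"
      by (rule contract_tmean, intro L2_on_integrable L2I; simp)
    finally show ?thesis by (simp only: ev) (simp add: cell_mean_eq energy_def bdot_add_left)
  qed
  have mt1: "contract 3 \<mu>t\<^sub>1 (V 2) = energy ?T2 ?k"
  proof -
    have "contract 3 \<mu>t\<^sub>1 (V 2) = cell_mean l (\<lambda>x. contract 3 (\<lambda>ix.
        of_real (G x) * (ttransp (D\<chi>t\<^sub>2 x) ix + (\<chi>\<^sub>1 x \<otimes>\<^bsub>1\<^esub> tI) ix)) (V 2))"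
      unfolding mut1 sy' by (rule contract_tmean, intro L2_on_integrable L2I; simp)
    then show ?thesis by (simp only: ev) (simp add: cell_mean_eq energy_def bdot_add_left bdot_scale_left)
  qed
  have mt2: "contract 4 \<mu>t\<^sub>2 (V 3) = energy ?T3 ?k"
  proof -
    have "contract 4 \<mu>t\<^sub>2 (V 3) = cell_mean l (\<lambda>x. contract 4 (\<lambda>ix.
        of_real (G x) * (ttransp (D\<chi>t\<^sub>3 x) ix + (\<chi>t\<^sub>2 x \<otimes>\<^bsub>2\<^esub> tI) ix)) (V 3))"
      unfolding mut2 sy' by (rule contract_tmean, intro L2_on_integrable L2I; simp)
    then show ?thesis by (simp only: ev) (simp add: cell_mean_eq energy_def bdot_add_left bdot_scale_left)
  qed
  have m2: "contract 4 \<mu>\<^sub>2 (P 4) = energy ?W3 ?k"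
  proof -
    have "contract 4 \<mu>\<^sub>2 (P 4) = cell_mean l (\<lambda>x. contract 4 (\<lambda>ix.
        of_real (G x) * (D\<chi>\<^sub>3 x ix + (tI \<otimes>\<^bsub>2\<^esub> \<chi>\<^sub>2 x) ix)) (P 4))"
      unfolding mu2 sy by (rule contract_tmean, intro L2_on_integrable L2I; simp)
    then show ?thesis
      by (simp only: ev) (simp add: cell_mean_eq energy_def bdot_add_left bdot_scale_left mult.commute)
  qed
  have r1: "contract 1 \<rho>\<^sub>1 (P 1) = mass w1 ?o" "contract 1 \<rho>\<^sub>1 (V 0) = mass X ?o"
    and r2: "contract 2 \<rho>\<^sub>2 (P 2) = mass w2 ?o" and rt2: "contract 2 \<rho>t\<^sub>2 (V 1) = mass t2 ?o"
  proof -
    have "contract 1 \<rho>\<^sub>1 W = cell_mean l (\<lambda>x. contract 1 (\<lambda>ix. of_real (\<rho> x) * \<chi>\<^sub>1 x ix) W)" for W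
      unfolding rho1 by (rule contract_tmean, intro L2_on_integrable L2I; simp)
    then show "contract 1 \<rho>\<^sub>1 (P 1) = mass w1 ?o" "contract 1 \<rho>\<^sub>1 (V 0) = mass X ?o"
      by (simp_all only: ev) (simp_all add: cell_mean_eq mass_def)
    have "contract 2 \<rho>\<^sub>2 (P 2) = cell_mean l (\<lambda>x. contract 2 (\<lambda>ix. of_real (\<rho> x) * \<chi>\<^sub>2 x ix) (P 2))"
      unfolding rho2 by (rule contract_tmean, intro L2_on_integrable L2I; simp)
    then show "contract 2 \<rho>\<^sub>2 (P 2) = mass w2 ?o"
      by (simp only: ev) (simp add: cell_mean_eq mass_def)
    have "contract 2 \<rho>t\<^sub>2 (V 1) = cell_mean l (\<lambda>x. contract 2 (\<lambda>ix. of_real (\<rho> x) * \<chi>t\<^sub>2 x ix) (V 1))"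
      unfolding rhot2 by (rule contract_tmean, intro L2_on_integrable L2I; simp)
    then show "contract 2 \<rho>t\<^sub>2 (V 1) = mass t2 ?o"
      by (simp only: ev) (simp add: cell_mean_eq mass_def)
  qed
  have xx: "contract 2 (tmean l (\<lambda>x ix. of_real (\<rho> x) * (\<chi>\<^sub>1 x \<otimes>\<^bsub>1\<^esub> \<chi>\<^sub>1 x) ix)) (V 1) = mass X w1"
  proof -
    have "contract 2 (tmean l (\<lambda>x ix. of_real (\<rho> x) * (\<chi>\<^sub>1 x \<otimes>\<^bsub>1\<^esub> \<chi>\<^sub>1 x) ix)) (V 1)
        = cell_mean l (\<lambda>x. contract 2 (\<lambda>ix. of_real (\<rho> x) * (\<chi>\<^sub>1 x \<otimes>\<^bsub>1\<^esub> \<chi>\<^sub>1 x) ix) (V 1))"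
    proof (rule contract_tmean)
      fix ix :: "'d list" assume ix: "length ix = 2"
      show "integrable M (\<lambda>x. of_real (\<rho> x) * (\<chi>\<^sub>1 x \<otimes>\<^bsub>1\<^esub> \<chi>\<^sub>1 x) ix)"
        \<comment> \<open>A product of two square integrable correctors need not be square
          integrable, so integrability is taken directly from the mass pairing.\<close>
        unfolding tprod_def mult.assoc[symmetric]
        by (intro mass_integrable T\<chi>(1)) (use ix in simp_all)
    qed
    then show ?thesis by (simp only: ev) (simp add: cell_mean_eq mass_def mult.assoc)
  qed
  have pt: "contract 3 (tsym' (\<mu>\<^sub>0 \<otimes>\<^bsub>2\<^esub> (\<lambda>ix. \<rho>\<^sub>1 ix / \<rho>\<^sub>0))) (V 2) = energy ?X1 ?k * mass w1 ?o / \<rho>\<^sub>0"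
    by (simp only: ev nu r1) simp

  \<comment> \<open>The contracted cell problems\<close>
  have e1: "energy ?W1 D\<phi> = 0" and eX: "energy ?X1 D\<phi> = 0" if "H1p l \<phi> D\<phi>" for \<phi> D\<phi>
    using cell1_direction[OF cell_functions(1) that] by (simp_all only: Dw P1 V_def)
  have e2: "energy ?W2 D\<phi> = energy ?W1 (\<lambda>x. \<phi> x *s \<kappa>) - energy ?W1 ?k / \<rho>\<^sub>0 * mass ?o \<phi>"
    if \<phi>: "H1p l \<phi> D\<phi>" for \<phi> D\<phi>
  proof -
    have "energy ?W2 D\<phi> = energy ?W1 (\<lambda>x. \<phi> x *s \<kappa>) - mass (\<lambda>x. energy ?W1 ?k / \<rho>\<^sub>0) \<phi> - 0 * cell_mean l \<phi>"
    proof (rule contracted_cell_equation[where W = "P 2", OF cell_functions(2)[unfolded cell2_def, THEN conjunct2]])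
      show "L2v (\<lambda>x. of_real (G x) * (D\<chi>\<^sub>2 x ix + tsym' (tI \<otimes>\<^bsub>2\<^esub> \<chi>\<^sub>1 x) ix))" if "length ix = Suc 2" for ix
        using that by (intro L2I; simp)
      show "L2v (\<lambda>x. of_real (G x) * (tsym (D\<chi>\<^sub>1 x) ix + tI ix) - of_real (\<rho> x / cell_mean l \<rho>) * \<mu>\<^sub>0 ix)"
        if "length ix = 2" for ix
        using that by (intro L2I; simp)
    qed (intro LW L2_on_const \<phi> | simp only: ev mu vec, simp add: rho0 bdot_add_left algebra_simps)+
    then show ?thesis by (simp add: mass_const[of "energy ?W1 ?k / \<rho>\<^sub>0"])
  qed
  have e3: "energy ?W3 D\<phi> = energy ?W2 (\<lambda>x. \<phi> x *s \<kappa>) - energy ?W1 ?k / \<rho>\<^sub>0 * mass w1 \<phi>"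
    if \<phi>: "H1p l \<phi> D\<phi>" for \<phi> D\<phi>
  proof -
    have "energy ?W3 D\<phi> = energy ?W2 (\<lambda>x. \<phi> x *s \<kappa>) - mass (\<lambda>x. energy ?W1 ?k / \<rho>\<^sub>0 * w1 x) \<phi> - 0 * cell_mean l \<phi>"
    proof (rule contracted_cell_equation[where W = "P 3", OF cell_functions(3)[unfolded cell3_def, THEN conjunct2]])
      show "L2v (\<lambda>x. of_real (G x) * (D\<chi>\<^sub>3 x ix + tsym' (tI \<otimes>\<^bsub>2\<^esub> \<chi>\<^sub>2 x) ix))" if "length ix = Suc 3" for ix
        using that by (intro L2I; simp)
      show "L2v (\<lambda>x. of_real (G x) * (tsym (D\<chi>\<^sub>2 x) ix + tsym (tI \<otimes>\<^bsub>2\<^esub> \<chi>\<^sub>1 x) ix)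
          - of_real (1 / cell_mean l \<rho>) * tsym (\<lambda>jx. of_real (\<rho> x) * (\<chi>\<^sub>1 x \<otimes>\<^bsub>1\<^esub> \<mu>\<^sub>0) jx) ix)"
        if "length ix = 3" for ix
        using that by (intro L2I; simp)
    qed (intro LW L2_on_cmult L \<phi> | simp only: ev mu vec, simp add: rho0 bdot_add_left bdot_scale_left algebra_simps)+
    then show ?thesis unfolding mass_cmult by simp
  qed
  have et2: "energy ?T2 D\<phi> = energy ?X1 (\<lambda>x. \<phi> x *s \<kappa>) - energy ?X1 ?k / \<rho>\<^sub>0 * mass ?o \<phi>"
    if \<phi>: "H1p l \<phi> D\<phi>" for \<phi> D\<phi>
  proof -
    have "energy ?T2 D\<phi> = energy ?X1 (\<lambda>x. \<phi> x *s \<kappa>) - mass (\<lambda>x. energy ?X1 ?k / \<rho>\<^sub>0) \<phi> - 0 * cell_mean l \<phi>"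
    proof (rule contracted_cell_equation[where W = "V 1", OF cell_functions(4)[unfolded tilde_cell2_def, THEN conjunct2]])
      show "L2v (\<lambda>x. of_real (G x) * D\<chi>t\<^sub>2 x ix
          + flux_transp (\<lambda>jx. of_real (G x) * (tI \<otimes>\<^bsub>2\<^esub> \<chi>\<^sub>1 x) jx) ix)" if "length ix = Suc 2" for ix
        using that by (intro L2I; simp)
      show "L2v (\<lambda>x. of_real (G x) * (ttransp (D\<chi>\<^sub>1 x) ix + tI ix) - of_real (\<rho> x / cell_mean l \<rho>) * \<mu>\<^sub>0 ix)"
        if "length ix = 2" for ix
        using that by (intro L2I; simp)
    qed (intro LW L2_on_const \<phi> | simp only: ev nu vec, simp add: rho0 bdot_add_left algebra_simps)+
    then show ?thesis by (simp add: mass_const[of "energy ?X1 ?k / \<rho>\<^sub>0"])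
  qed
  have et3: "energy ?T3 D\<phi> = energy ?T2 (\<lambda>x. \<phi> x *s \<kappa>) - energy ?T2 ?k * cell_mean l \<phi>
      - energy ?X1 ?k / \<rho>\<^sub>0 * (mass w1 \<phi> - mass w1 ?o * cell_mean l \<phi>)"
    if \<phi>: "H1p l \<phi> D\<phi>" for \<phi> D\<phi>
  proof -
    \<comment> \<open>The symmetrised product of \<open>\<mu>\<^sub>0\<close> with
      \<open>\<rho> \<chi>\<^sub>1 - \<rho>\<^sub>1\<close> splits: the first part is a density
      source proportional to \<open>w1\<close>, the second joins \<open>\<mu>t\<^sub>1\<close> in
      the constant source.\<close>
    have "energy ?T3 D\<phi> = energy ?T2 (\<lambda>x. \<phi> x *s \<kappa>) - mass (\<lambda>x. energy ?X1 ?k / \<rho>\<^sub>0 * w1 x) \<phi>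
        - (energy ?T2 ?k - energy ?X1 ?k / \<rho>\<^sub>0 * mass w1 ?o) * cell_mean l \<phi>"
    proof (rule contracted_cell_equation[where W = "V 2", OF cell_functions(5)[unfolded tilde_cell3_def, THEN conjunct2]])
      show "L2v (\<lambda>x. of_real (G x) * D\<chi>t\<^sub>3 x ix
          + flux_transp (\<lambda>jx. of_real (G x) * (tI \<otimes>\<^bsub>2\<^esub> \<chi>t\<^sub>2 x) jx) ix)" if "length ix = Suc 3" for ix
        using that by (intro L2I; simp)
      show "L2v (\<lambda>x. of_real (G x) * ((\<chi>\<^sub>1 x \<otimes>\<^bsub>1\<^esub> tI) ix + tsym' (ttransp (D\<chi>t\<^sub>2 x)) ix) - \<mu>t\<^sub>1 ix
          - tsym' (\<mu>\<^sub>0 \<otimes>\<^bsub>2\<^esub> (\<lambda>jx. (of_real (\<rho> x) * \<chi>\<^sub>1 x jx - \<rho>\<^sub>1 jx) / of_real (cell_mean l \<rho>))) ix)"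
        if "length ix = 3" for ix
        using that by (intro L2I; simp)
    qed (intro LW L2_on_cmult L \<phi> | simp only: ev nu mt1 r1 vec, simp add: rho0 bdot_add_left bdot_scale_left diff_divide_distrib algebra_simps)+
    then show ?thesis
      unfolding mass_cmult by (simp add: algebra_simps)
  qed

  \<comment> \<open>The hierarchy in terms of pairings\<close>
  have vneg: "vh (-2) = (\<lambda>x. 0)" "vh (-1) = (\<lambda>x. 0)" "Dvh (-1) = (\<lambda>x. 0)"
    and vh: "\<And>n. n \<in> {0..5} \<Longrightarrow> H1p l (vh n) (Dvh n)"
    using hierarchy unfolding dipole_hierarchy_def by auto
  have L2vh: "L2v (vh n)" "L2v (Dvh n)" if "n \<in> {-1..5}" for n
  proof -
    have "n = -1 \<or> n \<in> {0..5}" using that by auto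
    then show "L2v (vh n)" "L2v (Dvh n)"
      using vneg H1p_L2_on[OF vh, of n] by (auto simp: L2_on_const)
  qed
  \<comment> \<open>The equation of order 0 refers back to \<open>vh (- 2)\<close>, so the range
    extends two steps below zero.\<close>
  have L2vh': "L2v (vh n)" if "n \<in> {-2..5}" for n
  proof -
    have "n = -2 \<or> n \<in> {-1..5}" using that by auto
    then show ?thesis using vneg L2vh(1)[of n] by (auto simp: L2_on_const)
  qed
  let ?U = "\<lambda>n x. Dvh n x + vh (n - 1) x *s \<kappa> - (if n = 2 then J else 0)"
  have eq: "energy (?U n) D\<phi> = energy (?U (n - 1)) (\<lambda>x. \<phi> x *s \<kappa>) + of_real (\<omega>hat\<^sup>2) * mass (vh (n - 2)) \<phi>"
    if n: "n \<in> {0..5}" and \<phi>: "H1p l \<phi> D\<phi>" for n \<phi> D\<phi>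
  proof (rule weak_eq_energy[OF _ _ _ \<phi>])
    \<comment> \<open>The same field \<open>?U\<close> appears in both flux positions of the
      hierarchy: shifting its index by one turns the dipole term at \<open>n = 2\<close> into the
      one at \<open>n = 3\<close>.\<close>
    have i: "n - 1 - 1 = n - 2" "(n - 1 = 2) = (n = 3)" by auto
    show "weak_eq l (\<lambda>x. of_real (G x) *s ?U n x)
      (\<lambda>x. bdot \<kappa> (of_real (G x) *s ?U (n - 1) x) + of_real (\<omega>hat\<^sup>2 * \<rho> x) * vh (n - 2) x)"
      unfolding i using hierarchy n unfolding dipole_hierarchy_def \<kappa>_def J_def by blast
    show "L2v (?U (n - 1))"
      using n by (intro L2_on_diff L2_on_add L2_on_const L2_on_scale_vec L2vh(2) L2vh') auto
    show "L2v (vh (n - 2))" using n by (intro L2vh') auto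
  qed

  \<comment> \<open>Effective impedance, numerator and conclusion\<close>
  have nd: "energy ?W1 ?k + of_real (cell_mean l \<rho>) * of_real (\<omega>hat\<^sup>2) \<noteq> 0"
    using nondegenerate unfolding \<kappa>_def[symmetric] P_def[symmetric] mu rho0 .
  note mean = tensor_contract_mean[OF t(1), of "P 1", folded w(1)] tensor_contract_mean[OF t(2), of "P 2", folded w(2)]
    tensor_contract_mean[OF t(1), of "V 0", folded w(4)] tensor_contract_mean[OF t(4), of "V 1", folded w(5)]
  note coeffs = dipole_mean_coefficients[OF H mean e1 e2[unfolded rho0] e3[unfolded rho0] eX et2[unfolded rho0]
      et3[unfolded rho0] vneg vh eq nd]
  have Zn: "Z \<epsilon> = \<epsilon> ^ 2 * (energy ?W1 ?k + \<rho>\<^sub>0 * of_real (\<omega>hat\<^sup>2)) + \<epsilon> ^ 4 * (energy ?W3 ?k + mass w2 ?o * of_real (\<omega>hat\<^sup>2))" for \<epsilon>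
    unfolding Z by (simp only: \<kappa>_def[symmetric] P_def[symmetric] mu m2 r2)
  have V0: "contract 1 \<rho>\<^sub>1 (tvec J) = contract 1 \<rho>\<^sub>1 (V 0)"
    unfolding V_def contract_1 ..
  have Nn: "N \<epsilon> = \<epsilon> * energy ?X1 ?k
      + \<epsilon> ^ 2 * (energy ?T2 ?k - energy ?X1 ?k * mass w1 ?o / \<rho>\<^sub>0 + of_real (\<omega>hat\<^sup>2) * mass X ?o)
      + \<epsilon> ^ 3 * (energy ?T3 ?k + of_real (\<omega>hat\<^sup>2) * mass t2 ?o - of_real (\<omega>hat\<^sup>2) * mass X w1)" for \<epsilon>
    unfolding N e
    by (simp only: \<kappa>_def[symmetric] J_def[symmetric] V0 V_def[symmetric] nu pt mt1 r1 mt2 rt2 xx) (simp add: algebra_simps)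
  show ?thesis
    unfolding Zn Nn
    by (rule bigo_effective_equation[OF expansion]) (use coeffs in \<open>simp_all only: rho0\<close>)
qed

end
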